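(* Let $p$ be a prime, $m \ge 0$ an integer, and let $f \in (\mathbb{Z}/p^{m+1})[x_1, \dots, x_n]$ be a nonzerodivisor. Then the $C_m$-module $N_f$ is supported at a finite number of $p$-adic integers; that is, there are only finitely many $\alpha \in \mathbb{Z}_p$ such that the localization of $N_f$ at the maximal ideal $\mathfrak{m}_\alpha \subseteq C_m$ is nonzero.
   Context: Let $A = \mathbb{Z}/p^{m+1}$ and $R = A[x_1,\dots,x_n]$. For a commutative $A$-algebra $S$, let $\mathcal{D}_S \subseteq \operatorname{End}_A(S)$ be the ring of $A$-linear differential operators on $S$ in Grothendieck's sense: with $S \otimes_A S$ acting on $\operatorname{End}_A(S)$ by $((r\otimes s)\cdot\varphi)(x) = r\varphi(sx)$ and $J = \ker(S\otimes_A S \to S)$ the kernel of multiplication, $\mathcal{D}_S = \{\varphi : J^n\cdot \varphi = 0 \text{ for some } n \gg 0\}$. Grade $R[t]$ by $\deg R = 0$, $\deg t = 1$; this induces a $\mathbb{Z}$-grading on $\mathcal{D}_{R[t]}$, with degree-zero subring $(\mathcal{D}_{R[t]})_0$. Localizations of $R[t]$ carry the unique $\mathcal{D}_{R[t]}$-module structures extending that on $R[t]$. Let $H_f = R[t, f^{-1}, (f-t)^{-1}] / R[t, f^{-1}]$, let $\delta_0 \in H_f$ be the class of $(f-t)^{-1}$, and let $N_f = \big((\mathcal{D}_{R[t]})_0 \cdot \delta_0\big) / \big((\mathcal{D}_{R[t]})_0 \cdot f\delta_0\big)$. Let $C_m = (\mathcal{D}_{A[t]})_0$ be the ring of degree-zero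 $A$-linear differential operators on $A[t]$ ($\deg t=1$). It is generated as an $A$-algebra by the operators $-\partial_t^{[p^i]}t^{p^i}$, $i \ge 0$, where $\partial_t^{[k]}(t^a) = \binom{a}{k}t^{a-k}$. It acts on $N_f$ via the inclusion $C_m \subseteq (\mathcal{D}_{R[t]})_0$ given by extending operators $R$-linearly. For every $P \in C_m$ there is a unique locally constant function $\varphi_P : \mathbb{Z}_p \to A$ with $P(t^a) = \varphi_P(-1-a)t^a$ for all integers $a \ge 0$. For $\alpha \in \mathbb{Z}_p$ put $\mathfrak{m}_\alpha = \{P \in C_m : \varphi_P(\alpha) \in (p)\}$; the ideals $\mathfrak{m}_\alpha$ are precisely the prime ideals of $C_m$, and $\operatorname{Spec}(C_m)$ is identified with $\mathbb{Z}_p$ in this way. The $\alpha$ for which $(N_f)_{\mathfrak{m}_\alpha} \neq 0$ are called the Bernstein--Sato roots of $f$. *)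

theory Defs
  imports
    "Berlekamp_Zassenhaus.Finite_Field"
    "HOL-Algebra.Module"
    "HOL-Algebra.AbelCoset"
    "HOL-Library.Poly_Mapping"
    "HOL-Computational_Algebra.Polynomial"
begin

section \<open>Grothendieck differential operators\<close>

definition linear_endos ::
    "('k, 'x) ring_scheme \<Rightarrow> ('k, 's, 'y) module_scheme \<Rightarrow> ('s \<Rightarrow> 's) set"
  where "linear_endos A S =
    {\<phi> \<in> carrier S \<rightarrow>\<^sub>E carrier S.
      (\<forall>x\<in>carrier S. \<forall>y\<in>carrier S. \<phi> (x \<oplus>\<^bsub>S\<^esub> y) = \<phi> x \<oplus>\<^bsub>S\<^esub> \<phi> y) \<and>
      (\<forall>c\<in>carrier A. \<forall>x\<in>carrier S. \<phi> (c \<odot>\<^bsub>S\<^esub> x) = c \<odot>\<^bsub>S\<^esub> \<phi> x)}"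

text \<open>
  An element of \<open>S \<otimes>\<^sub>A S\<close> is represented by a list of pairs, \<open>[(r\<^sub>1, s\<^sub>1), \<dots>, (r\<^sub>k, s\<^sub>k)]\<close>
  standing for \<open>r\<^sub>1 \<otimes> s\<^sub>1 + \<dots> + r\<^sub>k \<otimes> s\<^sub>k\<close>; addition is concatenation of lists.
  The action on endomorphisms and the multiplication map below are defined on representatives
  and are compatible with the relations of the tensor product (lemmas \<open>tensor_act_*\<close>,
  \<open>tensor_mu_*\<close>), so quantifying over representatives of \<open>J\<^sup>n\<close> is quantifying over \<open>J\<^sup>n\<close>.
\<close>

definition tensors :: "('s, 'y) ring_scheme \<Rightarrow> ('s \<times> 's) list set"
  where "tensors S = lists (carrier S \<times> carrier S)"

definition tensor_mu :: "('s, 'y) ring_scheme \<Rightarrow> ('s \<times> 's) list \<Rightarrow> 's"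
  where "tensor_mu S w = foldr (\<lambda>(r, s) y. (r \<otimes>\<^bsub>S\<^esub> s) \<oplus>\<^bsub>S\<^esub> y) w \<zero>\<^bsub>S\<^esub>"

definition tensor_act :: "('s, 'y) ring_scheme \<Rightarrow> ('s \<times> 's) list \<Rightarrow> ('s \<Rightarrow> 's) \<Rightarrow> 's \<Rightarrow> 's"
  where "tensor_act S w \<phi> =
    (\<lambda>x\<in>carrier S. foldr (\<lambda>(r, s) y. (r \<otimes>\<^bsub>S\<^esub> \<phi> (s \<otimes>\<^bsub>S\<^esub> x)) \<oplus>\<^bsub>S\<^esub> y) w \<zero>\<^bsub>S\<^esub>)"

definition tensor_mult ::
    "('s, 'y) ring_scheme \<Rightarrow> ('s \<times> 's) list \<Rightarrow> ('s \<times> 's) list \<Rightarrow> ('s \<times> 's) list"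
  where "tensor_mult S v w = [(r \<otimes>\<^bsub>S\<^esub> r', s \<otimes>\<^bsub>S\<^esub> s'). (r, s) \<leftarrow> v, (r', s') \<leftarrow> w]"

definition diagonal_ideal :: "('s, 'y) ring_scheme \<Rightarrow> ('s \<times> 's) list set"
  where "diagonal_ideal S = {w \<in> tensors S. tensor_mu S w = \<zero>\<^bsub>S\<^esub>}"

lemma tensor_mu_Cons [simp]:
  "tensor_mu S ((r, s) # w) = (r \<otimes>\<^bsub>S\<^esub> s) \<oplus>\<^bsub>S\<^esub> tensor_mu S w"
  by (simp add: tensor_mu_def)

lemma tensor_act_Cons:
  "x \<in> carrier S \<Longrightarrow>
    tensor_act S ((r, s) # w) \<phi> x = (r \<otimes>\<^bsub>S\<^esub> \<phi> (s \<otimes>\<^bsub>S\<^esub> x)) \<oplus>\<^bsub>S\<^esub> tensor_act S w \<phi> x"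
  by (simp add: tensor_act_def)

lemma tensor_mu_Nil [simp]: "tensor_mu S [] = \<zero>\<^bsub>S\<^esub>"
  by (simp add: tensor_mu_def)

lemma tensor_act_Nil: "x \<in> carrier S \<Longrightarrow> tensor_act S [] \<phi> x = \<zero>\<^bsub>S\<^esub>"
  by (simp add: tensor_act_def)

context algebra
begin

lemma linear_endos_closed:
  "\<phi> \<in> linear_endos R M \<Longrightarrow> x \<in> carrier M \<Longrightarrow> \<phi> x \<in> carrier M"
  by (auto simp: linear_endos_def)

lemma smult_move:
  assumes "c \<in> carrier R" "r \<in> carrier M" "s \<in> carrier M"
  shows "r \<otimes>\<^bsub>M\<^esub> (c \<odot>\<^bsub>M\<^esub> s) = (c \<odot>\<^bsub>M\<^esub> r) \<otimes>\<^bsub>M\<^esub> s"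
  using assms m_comm smult_assoc2 smult_closed by metis

lemma tensor_mu_closed: "w \<in> tensors M \<Longrightarrow> tensor_mu M w \<in> carrier M"
  by (induction w) (auto simp: tensors_def)

lemma tensor_act_closed:
  assumes "\<phi> \<in> linear_endos R M" "x \<in> carrier M"
  shows "w \<in> tensors M \<Longrightarrow> tensor_act M w \<phi> x \<in> carrier M"
  by (induction w) (auto simp: tensors_def tensor_act_Cons tensor_act_Nil assms linear_endos_closed)

lemma tensor_mu_append:
  assumes "v \<in> tensors M" "w \<in> tensors M"
  shows "tensor_mu M (v @ w) = tensor_mu M v \<oplus>\<^bsub>M\<^esub> tensor_mu M w"
  using assms
  by (induction v)
     (auto simp: tensors_def tensor_mu_closed[unfolded tensors_def in_lists_conv_set] M.a_assoc)

lemma tensor_act_append: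
  assumes "v \<in> tensors M" "w \<in> tensors M" "\<phi> \<in> linear_endos R M" "x \<in> carrier M"
  shows "tensor_act M (v @ w) \<phi> x = tensor_act M v \<phi> x \<oplus>\<^bsub>M\<^esub> tensor_act M w \<phi> x"
  using assms
  by (induction v)
     (auto simp: tensors_def tensor_act_Cons tensor_act_Nil linear_endos_closed
       tensor_act_closed[unfolded tensors_def in_lists_conv_set] M.a_assoc)

lemma tensor_mu_add_left:
  assumes "r \<in> carrier M" "r' \<in> carrier M" "s \<in> carrier M"
  shows "tensor_mu M [(r \<oplus>\<^bsub>M\<^esub> r', s)] = tensor_mu M [(r, s), (r', s)]"
  using assms by (simp add: l_distr)

lemma tensor_mu_add_right:
  assumes "r \<in> carrier M" "s \<in> carrier M" "s' \<in> carrier M"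
  shows "tensor_mu M [(r, s \<oplus>\<^bsub>M\<^esub> s')] = tensor_mu M [(r, s), (r, s')]"
  using assms by (simp add: r_distr)

lemma tensor_mu_balanced:
  assumes "c \<in> carrier R" "r \<in> carrier M" "s \<in> carrier M"
  shows "tensor_mu M [(c \<odot>\<^bsub>M\<^esub> r, s)] = tensor_mu M [(r, c \<odot>\<^bsub>M\<^esub> s)]"
  using assms by (simp add: smult_move)

lemma tensor_act_add_left:
  assumes "r \<in> carrier M" "r' \<in> carrier M" "s \<in> carrier M" "\<phi> \<in> linear_endos R M" "x \<in> carrier M"
  shows "tensor_act M [(r \<oplus>\<^bsub>M\<^esub> r', s)] \<phi> x = tensor_act M [(r, s), (r', s)] \<phi> x"
  using assms
  by (simp add: tensor_act_Cons tensor_act_Nil linear_endos_closed l_distr)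

lemma tensor_act_add_right:
  assumes "r \<in> carrier M" "s \<in> carrier M" "s' \<in> carrier M" "\<phi> \<in> linear_endos R M" "x \<in> carrier M"
  shows "tensor_act M [(r, s \<oplus>\<^bsub>M\<^esub> s')] \<phi> x = tensor_act M [(r, s), (r, s')] \<phi> x"
proof -
  have "\<phi> ((s \<oplus>\<^bsub>M\<^esub> s') \<otimes>\<^bsub>M\<^esub> x) = \<phi> (s \<otimes>\<^bsub>M\<^esub> x) \<oplus>\<^bsub>M\<^esub> \<phi> (s' \<otimes>\<^bsub>M\<^esub> x)"
    using assms by (simp add: l_distr linear_endos_def)
  then show ?thesis
    using assms by (simp add: tensor_act_Cons tensor_act_Nil linear_endos_closed r_distr)
qed

lemma tensor_act_balanced:
  assumes "c \<in> carrier R" "r \<in> carrier M" "s \<in> carrier M" "\<phi> \<in> linear_endos R M" "x \<in> carrier M"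
  shows "tensor_act M [(c \<odot>\<^bsub>M\<^esub> r, s)] \<phi> x = tensor_act M [(r, c \<odot>\<^bsub>M\<^esub> s)] \<phi> x"
proof -
  have "\<phi> ((c \<odot>\<^bsub>M\<^esub> s) \<otimes>\<^bsub>M\<^esub> x) = c \<odot>\<^bsub>M\<^esub> \<phi> (s \<otimes>\<^bsub>M\<^esub> x)"
    using assms by (simp add: smult_assoc2 linear_endos_def)
  then show ?thesis
    using assms by (simp add: tensor_act_Cons tensor_act_Nil linear_endos_closed smult_move)
qed

end

text \<open>\<open>J\<^sup>n\<^sup>+\<^sup>1\<close> consists of the finite sums of products of an element of \<open>J\<close> and one of \<open>J\<^sup>n\<close>.\<close>

primrec diagonal_ideal_power :: "('s, 'y) ring_scheme \<Rightarrow> nat \<Rightarrow> ('s \<times> 's) list set"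
  where
    "diagonal_ideal_power S 0 = tensors S"
  | "diagonal_ideal_power S (Suc n) =
      concat ` lists {tensor_mult S v w | v w. v \<in> diagonal_ideal S \<and> w \<in> diagonal_ideal_power S n}"

definition diff_ops ::
    "('k, 'x) ring_scheme \<Rightarrow> ('k, 's, 'y) module_scheme \<Rightarrow> ('s \<Rightarrow> 's) set"
  where "diff_ops A S =
    {\<phi> \<in> linear_endos A S.
      \<exists>n. \<forall>w\<in>diagonal_ideal_power S n. tensor_act S w \<phi> = (\<lambda>x\<in>carrier S. \<zero>\<^bsub>S\<^esub>)}"

definition diff_op_ring ::
    "('k, 'x) ring_scheme \<Rightarrow> ('k, 's, 'y) module_scheme \<Rightarrow> ('s \<Rightarrow> 's) ring"
  where "diff_op_ring A S =
    \<lparr>carrier = diff_ops A S,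
     monoid.mult = compose (carrier S),
     monoid.one = (\<lambda>x\<in>carrier S. x),
     ring.zero = (\<lambda>x\<in>carrier S. \<zero>\<^bsub>S\<^esub>),
     ring.add = (\<lambda>\<phi> \<psi>. \<lambda>x\<in>carrier S. \<phi> x \<oplus>\<^bsub>S\<^esub> \<psi> x)\<rparr>"

definition mult_op :: "('s, 'y) ring_scheme \<Rightarrow> 's \<Rightarrow> 's \<Rightarrow> 's"
  where "mult_op S s = (\<lambda>x\<in>carrier S. s \<otimes>\<^bsub>S\<^esub> x)"

text \<open>\<open>G k\<close> is the homogeneous component of degree \<open>k\<close> of the graded algebra \<open>S\<close>.\<close>

definition diff_op_ring_deg0 ::
    "('k, 'x) ring_scheme \<Rightarrow> ('k, 's, 'y) module_scheme \<Rightarrow> (nat \<Rightarrow> 's set) \<Rightarrow> ('s \<Rightarrow> 's) ring"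
  where "diff_op_ring_deg0 A S G =
    (diff_op_ring A S)\<lparr>carrier := {\<phi> \<in> diff_ops A S. \<forall>k. \<phi> ` G k \<subseteq> G k}\<rparr>"


section \<open>Modules\<close>

text \<open>
  Modules are records of type \<^typ>\<open>('r, 'm) module\<close> whose fields \<open>mult\<close> and \<open>one\<close> play no role.
  The library locale \<^locale>\<open>module\<close> requires a commutative ring; the following is the same
  notion over an arbitrary ring.
\<close>

definition left_module :: "('r, 'x) ring_scheme \<Rightarrow> ('r, 'm, 'y) module_scheme \<Rightarrow> bool"
  where "left_module D M \<longleftrightarrow>
    ring D \<and> abelian_group M \<and>
    (\<forall>P\<in>carrier D. \<forall>x\<in>carrier M. P \<odot>\<^bsub>M\<^esub> x \<in> carrier M) \<and>
    (\<forall>P\<in>carrier D. \<forall>Q\<in>carrier D. \<forall>x\<in>carrier M.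
      (P \<oplus>\<^bsub>D\<^esub> Q) \<odot>\<^bsub>M\<^esub> x = (P \<odot>\<^bsub>M\<^esub> x) \<oplus>\<^bsub>M\<^esub> (Q \<odot>\<^bsub>M\<^esub> x)) \<and>
    (\<forall>P\<in>carrier D. \<forall>x\<in>carrier M. \<forall>y\<in>carrier M.
      P \<odot>\<^bsub>M\<^esub> (x \<oplus>\<^bsub>M\<^esub> y) = (P \<odot>\<^bsub>M\<^esub> x) \<oplus>\<^bsub>M\<^esub> (P \<odot>\<^bsub>M\<^esub> y)) \<and>
    (\<forall>P\<in>carrier D. \<forall>Q\<in>carrier D. \<forall>x\<in>carrier M.
      (P \<otimes>\<^bsub>D\<^esub> Q) \<odot>\<^bsub>M\<^esub> x = P \<odot>\<^bsub>M\<^esub> (Q \<odot>\<^bsub>M\<^esub> x)) \<and>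
    (\<forall>x\<in>carrier M. \<one>\<^bsub>D\<^esub> \<odot>\<^bsub>M\<^esub> x = x)"

definition with_smult :: "('r \<Rightarrow> 'm \<Rightarrow> 'm) \<Rightarrow> ('m, 'y) ring_scheme \<Rightarrow> ('r, 'm) module"
  where "with_smult h M =
    \<lparr>carrier = carrier M, monoid.mult = monoid.mult M, monoid.one = monoid.one M, ring.zero = ring.zero M, ring.add = ring.add M, module.smult = h\<rparr>"

definition quotient_module ::
    "('r, 'm, 'y) module_scheme \<Rightarrow> 'm set \<Rightarrow> ('r, 'm set) module"
  where "quotient_module M K =
    \<lparr>carrier = a_rcosets\<^bsub>M\<^esub> K,
     monoid.mult = undefined, monoid.one = undefined,
     ring.zero = K,
     ring.add = set_add M,
     module.smult = (\<lambda>r X. \<Union>x\<in>X. K +>\<^bsub>M\<^esub> (r \<odot>\<^bsub>M\<^esub> x))\<rparr>"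

definition cyclic_submodule ::
    "('r, 'x) ring_scheme \<Rightarrow> ('r, 'm, 'y) module_scheme \<Rightarrow> 'm \<Rightarrow> 'm set"
  where "cyclic_submodule D M x = (\<lambda>P. P \<odot>\<^bsub>M\<^esub> x) ` carrier D"

text \<open>
  Localization \<open>W\<^sup>-\<^sup>1M\<close> of a module over a commutative ring at a multiplicative set \<open>W\<close>;
  \<open>fraction M W x s\<close> is the class of \<open>x/s\<close>.
\<close>

definition fraction ::
    "('r, 'm, 'y) module_scheme \<Rightarrow> 'r set \<Rightarrow> 'm \<Rightarrow> 'r \<Rightarrow> ('m \<times> 'r) set"
  where "fraction M W x s =
    {(y, u). y \<in> carrier M \<and> u \<in> W \<and>
      (\<exists>v\<in>W. v \<odot>\<^bsub>M\<^esub> (u \<odot>\<^bsub>M\<^esub> x) = v \<odot>\<^bsub>M\<^esub> (s \<odot>\<^bsub>M\<^esub> y))}"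

definition localization ::
    "('r, 'x) ring_scheme \<Rightarrow> ('r, 'm, 'y) module_scheme \<Rightarrow> 'r set \<Rightarrow> ('r, ('m \<times> 'r) set) module"
  where "localization R M W =
    \<lparr>carrier = {fraction M W x s | x s. x \<in> carrier M \<and> s \<in> W},
     monoid.mult = undefined, monoid.one = undefined,
     ring.zero = fraction M W \<zero>\<^bsub>M\<^esub> \<one>\<^bsub>R\<^esub>,
     ring.add = (\<lambda>X Y. \<Union>(x, s)\<in>X. \<Union>(y, u)\<in>Y.
       fraction M W ((u \<odot>\<^bsub>M\<^esub> x) \<oplus>\<^bsub>M\<^esub> (s \<odot>\<^bsub>M\<^esub> y)) (s \<otimes>\<^bsub>R\<^esub> u)),
     module.smult = (\<lambda>r X. \<Union>(x, s)\<in>X. fraction M W (r \<odot>\<^bsub>M\<^esub> x) s)\<rparr>"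

definition self_module :: "('s, 'y) ring_scheme \<Rightarrow> ('s, 's) module"
  where "self_module S = with_smult (monoid.mult S) S"

definition localized_ring :: "('s, 'y) ring_scheme \<Rightarrow> 's set \<Rightarrow> ('s, ('s \<times> 's) set) module"
  where "localized_ring S W = localization S (self_module S) W"

text \<open>
  The module structure over the differential operators on \<open>W\<^sup>-\<^sup>1S\<close> extending the tautological
  one on \<open>S\<close>: elements of \<open>S\<close>, viewed as operators of order zero, act by multiplication, and
  \<open>P\<close> sends \<open>s/1\<close> to \<open>P(s)/1\<close>.
\<close>

definition extends_action ::
    "('k, 'x) ring_scheme \<Rightarrow> ('k, 's, 'y) module_scheme \<Rightarrow> 's set \<Rightarrow>
     (('s \<Rightarrow> 's) \<Rightarrow> ('s \<times> 's) set \<Rightarrow> ('s \<times> 's) set) \<Rightarrow> bool"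
  where "extends_action A S W h \<longleftrightarrow>
    (let L = localized_ring S W; \<iota> = (\<lambda>s. fraction (self_module S) W s \<one>\<^bsub>S\<^esub>) in
      h \<in> diff_ops A S \<rightarrow>\<^sub>E (carrier L \<rightarrow>\<^sub>E carrier L) \<and>
      left_module (diff_op_ring A S) (with_smult h L) \<and>
      (\<forall>s\<in>carrier S. \<forall>x\<in>carrier L. h (mult_op S s) x = s \<odot>\<^bsub>L\<^esub> x) \<and>
      (\<forall>P\<in>diff_ops A S. \<forall>s\<in>carrier S. h P (\<iota> s) = \<iota> (P s)))"

definition D_localization ::
    "('k, 'x) ring_scheme \<Rightarrow> ('k, 's, 'y) module_scheme \<Rightarrow> 's set \<Rightarrow>
     ('s \<Rightarrow> 's, ('s \<times> 's) set) module"
  where "D_localization A S W = with_smult (THE h. extends_action A S W h) (localized_ring S W)"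


section \<open>The polynomial rings\<close>

definition coeff_ring :: "'k::comm_ring_1 ring"
  where "coeff_ring =
    \<lparr>carrier = UNIV, monoid.mult = (*), monoid.one = 1, ring.zero = 0, ring.add = (+)\<rparr>"

text \<open>
  Polynomials in countably many variables, as finitely supported functions on monomials;
  \<open>A[x\<^sub>1, \<dots>, x\<^sub>n]\<close> is the subring of those involving only the variables with index below \<open>n\<close>.
\<close>

type_synonym 'k mpoly = "(nat \<Rightarrow>\<^sub>0 nat) \<Rightarrow>\<^sub>0 'k"

definition mpolys :: "nat \<Rightarrow> 'k::comm_ring_1 mpoly set"
  where "mpolys n = {g. \<forall>u\<in>Poly_Mapping.keys g. Poly_Mapping.keys u \<subseteq> {..<n}}"

definition mconst :: "'k::comm_ring_1 \<Rightarrow> 'k mpoly"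
  where "mconst c = Poly_Mapping.single 0 c"

text \<open>\<open>A[t]\<close> and \<open>R[t]\<close> with \<open>R = A[x\<^sub>1, \<dots>, x\<^sub>n]\<close>, both as \<open>A\<close>-algebras.\<close>

definition At :: "('k::comm_ring_1, 'k poly) module"
  where "At =
    \<lparr>carrier = UNIV,
     monoid.mult = (*), monoid.one = 1, ring.zero = 0, ring.add = (+),
     module.smult = Polynomial.smult\<rparr>"

definition At_component :: "nat \<Rightarrow> 'k::comm_ring_1 poly set"
  where "At_component k = range (\<lambda>c. Polynomial.monom c k)"

definition Rt :: "nat \<Rightarrow> ('k::comm_ring_1, 'k mpoly poly) module"
  where "Rt n =
    \<lparr>carrier = {q. \<forall>i. Polynomial.coeff q i \<in> mpolys n},
     monoid.mult = (*), monoid.one = 1, ring.zero = 0, ring.add = (+),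
     module.smult = (\<lambda>c. Polynomial.smult (mconst c))\<rparr>"

definition Rt_component :: "nat \<Rightarrow> nat \<Rightarrow> 'k::comm_ring_1 mpoly poly set"
  where "Rt_component n k = (\<lambda>r. Polynomial.monom r k) ` mpolys n"

lemma mpolys_closed:
  "0 \<in> mpolys n" "1 \<in> mpolys n" "mconst c \<in> mpolys n"
  "g \<in> mpolys n \<Longrightarrow> - g \<in> mpolys n"
  "g \<in> mpolys n \<Longrightarrow> h \<in> mpolys n \<Longrightarrow> g + h \<in> mpolys n"
  "g \<in> mpolys n \<Longrightarrow> h \<in> mpolys n \<Longrightarrow> g * h \<in> mpolys n"
proof -
  show "- g \<in> mpolys n" if "g \<in> mpolys n"
    using that by (auto simp: mpolys_def)
  show "0 \<in> mpolys n" "1 \<in> mpolys n" "mconst c \<in> mpolys n"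
    by (auto simp: mpolys_def mconst_def)
  assume g: "g \<in> mpolys n" and h: "h \<in> mpolys n"
  show "g + h \<in> mpolys n"
    using g h Poly_Mapping.keys_add[of g h] by (fastforce simp: mpolys_def)
  show "g * h \<in> mpolys n"
  proof -
    have "Poly_Mapping.keys u \<subseteq> {..<n}" if u: "u \<in> Poly_Mapping.keys (g * h)" for u
    proof -
      obtain a b where "a \<in> Poly_Mapping.keys g" "b \<in> Poly_Mapping.keys h" "u = a + b"
        using u keys_mult[of g h] by blast
      then show ?thesis
        using g h Poly_Mapping.keys_add[of a b] unfolding mpolys_def by blast
    qed
    then show ?thesis by (simp add: mpolys_def)
  qed
qed

lemma mpolys_sum: "(\<And>i. i \<in> I \<Longrightarrow> g i \<in> mpolys n) \<Longrightarrow> (\<Sum>i\<in>I. g i) \<in> mpolys n"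
  by (induction I rule: infinite_finite_induct) (auto intro: mpolys_closed)

lemma cring_coeff_ring: "cring (coeff_ring :: 'k::comm_ring_1 ring)"
proof (rule cringI)
  show "abelian_group (coeff_ring :: 'k ring)"
    by (rule abelian_groupI) (auto simp: coeff_ring_def algebra_simps intro: exI[of _ "- _"])
  show "comm_monoid (coeff_ring :: 'k ring)"
    by (rule comm_monoidI) (auto simp: coeff_ring_def algebra_simps)
qed (auto simp: coeff_ring_def algebra_simps)

lemma cring_Rt: "cring (Rt n :: ('k::comm_ring_1, 'k mpoly poly) module)"
proof (rule cringI)
  show "abelian_group (Rt n :: ('k, 'k mpoly poly) module)"
  proof (rule abelian_groupI)
    fix x assume "x \<in> carrier (Rt n :: ('k, 'k mpoly poly) module)"
    then show "\<exists>y\<in>carrier (Rt n). y \<oplus>\<^bsub>Rt n\<^esub> x = \<zero>\<^bsub>Rt n :: ('k, 'k mpoly poly) module\<^esub>"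
      by (intro bexI[of _ "- x"]) (auto simp: Rt_def mpolys_closed)
  qed (auto simp: Rt_def algebra_simps mpolys_closed)
  show "comm_monoid (Rt n :: ('k, 'k mpoly poly) module)"
    by (rule comm_monoidI)
       (auto simp: Rt_def algebra_simps coeff_mult coeff_1
         intro!: mpolys_closed mpolys_sum)
qed (auto simp: Rt_def algebra_simps)

lemma algebra_Rt: "algebra coeff_ring (Rt n :: ('k::comm_ring_1, 'k mpoly poly) module)"
  by (rule algebraI[OF cring_coeff_ring cring_Rt])
     (auto simp: Rt_def coeff_ring_def mconst_def algebra_simps Poly_Mapping.single_add
       Polynomial.smult_add_left Polynomial.smult_add_right mult_single
       intro!: mpolys_closed mpolys_closed(3)[unfolded mconst_def])

lemma algebra_At: "algebra coeff_ring (At :: ('k::comm_ring_1, 'k poly) module)"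
proof (rule algebraI[OF cring_coeff_ring])
  show "cring (At :: ('k, 'k poly) module)"
  proof (rule cringI)
    show "abelian_group (At :: ('k, 'k poly) module)"
      by (rule abelian_groupI) (auto simp: At_def algebra_simps intro: exI[of _ "- _"])
    show "comm_monoid (At :: ('k, 'k poly) module)"
      by (rule comm_monoidI) (auto simp: At_def algebra_simps)
  qed (auto simp: At_def algebra_simps)
qed (auto simp: At_def coeff_ring_def algebra_simps
       Polynomial.smult_add_left Polynomial.smult_add_right)

definition D0_Rt :: "nat \<Rightarrow> ('k::comm_ring_1 mpoly poly \<Rightarrow> 'k mpoly poly) ring"
  where "D0_Rt n = diff_op_ring_deg0 coeff_ring (Rt n) (Rt_component n)"

definition C_ring :: "('k::comm_ring_1 poly \<Rightarrow> 'k poly) ring"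
  where "C_ring = diff_op_ring_deg0 coeff_ring At At_component"

text \<open>The \<open>R\<close>-linear extension of an operator on \<open>A[t]\<close> to \<open>R[t]\<close>.\<close>

definition R_extension ::
    "nat \<Rightarrow> ('k::comm_ring_1 poly \<Rightarrow> 'k poly) \<Rightarrow> 'k mpoly poly \<Rightarrow> 'k mpoly poly"
  where "R_extension n P = (\<lambda>q\<in>carrier (Rt n).
    \<Sum>i\<le>Polynomial.degree q.
      Polynomial.smult (Polynomial.coeff q i) (map_poly mconst (P (Polynomial.monom 1 i))))"


section \<open>The module \<open>N\<^sub>f\<close>\<close>

text \<open>
  The polynomial \<open>f\<close> and the element \<open>f - t\<close> of \<open>R[t]\<close> are \<open>[:f:]\<close> and \<open>[:f, -1:]\<close>.
  Since \<open>f - t\<close> is a nonzerodivisor, \<open>R[t, f\<^sup>-\<^sup>1]\<close> is identified with its image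
  \<open>{a / f\<^sup>i}\<close> in \<open>R[t, f\<^sup>-\<^sup>1, (f - t)\<^sup>-\<^sup>1]\<close>.
\<close>

definition denominators :: "'k::comm_ring_1 mpoly \<Rightarrow> 'k mpoly poly set"
  where "denominators f = {[:f:] ^ i * [:f, -1:] ^ j | i j. True}"

definition local_Rt ::
    "nat \<Rightarrow> 'k::comm_ring_1 mpoly \<Rightarrow>
     ('k mpoly poly \<Rightarrow> 'k mpoly poly, ('k mpoly poly \<times> 'k mpoly poly) set) module"
  where "local_Rt n f = D_localization coeff_ring (Rt n) (denominators f)"

definition local_frac ::
    "nat \<Rightarrow> 'k::comm_ring_1 mpoly \<Rightarrow> 'k mpoly poly \<Rightarrow> 'k mpoly poly \<Rightarrow>
     ('k mpoly poly \<times> 'k mpoly poly) set"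
  where "local_frac n f = fraction (self_module (Rt n)) (denominators f)"

definition Rt_f_inverse ::
    "nat \<Rightarrow> 'k::comm_ring_1 mpoly \<Rightarrow> ('k mpoly poly \<times> 'k mpoly poly) set set"
  where "Rt_f_inverse n f = {local_frac n f a ([:f:] ^ i) | a i. a \<in> carrier (Rt n)}"

definition H_module ::
    "nat \<Rightarrow> 'k::comm_ring_1 mpoly \<Rightarrow>
     ('k mpoly poly \<Rightarrow> 'k mpoly poly, ('k mpoly poly \<times> 'k mpoly poly) set set) module"
  where "H_module n f = quotient_module (local_Rt n f) (Rt_f_inverse n f)"

definition delta0 ::
    "nat \<Rightarrow> 'k::comm_ring_1 mpoly \<Rightarrow> ('k mpoly poly \<times> 'k mpoly poly) set set"
  where "delta0 n f = Rt_f_inverse n f +>\<^bsub>local_Rt n f\<^esub> local_frac n f 1 [:f, -1:]"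

definition N_module ::
    "nat \<Rightarrow> 'k::comm_ring_1 mpoly \<Rightarrow>
     ('k poly \<Rightarrow> 'k poly, ('k mpoly poly \<times> 'k mpoly poly) set set set) module"
  where "N_module n f =
    (let H = H_module n f;
         M = H\<lparr>carrier := cyclic_submodule (D0_Rt n) H (delta0 n f)\<rparr>;
         K = cyclic_submodule (D0_Rt n) H (mult_op (Rt n) [:f:] \<odot>\<^bsub>H\<^esub> delta0 n f);
         Q = quotient_module M K
     in with_smult (\<lambda>P x. R_extension n P \<odot>\<^bsub>Q\<^esub> x) Q)"


section \<open>The \<open>p\<close>-adic integers and the spectrum of \<open>C\<^sub>m\<close>\<close>

text \<open>
  \<open>\<int>\<^sub>p\<close> as the inverse limit of the \<open>\<int>/p\<^sup>k\<close>, residues being represented in \<open>{0..<p\<^sup>k}\<close>.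
  The ball \<open>\<alpha> + p\<^sup>k\<int>\<^sub>p\<close> consists of the \<open>\<beta>\<close> with \<open>\<beta> k = \<alpha> k\<close>.
\<close>

definition padic_ints :: "nat \<Rightarrow> (nat \<Rightarrow> int) set"
  where "padic_ints p =
    {\<alpha>. \<forall>k. 0 \<le> \<alpha> k \<and> \<alpha> k < int p ^ k \<and> \<alpha> (Suc k) mod int p ^ k = \<alpha> k}"

definition padic_of_int :: "nat \<Rightarrow> int \<Rightarrow> nat \<Rightarrow> int"
  where "padic_of_int p a = (\<lambda>k. a mod int p ^ k)"

definition padic_locally_constant :: "nat \<Rightarrow> ((nat \<Rightarrow> int) \<Rightarrow> 'b) \<Rightarrow> bool"
  where "padic_locally_constant p \<phi> \<longleftrightarrow>
    (\<forall>\<alpha>\<in>padic_ints p. \<exists>k. \<forall>\<beta>\<in>padic_ints p. \<beta> k = \<alpha> k \<longrightarrow> \<phi> \<beta> = \<phi> \<alpha>)"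

definition eigenvalue_function ::
    "nat \<Rightarrow> ('k::comm_ring_1 poly \<Rightarrow> 'k poly) \<Rightarrow> (nat \<Rightarrow> int) \<Rightarrow> 'k"
  where "eigenvalue_function p P =
    (THE \<phi>. \<phi> \<in> extensional (padic_ints p) \<and> padic_locally_constant p \<phi> \<and>
      (\<forall>a::nat. P (Polynomial.monom 1 a) =
        Polynomial.smult (\<phi> (padic_of_int p (- 1 - int a))) (Polynomial.monom 1 a)))"

definition C_prime :: "nat \<Rightarrow> (nat \<Rightarrow> int) \<Rightarrow> ('k::comm_ring_1 poly \<Rightarrow> 'k poly) set"
  where "C_prime p \<alpha> = {P \<in> carrier C_ring. of_nat p dvd eigenvalue_function p P \<alpha>}"

definition N_localized ::
    "nat \<Rightarrow> nat \<Rightarrow> 'k::comm_ring_1 mpoly \<Rightarrow> (nat \<Rightarrow> int) \<Rightarrow>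
     ('k poly \<Rightarrow> 'k poly,
      (('k mpoly poly \<times> 'k mpoly poly) set set set \<times> ('k poly \<Rightarrow> 'k poly)) set) module"
  where "N_localized p n f \<alpha> =
    localization C_ring (N_module n f) (carrier C_ring - C_prime p \<alpha>)"

definition bernstein_sato_roots ::
    "nat \<Rightarrow> nat \<Rightarrow> 'k::comm_ring_1 mpoly \<Rightarrow> (nat \<Rightarrow> int) set"
  where "bernstein_sato_roots p n f =
    {\<alpha> \<in> padic_ints p. carrier (N_localized p n f \<alpha>) \<noteq> {\<zero>\<^bsub>N_localized p n f \<alpha>\<^esub>}}"

definition nonzerodivisor :: "nat \<Rightarrow> 'k::comm_ring_1 mpoly \<Rightarrow> bool"
  where "nonzerodivisor n f \<longleftrightarrow> (\<forall>g\<in>mpolys n. f * g = 0 \<longrightarrow> g = 0)"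

end

theory Submission
  imports Defs "HOL-Algebra.Subrings"
begin

text \<open>
  Write \<open>s = - 1 - i\<close> for the degree \<open>i\<close> in \<open>t\<close>. Expanding \<open>1/(f - t)\<close> in powers of \<open>t\<close> shows
  that \<open>\<delta>\<^sub>0\<close> has coefficient \<open>f\<^sup>s\<close> at \<open>t\<^sup>i\<close>, that an element of \<open>C\<^sub>m\<close> multiplies this
  coefficient by a scalar depending on \<open>s\<close>, and that a degree-zero operator applies to it some
  operator on \<open>R\<close> depending on \<open>s\<close>. Suppose an operator \<open>D\<close> on \<open>R\<close> satisfies
  \<open>D f\<^sup>s\<^sup>+\<^sup>1 = f\<^sup>s\<close> for one \<open>s\<close> and is linear over \<open>A[x\<^sup>q]\<close> with \<open>q = p\<^sup>e\<close>. As \<open>p\<^sup>m\<^sup>+\<^sup>1 = 0\<close>, the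
  power \<open>f\<close> to the \<open>p\<^sup>e\<^sup>+\<^sup>m\<close> lies in \<open>A[x\<^sup>q]\<close>, so that the equation persists for all exponents
  congruent to \<open>s\<close> modulo \<open>p\<^sup>e\<^sup>+\<^sup>m\<close>. Letting \<open>D\<close> act in these degrees only gives a degree-zero
  operator on \<open>R[t]\<close> which maps \<open>f \<delta>\<^sub>0\<close> to \<open>\<pi> \<delta>\<^sub>0\<close>, where \<open>\<pi> \<in> C\<^sub>m\<close> is the idempotent of the
  residue class of \<open>s\<close> (\<open>lowering_operator\<close>). Since \<open>C\<^sub>m\<close> is central in the ring of degree-zero
  operators (\<open>R_extension_central\<close>), \<open>\<pi>\<close> annihilates \<open>N\<^sub>f\<close>, and no \<open>\<alpha>\<close> in this residue class is
  a root (\<open>not_bernstein_sato_root\<close>).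

  It remains to bound, independently of \<open>e\<close>, the number of \<open>s < p\<^sup>e\<^sup>+\<^sup>m\<close> for which no such \<open>D\<close>
  exists (\<open>card_jumps\<close>). The ideals generated by the images of \<open>f\<^sup>s\<close> under all
  \<open>A[x\<^sup>q]\<close>-linear operators decrease with \<open>s\<close>, and \<open>s\<close> is exceptional when the inclusion at \<open>s\<close> is
  strict. Each ideal is generated by the coefficients of \<open>f\<^sup>s\<close> over \<open>A[x\<^sup>q]\<close>, which are
  polynomials in \<open>x\<^sup>q\<close> of degree at most \<open>p\<^sup>m\<close> times that of \<open>f\<close>. There are only finitely many of
  those, equally many for every \<open>e\<close>, so the chain can drop only a bounded number of times. A set
  of \<open>p\<close>-adic integers with boundedly many residues at every level is finite.

  Grothendieck's differential operators enter through a description special to the ring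
  \<open>\<int>/p\<^sup>m\<^sup>+\<^sup>1\<close>: they are the \<open>A\<close>-linear maps that commute with multiplication by all \<open>p\<^sup>e\<close>-th
  powers, for some \<open>e\<close> (\<open>diff_ops_iff\<close>). It makes the action on a localization explicit, through
  \<open>a/s = a s\<^sup>q\<^sup>-\<^sup>1/s\<^sup>q\<close>, and shows that this action exists and is unique.
\<close>

section \<open>Congruences between prime powers\<close>

lemma prime_dvd_power_add:
  fixes a b :: "'s::comm_ring_1"
  assumes "prime p"
  shows "of_nat p dvd (a + b) ^ p - (a ^ p + b ^ p)"
proof -
  have p: "p > 0" using assms by (simp add: prime_gt_0_nat)
  have "{..p} = insert 0 (insert p {1..<p})" using p by auto
  then have sum: "(a + b) ^ p = a ^ p + b ^ p + (\<Sum>k=1..<p. of_nat (p choose k) * a ^ k * b ^ (p - k))"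
    using p by (simp add: binomial_ring)
  have "of_nat p dvd (of_nat (p choose k) * a ^ k * b ^ (p - k) :: 's)"
    if "k \<in> {1..<p}" for k
  proof -
    have "p dvd (p choose k)" using assms that by (intro dvd_choose_prime) auto
    then show ?thesis by (auto simp: dvd_def mult.assoc)
  qed
  then have "of_nat p dvd (\<Sum>k=1..<p. of_nat (p choose k) * a ^ k * b ^ (p - k) :: 's)"
    by (rule dvd_sum)
  then show ?thesis using sum by simp
qed

lemma dvd_power_diff:
  fixes a b :: "'s::comm_ring_1"
  shows "a - b dvd a ^ k - b ^ k"
  by (simp add: power_diff_sumr2)

text \<open>
  Raising a congruence modulo \<open>p\<close> to the power \<open>p\<^sup>m\<close> makes it a congruence modulo \<open>p\<^sup>m\<^sup>+\<^sup>1\<close>, that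
  is, an equality in the rings at hand.
\<close>
lemma prime_power_dvd_power_diff:
  fixes a b :: "'s::comm_ring_1"
  assumes "of_nat p dvd a - b"
  shows "of_nat (p ^ Suc i) dvd a ^ (p ^ i) - b ^ (p ^ i)"
proof (induction i)
  case 0
  then show ?case using assms by simp
next
  case (Suc i)
  define x where "x = a ^ (p ^ i)"
  define y where "y = b ^ (p ^ i)"
  have xy: "of_nat (p ^ Suc i) dvd x - y" using Suc by (simp add: x_def y_def)
  have p_xy: "of_nat p dvd x - y"
    by (rule dvd_trans[OF _ xy]) simp
  \<comment> \<open>Modulo \<open>x - y\<close> the cofactor of \<open>x - y\<close> in \<open>x\<^sup>p - y\<^sup>p\<close> is \<open>p y\<^sup>p\<^sup>-\<^sup>1\<close>.\<close>
  have "of_nat p dvd (\<Sum>j<p. x ^ j * y ^ (p - 1 - j)) "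
  proof -
    have "(\<Sum>j<p. x ^ j * y ^ (p - 1 - j))
        = (\<Sum>j<p. (x ^ j - y ^ j) * y ^ (p - 1 - j)) + (\<Sum>j<p. y ^ j * y ^ (p - 1 - j))"
      by (simp add: algebra_simps sum_subtractf)
    also have "(\<Sum>j<p. y ^ j * y ^ (p - 1 - j)) = (\<Sum>j<p. y ^ (p - 1))"
      by (intro sum.cong) (auto simp flip: power_add)
    also have "\<dots> = of_nat p * y ^ (p - 1)" by simp
    finally show ?thesis
      using dvd_trans[OF p_xy dvd_power_diff] by (simp add: dvd_sum)
  qed
  then have "of_nat (p ^ Suc i) * of_nat p dvd (x - y) * (\<Sum>j<p. x ^ j * y ^ (p - 1 - j))"
    using xy by (intro mult_dvd_mono)
  then have "of_nat (p ^ Suc (Suc i)) dvd x ^ p - y ^ p"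
    by (simp add: power_diff_sumr2[of x p y] mult_ac)
  then show ?case
    by (simp add: x_def y_def mult.commute flip: power_mult)
qed

lemma prime_dvd_prime_power_add:
  fixes a b :: "'s::comm_ring_1"
  assumes "prime p"
  shows "of_nat p dvd (a + b) ^ (p ^ e) - (a ^ (p ^ e) + b ^ (p ^ e))"
proof (induction e)
  case (Suc e)
  define u where "u = (a + b) ^ (p ^ e)"
  define x where "x = a ^ (p ^ e)"
  define y where "y = b ^ (p ^ e)"
  have "of_nat p dvd u ^ p - (x + y) ^ p"
    using dvd_trans[OF Suc dvd_power_diff] by (simp add: u_def x_def y_def)
  from dvd_add[OF this prime_dvd_power_add[OF assms, of x y]]
  have "of_nat p dvd u ^ p - (x ^ p + y ^ p)" by (simp add: algebra_simps)
  then show ?case by (simp add: u_def x_def y_def mult.commute flip: power_mult)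
qed simp

text \<open>
  The generating sets used below contain all constants, among them \<open>0\<close>, \<open>1\<close> and \<open>- 1\<close>, so closure
  under sums and products suffices.
\<close>
inductive_set ring_gen :: "'s::comm_ring_1 set \<Rightarrow> 's set" for G :: "'s set"
  where
    base: "g \<in> G \<Longrightarrow> g \<in> ring_gen G"
  | add: "a \<in> ring_gen G \<Longrightarrow> b \<in> ring_gen G \<Longrightarrow> a + b \<in> ring_gen G"
  | mult: "a \<in> ring_gen G \<Longrightarrow> b \<in> ring_gen G \<Longrightarrow> a * b \<in> ring_gen G"

definition commutes_on :: "'s::comm_ring_1 set \<Rightarrow> ('s \<Rightarrow> 's) \<Rightarrow> 's \<Rightarrow> bool"
  where "commutes_on C \<phi> s \<longleftrightarrow> (\<forall>x\<in>C. \<phi> (s * x) = s * \<phi> x)"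

lemma commutes_onD: "commutes_on C \<phi> s \<Longrightarrow> x \<in> C \<Longrightarrow> \<phi> (s * x) = s * \<phi> x"
  by (simp add: commutes_on_def)

lemma commutes_on_power:
  assumes "commutes_on C \<phi> s" "\<And>x. x \<in> C \<Longrightarrow> s * x \<in> C"
  shows "commutes_on C \<phi> (s ^ k)"
proof (induction k)
  case (Suc k)
  have "s ^ k * x \<in> C" if "x \<in> C" for x
    using that assms(2) by (induction k) (auto simp: mult.assoc)
  then show ?case using Suc assms(1) by (auto simp: commutes_on_def mult.assoc)
qed (simp add: commutes_on_def)

text \<open>
  The elements commuting with \<open>\<phi>\<close> form a subring \<open>T\<close>. Powers of exponent \<open>p\<^sup>e\<close> are additive modulo
  \<open>p\<close>, so the \<open>p\<^sup>e\<close>-th power of every element is congruent modulo \<open>p\<close> to an element of \<open>T\<close>;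
  a further \<open>p\<^sup>m\<close>-th power turns the congruence into an equality.
\<close>
lemma commutes_with_prime_powers:
  fixes \<phi> :: "'s::comm_ring_1 \<Rightarrow> 's"
  assumes "prime p" and char: "of_nat (p ^ Suc m) = (0::'s)"
    and C: "C = ring_gen G" and "1 \<in> C"
    and additive: "\<And>x y. x \<in> C \<Longrightarrow> y \<in> C \<Longrightarrow> \<phi> (x + y) = \<phi> x + \<phi> y"
    and gens: "\<And>g. g \<in> G \<Longrightarrow> commutes_on C \<phi> (g ^ (p ^ e))"
    and "s \<in> C"
  shows "commutes_on C \<phi> (s ^ (p ^ (e + m)))"
proof -
  define T where "T = {s \<in> C. commutes_on C \<phi> s}"
  have mult_closed: "a * b \<in> C" if "a \<in> C" "b \<in> C" for a b
    using that C by (auto intro: ring_gen.mult)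
  have power_closed: "a ^ k \<in> C" if "a \<in> C" for a k
    using that \<open>1 \<in> C\<close> by (induction k) (auto intro: mult_closed)
  have T_add: "a + b \<in> T" if "a \<in> T" "b \<in> T" for a b
    using that additive mult_closed C
    by (auto simp: T_def commutes_on_def distrib_right intro: ring_gen.add)
  have T_mult: "a * b \<in> T" if "a \<in> T" "b \<in> T" for a b
    using that mult_closed by (auto simp: T_def commutes_on_def mult.assoc)
  have "s \<in> ring_gen G" using \<open>s \<in> C\<close> C by simp
  then have "\<exists>t\<in>T. of_nat p dvd s ^ (p ^ e) - t"
  proof induction
    case (base g)
    then have "g ^ (p ^ e) \<in> T"
      using gens power_closed[of g] C by (auto simp: T_def intro: ring_gen.base)
    then show ?case by (intro bexI[of _ "g ^ (p ^ e)"]) simp_all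
  next
    case (add a b)
    then obtain t u where tu: "t \<in> T" "u \<in> T"
      and "of_nat p dvd a ^ (p ^ e) - t" "of_nat p dvd b ^ (p ^ e) - u" by blast
    from dvd_add[OF dvd_add[OF this(3,4)] prime_dvd_prime_power_add[OF assms(1), of a b e]]
    have "of_nat p dvd (a + b) ^ (p ^ e) - (t + u)" by (simp add: algebra_simps)
    then show ?case using tu T_add by blast
  next
    case (mult a b)
    then obtain t u where tu: "t \<in> T" "u \<in> T"
      and *: "of_nat p dvd a ^ (p ^ e) - t" "of_nat p dvd b ^ (p ^ e) - u" by blast
    have "(a * b) ^ (p ^ e) - t * u = (a ^ (p ^ e) - t) * b ^ (p ^ e) + t * (b ^ (p ^ e) - u)"
      by (simp add: algebra_simps power_mult_distrib)
    then have "of_nat p dvd (a * b) ^ (p ^ e) - t * u" using * by simp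
    then show ?case using tu T_mult by blast
  qed
  then obtain t where t: "t \<in> T" "of_nat p dvd s ^ (p ^ e) - t" by blast
  from prime_power_dvd_power_diff[OF t(2), of m] char
  have eq: "s ^ (p ^ (e + m)) = t ^ (p ^ m)" by (simp add: power_add power_mult)
  show ?thesis
    unfolding eq using t(1) by (intro commutes_on_power) (auto simp: T_def intro: mult_closed)
qed

section \<open>Differential operators as maps commuting with prime powers\<close>

text \<open>
  The recurrence is used twice: for \<open>F k i\<close> the \<open>k\<close>-fold commutator evaluated at \<open>s\<^sup>i x\<close>, and for
  the same array with the two indices exchanged. The first instance expresses commutators by values
  of the operator, the second the values by commutators.
\<close>
lemma signed_binomial_recurrence:
  fixes F :: "nat \<Rightarrow> nat \<Rightarrow> 's::comm_ring_1"
  assumes "\<And>k i. F (Suc k) i = s * F k i - F k (Suc i)"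
  shows "F k i = (\<Sum>j\<le>k. of_nat (k choose j) * ((- 1) ^ j * s ^ (k - j) * F 0 (i + j)))"
proof (induction k arbitrary: i)
  case (Suc k)
  define t where "t j = (- 1) ^ j * s ^ (Suc k - j) * F 0 (i + j)" for j
  have "(\<Sum>j\<le>Suc k. of_nat (Suc k choose j) * t j)
      = t 0 + (\<Sum>j\<le>k. of_nat (Suc k choose Suc j) * t (Suc j))"
    by (simp add: sum.atMost_Suc_shift del: sum.atMost_Suc)
  also have "\<dots> = (t 0 + (\<Sum>j\<le>k. of_nat (k choose Suc j) * t (Suc j)))
      + (\<Sum>j\<le>k. of_nat (k choose j) * t (Suc j))"
    by (simp add: distrib_right sum.distrib)
  also have "t 0 + (\<Sum>j\<le>k. of_nat (k choose Suc j) * t (Suc j))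
      = (\<Sum>j\<le>Suc k. of_nat (k choose j) * t j)"
    by (simp add: sum.atMost_Suc_shift del: sum.atMost_Suc)
  also have "\<dots> = (\<Sum>j\<le>k. of_nat (k choose j) * t j)" by (simp add: binomial_eq_0)
  also have "\<dots> = s * F k i"
    unfolding Suc[of i] sum_distrib_left
    by (intro sum.cong) (auto simp: t_def Suc_diff_le mult_ac)
  also have "(\<Sum>j\<le>k. of_nat (k choose j) * t (Suc j)) = - F k (Suc i)"
    unfolding Suc[of "Suc i"] sum_negf[symmetric]
    by (intro sum.cong) (auto simp: t_def mult_ac)
  finally show ?case by (simp add: assms t_def)
qed simp

text \<open>The action of \<open>s \<otimes> 1 - 1 \<otimes> s\<close> on operators.\<close>
definition ad :: "'s::comm_ring_1 \<Rightarrow> ('s \<Rightarrow> 's) \<Rightarrow> 's \<Rightarrow> 's"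
  where "ad s \<phi> x = s * \<phi> x - \<phi> (s * x)"

lemma ad_power_eq:
  "(ad s ^^ k) \<phi> x = (\<Sum>j\<le>k. of_nat (k choose j) * ((- 1) ^ j * s ^ (k - j) * \<phi> (s ^ j * x)))"
  using signed_binomial_recurrence[of "\<lambda>k j. (ad s ^^ k) \<phi> (s ^ j * x)" s k 0]
  by (simp add: ad_def mult_ac)

lemma eq_ad_powers:
  "\<phi> (s ^ k * x) = (\<Sum>j\<le>k. of_nat (k choose j) * ((- 1) ^ j * s ^ (k - j) * (ad s ^^ j) \<phi> x))"
  using signed_binomial_recurrence[of "\<lambda>k j. (ad s ^^ j) \<phi> (s ^ k * x)" s k 0]
  by (simp add: ad_def mult_ac)

lemma ad_commute: "ad s (ad t \<phi>) = ad t (ad s \<phi>)"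
  by (rule ext) (simp add: ad_def algebra_simps)

lemma ad_power_commute: "(ad s ^^ k) (ad t \<phi>) = ad t ((ad s ^^ k) \<phi>)"
  by (induction k) (simp_all add: ad_commute[of s t])

lemma ad_scale: "ad s (\<lambda>x. a * \<phi> (b * x)) = (\<lambda>x. a * ad s \<phi> (b * x))"
  by (rule ext) (simp add: ad_def algebra_simps)

lemma ad_power_scale: "(ad s ^^ k) (\<lambda>x. a * \<phi> x) = (\<lambda>x. a * (ad s ^^ k) \<phi> x)"
  using ad_scale[of s a _ 1] by (induction k) simp_all

lemma ad_add: "ad s (\<lambda>x. \<phi> x + \<psi> x) = (\<lambda>x. ad s \<phi> x + ad s \<psi> x)"
  by (rule ext) (simp add: ad_def algebra_simps)

lemma prime_power_dvd_choose:
  assumes "prime p" "0 < j" "j < p ^ N"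
  shows "p ^ Suc m dvd (p ^ (N + m) choose j)"
proof -
  have "j * (p ^ (N + m) choose j) = p ^ (N + m) * ((p ^ (N + m) - 1) choose (j - 1))"
    using times_binomial_minus1_eq[OF assms(2)] by simp
  then have "p ^ (N + m) dvd j * (p ^ (N + m) choose j)" by simp
  moreover have "\<not> p ^ N dvd j" using assms(2,3) by (auto dest: dvd_imp_le)
  ultimately show ?thesis
    using prime_elem_power_dvd_cases[of p "N + m" j _ N "Suc m"] assms(1) by auto
qed

text \<open>
  This covers both \<open>A[t]\<close> and \<open>R[t]\<close>: \<open>\<kappa>\<close> is the structure map and \<open>Y\<close> a finite set of algebra
  generators. The operations of the record \<open>S\<close> are those of the surrounding type, so that
  computations on the carrier can use the arithmetic of type classes.
\<close>
locale prime_power_algebra =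
  fixes p m :: nat
    and S :: "('k::comm_ring_1, 's::comm_ring_1) module"
    and \<kappa> :: "'k \<Rightarrow> 's"
    and Y :: "'s set"
  assumes prime: "prime p"
    and char: "of_nat (p ^ Suc m) = (0::'s)"
    and algebra: "algebra coeff_ring S"
    and S_ops: "monoid.mult S = (*)" "monoid.one S = 1" "ring.zero S = 0" "ring.add S = (+)"
      "\<And>c x. module.smult S c x = \<kappa> c * x"
    and carrier_gen: "carrier S = ring_gen (range \<kappa> \<union> Y)"
    and finite_Y: "finite Y" and Y_nonempty: "Y \<noteq> {}"
begin

abbreviation "C \<equiv> carrier S"

sublocale alg: algebra coeff_ring S by (rule algebra)

lemma C_closed:
  "0 \<in> C" "1 \<in> C" "a \<in> C \<Longrightarrow> b \<in> C \<Longrightarrow> a + b \<in> C" "a \<in> C \<Longrightarrow> b \<in> C \<Longrightarrow> a * b \<in> C"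
  "\<kappa> c \<in> C"
  using alg.M.zero_closed alg.one_closed alg.M.a_closed[of a b] alg.m_closed[of a b]
  by (auto simp: S_ops carrier_gen intro: ring_gen.base)

lemma Y_closed: "y \<in> Y \<Longrightarrow> y \<in> C"
  by (auto simp: carrier_gen intro: ring_gen.base)

lemma C_power: "a \<in> C \<Longrightarrow> a ^ k \<in> C"
  by (induction k) (auto intro: C_closed)

lemma C_uminus: "a \<in> C \<Longrightarrow> - a \<in> C"
proof -
  assume a: "a \<in> C"
  then have "a + (\<ominus>\<^bsub>S\<^esub> a) = 0" using alg.M.r_neg[of a] by (simp add: S_ops)
  then have "- a = \<ominus>\<^bsub>S\<^esub> a" by (rule minus_unique)
  then show ?thesis using a alg.M.a_inv_closed by metis
qed

definition linear :: "('s \<Rightarrow> 's) \<Rightarrow> bool"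
  where "linear \<phi> \<longleftrightarrow> (\<forall>x\<in>C. \<phi> x \<in> C) \<and> (\<forall>x\<in>C. \<forall>y\<in>C. \<phi> (x + y) = \<phi> x + \<phi> y) \<and>
    (\<forall>c. \<forall>x\<in>C. \<phi> (\<kappa> c * x) = \<kappa> c * \<phi> x)"

lemma linear_endos_iff: "\<phi> \<in> linear_endos coeff_ring S \<longleftrightarrow> \<phi> \<in> extensional C \<and> linear \<phi>"
  by (auto simp: linear_endos_def linear_def S_ops coeff_ring_def PiE_def)

lemma linear_closed: "linear \<phi> \<Longrightarrow> x \<in> C \<Longrightarrow> \<phi> x \<in> C"
  and linear_add: "linear \<phi> \<Longrightarrow> x \<in> C \<Longrightarrow> y \<in> C \<Longrightarrow> \<phi> (x + y) = \<phi> x + \<phi> y"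
  and linear_const: "linear \<phi> \<Longrightarrow> x \<in> C \<Longrightarrow> \<phi> (\<kappa> c * x) = \<kappa> c * \<phi> x"
  by (simp_all add: linear_def)

lemma linear_0: "linear \<phi> \<Longrightarrow> \<phi> 0 = 0"
  using linear_add[of \<phi> 0 0] C_closed(1) by simp

lemma linear_uminus: "linear \<phi> \<Longrightarrow> x \<in> C \<Longrightarrow> \<phi> (- x) = - \<phi> x"
  using linear_add[of \<phi> x "- x"] C_uminus[of x] linear_0[of \<phi>]
  by (simp add: eq_neg_iff_add_eq_0 add.commute)

lemma linear_diff: "linear \<phi> \<Longrightarrow> x \<in> C \<Longrightarrow> y \<in> C \<Longrightarrow> \<phi> (x - y) = \<phi> x - \<phi> y"
  using linear_add[of \<phi> x "- y"] C_uminus[of y] linear_uminus[of \<phi> y] by simp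

lemma linear_sum:
  assumes "linear \<phi>" "\<And>i. i \<in> I \<Longrightarrow> g i \<in> C"
  shows "\<phi> (\<Sum>i\<in>I. g i) = (\<Sum>i\<in>I. \<phi> (g i))" "(\<Sum>i\<in>I. g i) \<in> C"
proof -
  have "\<phi> (\<Sum>i\<in>I. g i) = (\<Sum>i\<in>I. \<phi> (g i)) \<and> (\<Sum>i\<in>I. g i) \<in> C"
    using assms(2)
    by (induction I rule: infinite_finite_induct)
       (auto simp: linear_0[OF assms(1)] linear_add[OF assms(1)] C_closed)
  then show "\<phi> (\<Sum>i\<in>I. g i) = (\<Sum>i\<in>I. \<phi> (g i))" "(\<Sum>i\<in>I. g i) \<in> C" by auto
qed

lemma linear_scale:
  assumes "linear \<phi>" "a \<in> C" "b \<in> C"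
  shows "linear (\<lambda>x. a * \<phi> (b * x))"
proof -
  have "\<phi> (b * (\<kappa> c * x)) = \<kappa> c * \<phi> (b * x)" if "x \<in> C" for c x
    using that assms linear_const[OF assms(1), of "b * x" c] C_closed(4)[of b x]
    by (simp add: mult.left_commute)
  then show ?thesis
    using assms unfolding linear_def by (auto simp: C_closed distrib_left mult.left_commute)
qed

lemma linear_plus: "linear \<phi> \<Longrightarrow> linear \<psi> \<Longrightarrow> linear (\<lambda>x. \<phi> x + \<psi> x)"
  by (auto simp: linear_def C_closed algebra_simps)

lemma linear_zero: "linear (\<lambda>x. 0)"
  by (auto simp: linear_def C_closed)

lemma linear_cong: "(\<And>x. x \<in> C \<Longrightarrow> \<phi> x = \<psi> x) \<Longrightarrow> linear \<phi> = linear \<psi>"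
  by (simp add: linear_def C_closed cong: ball_cong)

lemma ad_cong: "(\<And>x. x \<in> C \<Longrightarrow> \<phi> x = \<psi> x) \<Longrightarrow> s \<in> C \<Longrightarrow> x \<in> C \<Longrightarrow> ad s \<phi> x = ad s \<psi> x"
  by (simp add: ad_def C_closed)

lemma ad_power_cong:
  "(\<And>x. x \<in> C \<Longrightarrow> \<phi> x = \<psi> x) \<Longrightarrow> s \<in> C \<Longrightarrow> x \<in> C \<Longrightarrow> (ad s ^^ k) \<phi> x = (ad s ^^ k) \<psi> x"
  by (induction k arbitrary: x) (auto intro: ad_cong)

text \<open>
  A criterion for \<open>J\<^sup>N\<close> to annihilate \<open>\<phi>\<close> (\<open>order_below_killed\<close>) that can be checked on the
  finitely many iterated commutators with generators.
\<close>
primrec order_below :: "nat \<Rightarrow> ('s \<Rightarrow> 's) \<Rightarrow> bool"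
  where
    "order_below 0 \<phi> \<longleftrightarrow> (\<forall>x\<in>C. \<phi> x = 0)"
  | "order_below (Suc N) \<phi> \<longleftrightarrow> (\<forall>y\<in>Y. order_below N (ad y \<phi>))"

lemma order_below_cong:
  "(\<And>x. x \<in> C \<Longrightarrow> \<phi> x = \<psi> x) \<Longrightarrow> order_below N \<phi> = order_below N \<psi>"
proof (induction N arbitrary: \<phi> \<psi>)
  case (Suc N)
  have "order_below N (ad y \<phi>) = order_below N (ad y \<psi>)" if "y \<in> Y" for y
    using Suc.prems Y_closed[OF that] by (intro Suc.IH ad_cong)
  then show ?case by simp
qed simp

lemma order_below_scale:
  "order_below N \<phi> \<Longrightarrow> b \<in> C \<Longrightarrow> order_below N (\<lambda>x. a * \<phi> (b * x))"
  by (induction N arbitrary: \<phi>) (auto simp: ad_scale C_closed Y_closed)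

lemma order_below_add:
  "order_below N \<phi> \<Longrightarrow> order_below N \<psi> \<Longrightarrow> order_below N (\<lambda>x. \<phi> x + \<psi> x)"
  by (induction N arbitrary: \<phi> \<psi>) (auto simp: ad_add)

lemma order_below_zero: "(\<And>x. x \<in> C \<Longrightarrow> \<phi> x = 0) \<Longrightarrow> order_below N \<phi>"
  by (induction N arbitrary: \<phi>) (auto simp: ad_def C_closed Y_closed)

text \<open>
  A commutator with a product is a combination of commutators with the factors, so commutators
  with generators control all others.
\<close>
lemma order_below_ad:
  assumes "linear \<phi>" "order_below (Suc N) \<phi>" "s \<in> C"
  shows "order_below N (ad s \<phi>)"
proof -
  have "s \<in> ring_gen (range \<kappa> \<union> Y)" using assms(3) carrier_gen by simp
  then show ?thesis
  proof induction
    case (base g)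
    then consider c where "g = \<kappa> c" | "g \<in> Y" by blast
    then show ?case
    proof cases
      case 1
      then show ?thesis
        using assms(1) by (intro order_below_zero) (simp add: ad_def linear_const)
    next
      case 2
      then show ?thesis using assms(2) by simp
    qed
  next
    case (add a b)
    then have ab: "a \<in> C" "b \<in> C" by (auto simp: carrier_gen)
    have "ad (a + b) \<phi> x = ad a \<phi> x + ad b \<phi> x" if "x \<in> C" for x
      using that ab by (simp add: ad_def algebra_simps linear_add[OF assms(1)] C_closed)
    then have "order_below N (ad (a + b) \<phi>) = order_below N (\<lambda>x. ad a \<phi> x + ad b \<phi> x)"
      by (rule order_below_cong)
    then show ?case using order_below_add[OF add.IH] by simp
  next
    case (mult a b)
    then have ab: "a \<in> C" "b \<in> C" by (auto simp: carrier_gen)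
    have "ad (a * b) \<phi> = (\<lambda>x. a * ad b \<phi> (1 * x) + 1 * ad a \<phi> (b * x))"
      by (rule ext) (simp add: ad_def algebra_simps)
    then show ?case
      using mult.IH ab by (auto intro!: order_below_add order_below_scale C_closed
        simp del: mult_1_left)
  qed
qed

text \<open>
  Among \<open>\<Sum>y\<in>Y. k y\<close> commutators some generator \<open>y\<close> occurs at least \<open>k y\<close> times, and commutators
  commute. The induction lowers \<open>k y\<close> by one for each commutator with \<open>y\<close>, which avoids counting
  occurrences.
\<close>
lemma order_below_of_ad_nilpotent:
  assumes "\<And>y x. y \<in> Y \<Longrightarrow> x \<in> C \<Longrightarrow> (ad y ^^ k y) \<phi> x = 0" "(\<Sum>y\<in>Y. k y) = N"
  shows "order_below N \<phi>"
  using assms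
proof (induction N arbitrary: k \<phi>)
  case 0
  obtain y where "y \<in> Y" using Y_nonempty by blast
  moreover have "k y = 0" using 0 \<open>y \<in> Y\<close> finite_Y by simp
  ultimately show ?case using 0(1)[of y] by simp
next
  case (Suc N)
  have "order_below N (ad y \<phi>)" if y: "y \<in> Y" for y
  proof (cases "k y")
    case 0
    then have "\<And>x. x \<in> C \<Longrightarrow> \<phi> x = 0" using Suc.prems(1)[OF y] by simp
    then show ?thesis using y by (intro order_below_zero) (simp add: ad_def C_closed Y_closed)
  next
    case (Suc l)
    have "(ad z ^^ (k(y := l)) z) (ad y \<phi>) x = 0" if z: "z \<in> Y" "x \<in> C" for z x
    proof (cases "z = y")
      case True
      then show ?thesis
        using Suc.prems(1)[of y x] Suc that by (simp add: funpow_swap1)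
    next
      case False
      then show ?thesis
        using Suc.prems(1)[of z] y z by (simp add: ad_power_commute) (simp add: ad_def C_closed Y_closed)
    qed
    moreover have "(\<Sum>z\<in>Y. (k(y := l)) z) = N"
    proof -
      have "(\<Sum>z\<in>Y. k z) = k y + (\<Sum>z\<in>Y - {y}. k z)" using finite_Y y by (rule sum.remove)
      moreover have "(\<Sum>z\<in>Y. (k(y := l)) z) = l + (\<Sum>z\<in>Y - {y}. k z)"
        using finite_Y y by (subst sum.remove[of Y y]) (auto intro!: sum.cong)
      ultimately show ?thesis using Suc Suc.prems(2) by simp
    qed
    ultimately show ?thesis by (rule Suc.IH)
  qed
  then show ?case by simp
qed

lemma tensor_mu_eq: "tensor_mu S w = (\<Sum>(r, s)\<leftarrow>w. r * s)"
  by (induction w) (auto simp: S_ops)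

lemma tensor_act_eq: "x \<in> C \<Longrightarrow> tensor_act S w \<phi> x = (\<Sum>(r, s)\<leftarrow>w. r * \<phi> (s * x))"
  by (induction w) (auto simp: tensor_act_Cons tensor_act_Nil S_ops)

lemma tensor_act_cong:
  assumes "w \<in> tensors S" "\<And>x. x \<in> C \<Longrightarrow> \<phi> x = \<psi> x" "x \<in> C"
  shows "tensor_act S w \<phi> x = tensor_act S w \<psi> x"
  using assms(1) unfolding tensor_act_eq[OF assms(3)] tensors_def
  by (induction w) (auto simp: assms(2,3) C_closed)

lemma tensor_act_mult:
  assumes "v \<in> tensors S" "w \<in> tensors S" "x \<in> C"
  shows "tensor_act S (tensor_mult S v w) \<phi> x = tensor_act S w (tensor_act S v \<phi>) x"
proof -
  have 1: "(\<Sum>(r, s)\<leftarrow>map (\<lambda>(r', s'). (a * r', b * s')) w. r * \<phi> (s * x))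
     = (\<Sum>(r, s)\<leftarrow>w. r * (a * \<phi> (b * (s * x))))" for a b
    by (induction w) (auto simp: mult.assoc mult.left_commute simp del: map_map)
  have 2: "(\<Sum>(r, s)\<leftarrow>w. r * (g s + h s)) = (\<Sum>(r, s)\<leftarrow>w. r * g s) + (\<Sum>(r, s)\<leftarrow>w. r * h s)"
    for g h :: "'s \<Rightarrow> 's"
    by (induction w) (auto simp: algebra_simps)
  have "tensor_act S w (tensor_act S v \<phi>) x
      = (\<Sum>(r, s)\<leftarrow>w. r * (\<Sum>(a, b)\<leftarrow>v. a * \<phi> (b * (s * x))))"
    using assms(2) unfolding tensor_act_eq[OF assms(3)] tensors_def
    by (induction w) (auto simp: tensor_act_eq C_closed assms(3))
  also have "\<dots> = (\<Sum>(r, s)\<leftarrow>tensor_mult S v w. r * \<phi> (s * x))"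
  proof (induction v)
    case Nil
    show ?case by (induction w) (auto simp: tensor_mult_def)
  next
    case (Cons c v)
    obtain a b where c: "c = (a, b)" by force
    have "tensor_mult S (c # v) w = map (\<lambda>(r', s'). (a * r', b * s')) w @ tensor_mult S v w"
      by (simp add: tensor_mult_def c S_ops)
    then show ?case using Cons by (simp add: c 1 2 del: map_map)
  qed
  finally show ?thesis by (simp add: tensor_act_eq[OF assms(3)])
qed

lemma tensor_mult_closed:
  "v \<in> tensors S \<Longrightarrow> w \<in> tensors S \<Longrightarrow> tensor_mult S v w \<in> tensors S"
  unfolding tensors_def lists_eq_set tensor_mult_def
  by (auto simp: S_ops intro!: C_closed(4))

lemma diagonal_ideal_power_tensors: "diagonal_ideal_power S N \<subseteq> tensors S"
proof (induction N)
  case (Suc N)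
  have "tensor_mult S v w \<in> tensors S"
    if "v \<in> diagonal_ideal S" "w \<in> diagonal_ideal_power S N" for v w
    using that Suc by (intro tensor_mult_closed) (auto simp: diagonal_ideal_def)
  then have "lists {tensor_mult S v w | v w. v \<in> diagonal_ideal S \<and> w \<in> diagonal_ideal_power S N}
      \<subseteq> lists (tensors S)"
    by (intro lists_mono) blast
  moreover have "concat ws \<in> tensors S" if "ws \<in> lists (tensors S)" for ws
    using that by induction (auto simp: tensors_def)
  ultimately show ?case unfolding diagonal_ideal_power.simps by blast
qed simp

lemma tensor_act_linear:
  assumes "w \<in> tensors S" "linear \<phi>"
  shows "linear (tensor_act S w \<phi>)"
proof -
  have "linear (\<lambda>x. \<Sum>(r, s)\<leftarrow>w. r * \<phi> (s * x))"
    using assms(1) unfolding tensors_def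
    by (induction w) (auto intro!: linear_plus linear_scale linear_zero assms(2))
  then show ?thesis using linear_cong[of "tensor_act S w \<phi>"] tensor_act_eq by simp
qed

text \<open>
  If \<open>\<Sum> r s = 0\<close>, then \<open>\<Sum> r \<phi>(s x)\<close> equals \<open>- \<Sum> r [s, \<phi>](x)\<close>, which involves only commutators.
\<close>
lemma diagonal_ideal_lowers_order:
  assumes "w \<in> diagonal_ideal S" "linear \<phi>" "order_below (Suc N) \<phi>"
  shows "order_below N (tensor_act S w \<phi>)"
proof -
  have "order_below N (\<lambda>x. \<Sum>(r, s)\<leftarrow>w. - r * ad s \<phi> (1 * x))"
  proof -
    have "w \<in> lists (C \<times> C)" using assms(1) by (simp add: diagonal_ideal_def tensors_def)
    then show ?thesis
    proof induction
      case Nil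
      show ?case by (rule order_below_zero) simp
    next
      case (Cons c w)
      obtain r s where c: "c = (r, s)" by force
      then have "order_below N (\<lambda>x. - r * ad s \<phi> (1 * x))"
        using Cons.hyps by (intro order_below_scale order_below_ad assms) (auto intro: C_closed)
      from order_below_add[OF this Cons.IH] show ?case by (simp add: c)
    qed
  qed
  moreover
  have "(\<Sum>(r, s)\<leftarrow>w. - r * ad s \<phi> (1 * x)) = tensor_act S w \<phi> x" if "x \<in> C" for x
  proof -
    have "(\<Sum>(r, s)\<leftarrow>w. - r * ad s \<phi> (1 * x))
        = (\<Sum>(r, s)\<leftarrow>w. r * \<phi> (s * x)) - (\<Sum>(r, s)\<leftarrow>w. r * s) * \<phi> x"
      by (induction w) (auto simp: ad_def algebra_simps)
    then show ?thesis
      using assms(1) that by (simp add: diagonal_ideal_def tensor_mu_eq tensor_act_eq S_ops)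
  qed
  then have "order_below N (\<lambda>x. \<Sum>(r, s)\<leftarrow>w. - r * ad s \<phi> (1 * x)) = order_below N (tensor_act S w \<phi>)"
    by (rule order_below_cong)
  ultimately show ?thesis by simp
qed

lemma order_below_killed:
  assumes "linear \<phi>" "order_below N \<phi>" "w \<in> diagonal_ideal_power S N" "x \<in> C"
  shows "tensor_act S w \<phi> x = 0"
  using assms
proof (induction N arbitrary: \<phi> w x)
  case 0
  have "w \<in> lists (C \<times> C)" using 0 by (simp add: tensors_def)
  then show ?case
    using 0(2,4) unfolding tensor_act_eq[OF 0(4)] by induction (auto simp: C_closed)
next
  case (Suc N)
  obtain ws where w: "w = concat ws"
    and ws: "ws \<in> lists {tensor_mult S v w | v w. v \<in> diagonal_ideal S \<and> w \<in> diagonal_ideal_power S N}"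
    using Suc.prems(3) by auto
  have summand: "tensor_act S (tensor_mult S v w) \<phi> x = 0"
    if "v \<in> diagonal_ideal S" "w \<in> diagonal_ideal_power S N" for v w
  proof -
    have v: "v \<in> tensors S" using that by (simp add: diagonal_ideal_def)
    have "tensor_act S w (tensor_act S v \<phi>) x = 0"
      using that v Suc.prems
      by (intro Suc.IH tensor_act_linear diagonal_ideal_lowers_order) auto
    then show ?thesis
      using that v diagonal_ideal_power_tensors Suc.prems(4) by (subst tensor_act_mult) auto
  qed
  have "tensor_act S (concat ws) \<phi> x = (\<Sum>u\<leftarrow>ws. tensor_act S u \<phi> x)"
    by (induction ws) (auto simp: tensor_act_eq[OF Suc.prems(4)])
  also have "\<dots> = (\<Sum>u\<leftarrow>ws. 0)"
  proof (intro arg_cong[of _ _ sum_list] map_cong refl)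
    fix u assume "u \<in> set ws"
    then obtain v w where "u = tensor_mult S v w" "v \<in> diagonal_ideal S" "w \<in> diagonal_ideal_power S N"
      using ws by blast
    then show "tensor_act S u \<phi> x = 0" using summand[of v w] by (simp only:)
  qed
  finally show ?case unfolding w by simp
qed

text \<open>The witness is the tensor \<open>(s \<otimes> 1 - 1 \<otimes> s)\<^sup>N\<close>.\<close>
lemma ad_power_in_diagonal_ideal_power:
  assumes "s \<in> C"
  shows "\<exists>w\<in>diagonal_ideal_power S N. \<forall>\<phi>. \<forall>x\<in>C. tensor_act S w \<phi> x = (ad s ^^ N) \<phi> x"
proof (induction N)
  case 0
  have "[(1, 1)] \<in> tensors S" by (simp add: tensors_def C_closed)
  then show ?case by (intro bexI[of _ "[(1, 1)]"]) (simp_all add: tensor_act_eq)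
next
  case (Suc N)
  then obtain w where w: "w \<in> diagonal_ideal_power S N"
    "\<And>\<phi> x. x \<in> C \<Longrightarrow> tensor_act S w \<phi> x = (ad s ^^ N) \<phi> x" by blast
  define v where "v = [(s, 1), (- 1, s)]"
  have v: "v \<in> diagonal_ideal S"
    using assms by (simp add: v_def diagonal_ideal_def tensors_def tensor_mu_eq S_ops C_closed C_uminus)
  then have v': "v \<in> tensors S" by (simp add: diagonal_ideal_def)
  have v_act: "tensor_act S v \<phi> x = ad s \<phi> x" if "x \<in> C" for \<phi> x
    using that by (simp add: v_def tensor_act_eq ad_def)
  have "tensor_act S (tensor_mult S v w) \<phi> x = (ad s ^^ Suc N) \<phi> x" if x: "x \<in> C" for \<phi> x
  proof -
    have wt: "w \<in> tensors S" using w(1) diagonal_ideal_power_tensors by blast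
    have "tensor_act S (tensor_mult S v w) \<phi> x = tensor_act S w (ad s \<phi>) x"
      using tensor_act_mult[OF v' wt x] tensor_act_cong[OF wt v_act x] by simp
    then show ?thesis using w(2) x by (simp add: funpow_swap1)
  qed
  moreover have "tensor_mult S v w \<in> diagonal_ideal_power S (Suc N)"
  proof -
    have "tensor_mult S v w
        \<in> {tensor_mult S v w | v w. v \<in> diagonal_ideal S \<and> w \<in> diagonal_ideal_power S N}"
      using v w(1) by blast
    then have "[tensor_mult S v w]
        \<in> lists {tensor_mult S v w | v w. v \<in> diagonal_ideal S \<and> w \<in> diagonal_ideal_power S N}"
      by (intro lists.intros)
    then show ?thesis
      unfolding diagonal_ideal_power.simps by (rule rev_image_eqI) simp
  qed
  ultimately show ?case by blast
qed

text \<open>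
  Modulo \<open>p\<close>, only the two outer terms of the \<open>q\<close>-th power of the commutator survive, and these
  cancel because \<open>\<phi>\<close> commutes with \<open>y\<^sup>q\<close>. When \<open>q\<close> is even they have equal signs, but then
  \<open>p = 2\<close>. Since \<open>\<psi>\<close> again commutes with \<open>y\<^sup>q\<close>, the lemma can be iterated until a factor
  \<open>p\<^sup>m\<^sup>+\<^sup>1 = 0\<close> appears.
\<close>
lemma ad_power_prime_power:
  assumes "y \<in> C" "commutes_on C \<phi> (y ^ (p ^ e))"
  shows "\<exists>\<psi>. commutes_on C \<psi> (y ^ (p ^ e)) \<and>
    (\<forall>x\<in>C. (ad y ^^ (p ^ e)) \<phi> x = of_nat p * \<psi> x)"
proof -
  define q where "q = p ^ e"
  have q: "q > 0" using prime by (simp add: q_def prime_gt_0_nat)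
  \<comment> \<open>The inner binomial terms divided by \<open>p\<close>; for even \<open>q\<close>, also half of the two equal outer ones.\<close>
  define \<psi> where "\<psi> x = (\<Sum>j=1..<q. of_nat ((q choose j) div p) * ((- 1) ^ j * y ^ (q - j) * \<phi> (y ^ j * x)))
    + (if even q then y ^ q * \<phi> x else 0)" for x
  have "commutes_on C \<psi> (y ^ q)"
  proof -
    have "\<phi> (y ^ j * (y ^ q * x)) = y ^ q * \<phi> (y ^ j * x)" if "x \<in> C" for j x
      using commutes_onD[OF assms(2), of "y ^ j * x"] that assms(1)
      by (simp add: q_def C_closed C_power mult.left_commute)
    then show ?thesis
      using assms(2) by (auto simp: commutes_on_def \<psi>_def q_def[symmetric] algebra_simps sum_distrib_left)
  qed
  moreover have "(ad y ^^ q) \<phi> x = of_nat p * \<psi> x" if x: "x \<in> C" for x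
  proof -
    let ?t = "\<lambda>j. (- 1) ^ j * y ^ (q - j) * \<phi> (y ^ j * x)"
    have "{..q} = insert 0 (insert q {1..<q})" using q by auto
    then have "(ad y ^^ q) \<phi> x = ?t 0 + ?t q + (\<Sum>j=1..<q. of_nat (q choose j) * ?t j)"
      using q by (simp add: ad_power_eq)
    moreover have "?t 0 + ?t q = of_nat p * (if even q then y ^ q * \<phi> x else 0)"
    proof -
      have "\<phi> (y ^ q * x) = y ^ q * \<phi> x" using assms(2) x by (simp add: commutes_on_def q_def)
      moreover have "p = 2" if "even q"
        using that prime by (metis q_def even_power primes_dvd_imp_eq two_is_prime_nat)
      ultimately show ?thesis by (simp add: uminus_power_if)
    qed
    moreover have "(\<Sum>j=1..<q. of_nat (q choose j) * ?t j)
        = of_nat p * (\<Sum>j=1..<q. of_nat ((q choose j) div p) * ?t j)"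
      unfolding sum_distrib_left
    proof (intro sum.cong refl)
      fix j assume "j \<in> {1..<q}"
      then have "p dvd (q choose j)"
        using prime_power_dvd_choose[OF prime, of j e 0] by (simp add: q_def)
      then have "(of_nat (q choose j) :: 's) = of_nat p * of_nat ((q choose j) div p)"
        by (metis dvd_mult_div_cancel of_nat_mult)
      then show "of_nat (q choose j) * ?t j = of_nat p * (of_nat ((q choose j) div p) * ?t j)"
        by (simp add: mult.assoc)
    qed
    ultimately show ?thesis by (simp add: \<psi>_def distrib_left)
  qed
  ultimately show ?thesis by (auto simp: q_def)
qed

lemma ad_nilpotent:
  assumes "y \<in> C" "commutes_on C \<phi> (y ^ (p ^ e))" "x \<in> C"
  shows "(ad y ^^ (p ^ e * Suc m)) \<phi> x = 0"
proof -
  have "\<exists>\<psi>. commutes_on C \<psi> (y ^ (p ^ e)) \<and>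
    (\<forall>x\<in>C. (ad y ^^ (p ^ e * k)) \<phi> x = of_nat (p ^ k) * \<psi> x)" for k
  proof (induction k)
    case 0
    show ?case using assms(2) by auto
  next
    case (Suc k)
    then obtain \<psi> where \<psi>: "commutes_on C \<psi> (y ^ (p ^ e))"
      "\<And>x. x \<in> C \<Longrightarrow> (ad y ^^ (p ^ e * k)) \<phi> x = of_nat (p ^ k) * \<psi> x" by blast
    obtain \<chi> where \<chi>: "commutes_on C \<chi> (y ^ (p ^ e))"
      "\<And>x. x \<in> C \<Longrightarrow> (ad y ^^ (p ^ e)) \<psi> x = of_nat p * \<chi> x"
      using ad_power_prime_power[OF assms(1) \<psi>(1)] by blast
    have "(ad y ^^ (p ^ e * Suc k)) \<phi> x = of_nat (p ^ Suc k) * \<chi> x" if "x \<in> C" for x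
    proof -
      have "(ad y ^^ (p ^ e * Suc k)) \<phi> x = (ad y ^^ (p ^ e)) ((ad y ^^ (p ^ e * k)) \<phi>) x"
        by (simp add: funpow_add)
      also have "\<dots> = (ad y ^^ (p ^ e)) (\<lambda>x. of_nat (p ^ k) * \<psi> x) x"
        using \<psi>(2) assms(1) that by (rule ad_power_cong)
      also have "\<dots> = of_nat (p ^ k) * (of_nat p * \<chi> x)"
        unfolding ad_power_scale using \<chi>(2) that by simp
      finally show ?thesis by (simp add: mult_ac)
    qed
    then show ?case using \<chi>(1) by blast
  qed
  from this[of "Suc m"] show ?thesis using assms(3) char by auto
qed

text \<open>Commuting with \<open>p\<^sup>e\<close>-th powers of generators makes each commutator nilpotent.\<close>
lemma diff_opsI:
  assumes "\<phi> \<in> extensional C" "linear \<phi>"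
    and "\<And>y. y \<in> Y \<Longrightarrow> commutes_on C \<phi> (y ^ (p ^ e))"
  shows "\<phi> \<in> diff_ops coeff_ring S"
proof -
  have "order_below (\<Sum>y\<in>Y. p ^ e * Suc m) \<phi>"
    using assms(3) by (intro order_below_of_ad_nilpotent[of "\<lambda>_. p ^ e * Suc m"] ad_nilpotent)
      (auto intro: Y_closed)
  then have "tensor_act S w \<phi> = (\<lambda>x\<in>C. \<zero>\<^bsub>S\<^esub>)"
    if "w \<in> diagonal_ideal_power S (\<Sum>y\<in>Y. p ^ e * Suc m)" for w
    using order_below_killed[OF assms(2) _ that]
    by (intro extensionalityI[of _ C]) (auto simp: tensor_act_def S_ops)
  then show ?thesis using assms(1,2) unfolding diff_ops_def linear_endos_iff by blast
qed

text \<open>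
  For the forward direction, expand \<open>\<phi>(s\<^sup>q x)\<close> into commutators for \<open>q = p\<^sup>N\<^sup>+\<^sup>m\<close>. Those of order
  at least \<open>N\<close> vanish, and the binomial coefficients in front of the others, except the one of
  order zero, are divisible by \<open>p\<^sup>m\<^sup>+\<^sup>1\<close>.
\<close>
lemma diff_ops_iff:
  "\<phi> \<in> diff_ops coeff_ring S \<longleftrightarrow>
    \<phi> \<in> extensional C \<and> linear \<phi> \<and> (\<exists>e. \<forall>s\<in>C. commutes_on C \<phi> (s ^ (p ^ e)))"
proof
  assume \<phi>: "\<phi> \<in> diff_ops coeff_ring S"
  then obtain N where N: "\<And>w. w \<in> diagonal_ideal_power S N \<Longrightarrow> tensor_act S w \<phi> = (\<lambda>x\<in>C. \<zero>\<^bsub>S\<^esub>)"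
    by (auto simp: diff_ops_def)
  have nil: "(ad s ^^ N) \<phi> x = 0" if s: "s \<in> C" and x: "x \<in> C" for s x
  proof -
    obtain w where w: "w \<in> diagonal_ideal_power S N"
      "\<forall>\<phi>. \<forall>x\<in>C. tensor_act S w \<phi> x = (ad s ^^ N) \<phi> x"
      using ad_power_in_diagonal_ideal_power[OF s] by blast
    then have "(ad s ^^ N) \<phi> x = tensor_act S w \<phi> x" using x by simp
    also have "\<dots> = 0" using N[OF w(1)] x by (simp add: S_ops)
    finally show ?thesis .
  qed
  have "commutes_on C \<phi> (s ^ (p ^ (N + m)))" if s: "s \<in> C" for s
    unfolding commutes_on_def
  proof
    fix x assume x: "x \<in> C"
    let ?q = "p ^ (N + m)"
    have "of_nat (?q choose j) * ((- 1) ^ j * s ^ (?q - j) * (ad s ^^ j) \<phi> x) = 0"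
      if "j \<in> {..?q} - {0}" for j
    proof (cases "j < p ^ N")
      case True
      then have "p ^ Suc m dvd (?q choose j)"
        using that by (intro prime_power_dvd_choose[OF prime]) auto
      then have "of_nat (?q choose j) = (0::'s)"
        using char by (auto simp: dvd_def simp del: of_nat_power)
      then show ?thesis by simp
    next
      case False
      have "N < p ^ N" using prime_gt_1_nat[OF prime] by (intro power_gt_expt) simp
      then have "(ad s ^^ (N + (j - N))) \<phi> x = (ad s ^^ j) \<phi> x" using False by simp
      moreover have "(ad s ^^ (N + i)) \<phi> x = 0" if "x \<in> C" for i x
        using that
      proof (induction i arbitrary: x)
        case (Suc i)
        then show ?case using s by (simp add: ad_def C_closed)
      qed (simp add: nil s)
      ultimately show ?thesis using x by (metis mult_zero_right)
    qed
    then have "(\<Sum>j\<le>?q. of_nat (?q choose j) * ((- 1) ^ j * s ^ (?q - j) * (ad s ^^ j) \<phi> x))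
       = (\<Sum>j\<in>{0}. of_nat (?q choose j) * ((- 1) ^ j * s ^ (?q - j) * (ad s ^^ j) \<phi> x))"
      by (intro sum.mono_neutral_right) auto
    then show "\<phi> (s ^ ?q * x) = s ^ ?q * \<phi> x"
      unfolding eq_ad_powers[of \<phi> s ?q x] by simp
  qed
  then show "\<phi> \<in> extensional C \<and> linear \<phi> \<and> (\<exists>e. \<forall>s\<in>C. commutes_on C \<phi> (s ^ (p ^ e)))"
    using \<phi> by (auto simp: diff_ops_def linear_endos_iff)
next
  assume "\<phi> \<in> extensional C \<and> linear \<phi> \<and> (\<exists>e. \<forall>s\<in>C. commutes_on C \<phi> (s ^ (p ^ e)))"
  then show "\<phi> \<in> diff_ops coeff_ring S" using diff_opsI Y_closed by blast
qed

end

context prime_power_algebra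
begin

definition power_linear :: "nat \<Rightarrow> ('s \<Rightarrow> 's) \<Rightarrow> bool"
  where "power_linear e \<phi> \<longleftrightarrow> (\<forall>s\<in>C. commutes_on C \<phi> (s ^ (p ^ e)))"

lemma power_linearD:
  "power_linear e \<phi> \<Longrightarrow> s \<in> C \<Longrightarrow> x \<in> C \<Longrightarrow> \<phi> (s ^ (p ^ e) * x) = s ^ (p ^ e) * \<phi> x"
  by (simp add: power_linear_def commutes_on_def)

lemma power_linear_mono:
  assumes "power_linear e \<phi>" "e \<le> e'"
  shows "power_linear e' \<phi>"
  unfolding power_linear_def
proof
  fix s assume "s \<in> C"
  then have "commutes_on C \<phi> ((s ^ (p ^ (e' - e))) ^ (p ^ e))"
    using assms(1) by (simp add: power_linear_def C_power)
  moreover have "(s ^ (p ^ (e' - e))) ^ (p ^ e) = s ^ (p ^ e')"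
    using assms(2) by (simp flip: power_mult power_add)
  ultimately show "commutes_on C \<phi> (s ^ (p ^ e'))" by simp
qed

lemma diff_ops_iff_power_linear:
  "\<phi> \<in> diff_ops coeff_ring S \<longleftrightarrow> \<phi> \<in> extensional C \<and> linear \<phi> \<and> (\<exists>e. power_linear e \<phi>)"
  by (simp add: diff_ops_iff power_linear_def)

lemma common_power_linear:
  assumes "\<phi> \<in> diff_ops coeff_ring S" "\<psi> \<in> diff_ops coeff_ring S"
  obtains e where "power_linear e \<phi>" "power_linear e \<psi>"
proof -
  obtain a b where "power_linear a \<phi>" "power_linear b \<psi>"
    using assms by (auto simp: diff_ops_iff_power_linear)
  then have "power_linear (max a b) \<phi>" "power_linear (max a b) \<psi>"
    by (auto intro: power_linear_mono)
  then show ?thesis using that by blast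
qed

lemma diff_ops_linear: "\<phi> \<in> diff_ops coeff_ring S \<Longrightarrow> linear \<phi>"
  and diff_ops_extensional: "\<phi> \<in> diff_ops coeff_ring S \<Longrightarrow> \<phi> \<in> extensional C"
  by (simp_all add: diff_ops_iff)

lemma diff_ops_add:
  assumes "\<phi> \<in> diff_ops coeff_ring S" "\<psi> \<in> diff_ops coeff_ring S"
  shows "(\<lambda>x\<in>C. \<phi> x + \<psi> x) \<in> diff_ops coeff_ring S"
proof -
  obtain e where e: "power_linear e \<phi>" "power_linear e \<psi>"
    using common_power_linear assms by blast
  have "linear (\<lambda>x\<in>C. \<phi> x + \<psi> x)"
    using linear_plus[of \<phi> \<psi>] assms diff_ops_linear
    by (subst linear_cong[of _ "\<lambda>x. \<phi> x + \<psi> x"]) auto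
  moreover have "power_linear e (\<lambda>x\<in>C. \<phi> x + \<psi> x)"
    using e by (auto simp: power_linear_def commutes_on_def C_closed C_power distrib_left)
  ultimately show ?thesis by (auto simp: diff_ops_iff_power_linear)
qed

lemma diff_ops_compose:
  assumes "\<phi> \<in> diff_ops coeff_ring S" "\<psi> \<in> diff_ops coeff_ring S"
  shows "compose C \<phi> \<psi> \<in> diff_ops coeff_ring S"
proof -
  obtain e where e: "power_linear e \<phi>" "power_linear e \<psi>"
    using common_power_linear assms by blast
  have "linear (compose C \<phi> \<psi>)"
    using assms[THEN diff_ops_linear] by (auto simp: linear_def compose_def C_closed)
  moreover have "power_linear e (compose C \<phi> \<psi>)"
    using e linear_closed[OF assms(2)[THEN diff_ops_linear]]
    by (auto simp: power_linear_def commutes_on_def compose_def C_closed C_power)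
  ultimately show ?thesis by (auto simp: diff_ops_iff_power_linear compose_def)
qed

lemma mult_op_diff_ops:
  assumes "s \<in> C"
  shows "mult_op S s \<in> diff_ops coeff_ring S"
proof -
  have "linear (mult_op S s)"
    using assms by (auto simp: linear_def mult_op_def S_ops C_closed algebra_simps)
  moreover have "power_linear 0 (mult_op S s)"
    using assms by (auto simp: power_linear_def commutes_on_def mult_op_def S_ops C_closed)
  ultimately show ?thesis by (auto simp: diff_ops_iff_power_linear mult_op_def)
qed

lemma const_diff_ops:
  "(\<lambda>x\<in>C. x) \<in> diff_ops coeff_ring S" "(\<lambda>x\<in>C. 0) \<in> diff_ops coeff_ring S"
  "(\<lambda>x\<in>C. - x) \<in> diff_ops coeff_ring S"
  using mult_op_diff_ops[of 1] mult_op_diff_ops[of 0] mult_op_diff_ops[of "- 1"]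
  by (simp_all add: mult_op_def S_ops C_closed C_uminus cong: restrict_cong)

lemma compose_uminus:
  "\<phi> \<in> diff_ops coeff_ring S \<Longrightarrow> compose C \<phi> (\<lambda>x\<in>C. - x) = (\<lambda>x\<in>C. - \<phi> x)"
  by (auto simp: compose_def linear_uminus[OF diff_ops_linear] cong: restrict_cong)

lemma ring_diff_op_ring: "ring (diff_op_ring coeff_ring S)"
proof (rule ringI)
  note closed = linear_closed[OF diff_ops_linear]
  show "abelian_group (diff_op_ring coeff_ring S)"
  proof (rule abelian_groupI)
    fix \<phi> assume "\<phi> \<in> carrier (diff_op_ring coeff_ring S)"
    then have \<phi>: "\<phi> \<in> diff_ops coeff_ring S" by (simp add: diff_op_ring_def)
    then have "(\<lambda>x\<in>C. - \<phi> x) \<in> diff_ops coeff_ring S"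
      using diff_ops_compose[OF \<phi> const_diff_ops(3)] by (simp add: compose_uminus)
    then show "\<exists>\<psi>\<in>carrier (diff_op_ring coeff_ring S).
        \<psi> \<oplus>\<^bsub>diff_op_ring coeff_ring S\<^esub> \<phi> = \<zero>\<^bsub>diff_op_ring coeff_ring S\<^esub>"
      by (intro bexI[of _ "\<lambda>x\<in>C. - \<phi> x"])
         (auto simp: diff_op_ring_def S_ops cong: restrict_cong)
  next
    fix \<phi> assume "\<phi> \<in> carrier (diff_op_ring coeff_ring S)"
    then show "\<zero>\<^bsub>diff_op_ring coeff_ring S\<^esub> \<oplus>\<^bsub>diff_op_ring coeff_ring S\<^esub> \<phi> = \<phi>"
      using diff_ops_extensional[of \<phi>]
      by (auto simp: diff_op_ring_def S_ops restrict_def extensional_def intro!: ext)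
  qed (auto simp: diff_op_ring_def S_ops diff_ops_add const_diff_ops algebra_simps cong: restrict_cong)
  show "Group.monoid (diff_op_ring coeff_ring S)"
  proof (rule monoidI)
    fix \<phi> assume "\<phi> \<in> carrier (diff_op_ring coeff_ring S)"
    then have \<phi>: "\<phi> \<in> diff_ops coeff_ring S" by (simp add: diff_op_ring_def)
    show "\<one>\<^bsub>diff_op_ring coeff_ring S\<^esub> \<otimes>\<^bsub>diff_op_ring coeff_ring S\<^esub> \<phi> = \<phi>"
      "\<phi> \<otimes>\<^bsub>diff_op_ring coeff_ring S\<^esub> \<one>\<^bsub>diff_op_ring coeff_ring S\<^esub> = \<phi>"
      using closed[OF \<phi>] extensional_arb[OF diff_ops_extensional[OF \<phi>]]
      by (auto simp: diff_op_ring_def compose_def restrict_def intro!: ext)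
  next
    fix \<phi> \<psi> \<chi>
    assume "\<phi> \<in> carrier (diff_op_ring coeff_ring S)" "\<psi> \<in> carrier (diff_op_ring coeff_ring S)"
      "\<chi> \<in> carrier (diff_op_ring coeff_ring S)"
    then show "\<phi> \<otimes>\<^bsub>diff_op_ring coeff_ring S\<^esub> \<psi> \<otimes>\<^bsub>diff_op_ring coeff_ring S\<^esub> \<chi>
      = \<phi> \<otimes>\<^bsub>diff_op_ring coeff_ring S\<^esub> (\<psi> \<otimes>\<^bsub>diff_op_ring coeff_ring S\<^esub> \<chi>)"
      using closed by (auto simp: diff_op_ring_def compose_def cong: restrict_cong)
  qed (auto simp: diff_op_ring_def diff_ops_compose const_diff_ops)
next
  fix \<phi> \<psi> \<chi>
  assume "\<phi> \<in> carrier (diff_op_ring coeff_ring S)" "\<psi> \<in> carrier (diff_op_ring coeff_ring S)"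
    "\<chi> \<in> carrier (diff_op_ring coeff_ring S)"
  then have *: "\<phi> \<in> diff_ops coeff_ring S" "\<psi> \<in> diff_ops coeff_ring S" "\<chi> \<in> diff_ops coeff_ring S"
    by (auto simp: diff_op_ring_def)
  note closed = linear_closed[OF diff_ops_linear]
  show "(\<phi> \<oplus>\<^bsub>diff_op_ring coeff_ring S\<^esub> \<psi>) \<otimes>\<^bsub>diff_op_ring coeff_ring S\<^esub> \<chi>
      = (\<phi> \<otimes>\<^bsub>diff_op_ring coeff_ring S\<^esub> \<chi>) \<oplus>\<^bsub>diff_op_ring coeff_ring S\<^esub> (\<psi> \<otimes>\<^bsub>diff_op_ring coeff_ring S\<^esub> \<chi>)"
    using * closed by (auto simp: diff_op_ring_def S_ops compose_def cong: restrict_cong)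
  show "\<chi> \<otimes>\<^bsub>diff_op_ring coeff_ring S\<^esub> (\<phi> \<oplus>\<^bsub>diff_op_ring coeff_ring S\<^esub> \<psi>)
      = (\<chi> \<otimes>\<^bsub>diff_op_ring coeff_ring S\<^esub> \<phi>) \<oplus>\<^bsub>diff_op_ring coeff_ring S\<^esub> (\<chi> \<otimes>\<^bsub>diff_op_ring coeff_ring S\<^esub> \<psi>)"
    using * closed linear_add[OF diff_ops_linear[OF *(3)]]
    by (auto simp: diff_op_ring_def S_ops compose_def cong: restrict_cong)
qed

end

section \<open>The action of differential operators on localizations\<close>

locale prime_power_localization = prime_power_algebra p m S \<kappa> Y
  for p m :: nat and S :: "('k::comm_ring_1, 's::comm_ring_1) module"
    and \<kappa> :: "'k \<Rightarrow> 's" and Y :: "'s set" +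
  fixes W :: "'s set"
  assumes W_carrier: "W \<subseteq> C" and W_one: "1 \<in> W"
    and W_mult: "\<And>s u. s \<in> W \<Longrightarrow> u \<in> W \<Longrightarrow> s * u \<in> W"
begin

lemma W_closed: "s \<in> W \<Longrightarrow> s \<in> C"
  using W_carrier by blast

lemma W_power: "s \<in> W \<Longrightarrow> s ^ k \<in> W"
  by (induction k) (auto intro: W_one W_mult)

abbreviation frac :: "'s \<Rightarrow> 's \<Rightarrow> ('s \<times> 's) set"
  where "frac \<equiv> fraction (self_module S) W"

abbreviation L :: "('s, ('s \<times> 's) set) module"
  where "L \<equiv> localized_ring S W"

lemma frac_def':
  "frac a s = {(b, u). b \<in> C \<and> u \<in> W \<and> (\<exists>v\<in>W. v * (u * a) = v * (s * b))}"
  by (simp add: fraction_def self_module_def with_smult_def S_ops)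

lemma frac_eq_iff:
  assumes "a \<in> C" "s \<in> W" "b \<in> C" "u \<in> W"
  shows "frac a s = frac b u \<longleftrightarrow> (\<exists>v\<in>W. v * (u * a) = v * (s * b))"
proof
  assume "frac a s = frac b u"
  moreover have "(b, u) \<in> frac b u"
    using assms W_one by (auto simp: frac_def')
  ultimately have "(b, u) \<in> frac a s" by simp
  then show "\<exists>v\<in>W. v * (u * a) = v * (s * b)" by (simp add: frac_def')
next
  have sub: "frac b u \<subseteq> frac a s"
    if *: "a \<in> C" "s \<in> W" "b \<in> C" "u \<in> W" "v \<in> W" "v * (u * a) = v * (s * b)" for a s b u v
  proof clarify
    fix y w assume "(y, w) \<in> frac b u"
    then obtain v' where y: "y \<in> C" "w \<in> W" and v': "v' \<in> W" "v' * (w * b) = v' * (u * y)"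
      by (auto simp: frac_def')
    have "(v * v' * u) * (w * a) = v' * w * (v * (u * a))" by (simp add: mult_ac)
    also have "\<dots> = v * s * (v' * (w * b))" unfolding *(6) by (simp add: mult_ac)
    also have "\<dots> = (v * v' * u) * (s * y)" unfolding v'(2) by (simp add: mult_ac)
    finally have "(v * v' * u) * (w * a) = (v * v' * u) * (s * y)" .
    moreover have "v * v' * u \<in> W" using * v'(1) by (intro W_mult)
    ultimately show "(y, w) \<in> frac a s" using y by (auto simp: frac_def')
  qed
  assume "\<exists>v\<in>W. v * (u * a) = v * (s * b)"
  then obtain v where v: "v \<in> W" "v * (u * a) = v * (s * b)" by blast
  show "frac a s = frac b u"
    using sub[OF assms v] sub[OF assms(3,4,1,2) v(1) v(2)[symmetric]] by blast
qed

lemma frac_eqE: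
  assumes "frac a s = frac b u" "a \<in> C" "s \<in> W" "b \<in> C" "u \<in> W"
  obtains v where "v \<in> W" "v * (u * a) = v * (s * b)"
  using assms(1) frac_eq_iff[OF assms(2-5)] by blast

lemma frac_eqI':
  "v \<in> W \<Longrightarrow> v * (u * a) = v * (s * b) \<Longrightarrow> a \<in> C \<Longrightarrow> s \<in> W \<Longrightarrow> b \<in> C \<Longrightarrow> u \<in> W
    \<Longrightarrow> frac a s = frac b u"
  using frac_eq_iff[of a s b u] by blast

lemma frac_eqI:
  "a \<in> C \<Longrightarrow> s \<in> W \<Longrightarrow> b \<in> C \<Longrightarrow> u \<in> W \<Longrightarrow> u * a = s * b \<Longrightarrow> frac a s = frac b u"
  by (subst frac_eq_iff) (auto intro: bexI[OF _ W_one])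

lemma frac_mem_iff:
  "a \<in> C \<Longrightarrow> s \<in> W \<Longrightarrow> (b, u) \<in> frac a s \<longleftrightarrow> b \<in> C \<and> u \<in> W \<and> frac b u = frac a s"
  using frac_eq_iff[of a s b u] by (auto simp: frac_def')

lemma frac_self: "a \<in> C \<Longrightarrow> s \<in> W \<Longrightarrow> (a, s) \<in> frac a s"
  by (simp add: frac_mem_iff)

lemma carrier_L: "carrier L = {frac a s | a s. a \<in> C \<and> s \<in> W}"
  by (simp add: localized_ring_def localization_def self_module_def with_smult_def)

lemma frac_carrier: "a \<in> C \<Longrightarrow> s \<in> W \<Longrightarrow> frac a s \<in> carrier L"
  by (auto simp: carrier_L)

lemma zero_L: "\<zero>\<^bsub>L\<^esub> = frac 0 1"
  by (simp add: localized_ring_def localization_def self_module_def with_smult_def S_ops)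

lemma UN_frac:
  assumes "a \<in> C" "s \<in> W"
    and "\<And>b u. b \<in> C \<Longrightarrow> u \<in> W \<Longrightarrow> frac b u = frac a s \<Longrightarrow> F b u = F a s"
  shows "(\<Union>(b, u)\<in>frac a s. F b u) = F a s"
proof -
  have "F b u = F a s" if "(b, u) \<in> frac a s" for b u
    using that frac_mem_iff[OF assms(1,2)] by (intro assms(3)) simp_all
  then have "(\<lambda>(b, u). F b u) ` frac a s \<subseteq> {F a s}" by auto
  moreover have "F a s \<in> (\<lambda>(b, u). F b u) ` frac a s"
    using frac_self[OF assms(1,2)] by (rule rev_image_eqI) simp
  ultimately have "(\<lambda>(b, u). F b u) ` frac a s = {F a s}" by blast
  then show ?thesis by simp
qed

lemma add_L:
  assumes "a \<in> C" "s \<in> W" "b \<in> C" "u \<in> W"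
  shows "frac a s \<oplus>\<^bsub>L\<^esub> frac b u = frac (u * a + s * b) (s * u)"
proof -
  have wd: "frac (u' * a' + s' * b') (s' * u') = frac (u * a + s * b) (s * u)"
    if *: "a' \<in> C" "s' \<in> W" "b' \<in> C" "u' \<in> W" "frac a' s' = frac a s" "frac b' u' = frac b u"
    for a' s' b' u'
  proof -
    obtain v where v: "v \<in> W" "v * (s * a') = v * (s' * a)"
      by (rule frac_eqE[OF *(5) *(1,2) assms(1,2)])
    obtain w where w: "w \<in> W" "w * (u * b') = w * (u' * b)"
      by (rule frac_eqE[OF *(6) *(3,4) assms(3,4)])
    have "(v * w) * ((s * u) * (u' * a' + s' * b'))
        = (v * (s * a')) * (w * u * u') + (w * (u * b')) * (v * s * s')"
      by (simp add: algebra_simps)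
    also have "\<dots> = (v * w) * ((s' * u') * (u * a + s * b))"
      unfolding v(2) w(2) by (simp add: algebra_simps)
    finally show ?thesis
      by (rule frac_eqI'[OF W_mult[OF v(1) w(1)]])
        (simp_all add: *(1-4) assms C_closed W_mult W_closed)
  qed
  have inner: "(\<Union>(b', u')\<in>frac b u. frac (u' * a' + s' * b') (s' * u')) = frac (u * a + s * b) (s * u)"
    if *: "a' \<in> C" "s' \<in> W" "frac a' s' = frac a s" for a' s'
  proof -
    have "(\<Union>(b', u')\<in>frac b u. frac (u' * a' + s' * b') (s' * u')) = frac (u * a' + s' * b) (s' * u)"
    proof (rule UN_frac[OF assms(3,4), where F = "\<lambda>b' u'. frac (u' * a' + s' * b') (s' * u')"])
      fix b' u' assume "b' \<in> C" "u' \<in> W" "frac b' u' = frac b u"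
      from wd[OF *(1,2) this(1,2) *(3) this(3)] wd[OF *(1,2) assms(3,4) *(3) refl]
      show "frac (u' * a' + s' * b') (s' * u') = frac (u * a' + s' * b) (s' * u)"
        by (rule trans[OF _ sym])
    qed
    also have "\<dots> = frac (u * a + s * b) (s * u)" by (rule wd[OF *(1,2) assms(3,4) *(3) refl])
    finally show ?thesis .
  qed
  have "frac a s \<oplus>\<^bsub>L\<^esub> frac b u
      = (\<Union>(a', s')\<in>frac a s. \<Union>(b', u')\<in>frac b u. frac (u' * a' + s' * b') (s' * u'))"
    by (simp only: localized_ring_def localization_def self_module_def with_smult_def S_ops
        ring_record_simps partial_object.simps monoid.simps ring.simps module.simps)
  also have "\<dots> = (\<Union>(b', u')\<in>frac b u. frac (u' * a + s * b') (s * u'))"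
    by (rule UN_frac[OF assms(1,2),
          where F = "\<lambda>a' s'. \<Union>(b', u')\<in>frac b u. frac (u' * a' + s' * b') (s' * u')"])
       (rule trans[OF inner inner[symmetric]], assumption+, rule assms, rule assms, rule refl)
  also have "\<dots> = frac (u * a + s * b) (s * u)" by (rule inner[OF assms(1,2) refl])
  finally show ?thesis .
qed

lemma smult_L:
  assumes "a \<in> C" "s \<in> W" "r \<in> C"
  shows "r \<odot>\<^bsub>L\<^esub> frac a s = frac (r * a) s"
proof -
  have "r \<odot>\<^bsub>L\<^esub> frac a s = (\<Union>(a', s')\<in>frac a s. frac (r * a') s')"
    by (simp add: localized_ring_def localization_def self_module_def with_smult_def S_ops)
  also have "\<dots> = frac (r * a) s"
  proof (rule UN_frac[OF assms(1,2), where F = "\<lambda>a s. frac (r * a) s"])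
    fix b u assume *: "b \<in> C" "u \<in> W" "frac b u = frac a s"
    obtain v where v: "v \<in> W" "v * (s * b) = v * (u * a)"
      by (rule frac_eqE[OF *(3) *(1,2) assms(1,2)])
    have "v * (s * (r * b)) = r * (v * (s * b))" by (simp add: mult_ac)
    also have "\<dots> = v * (u * (r * a))" unfolding v(2) by (simp add: mult_ac)
    finally show "frac (r * b) u = frac (r * a) s"
      by (rule frac_eqI'[OF v(1)]) (simp_all add: *(1,2) assms C_closed)
  qed
  finally show ?thesis .
qed

lemma abelian_group_L: "abelian_group (with_smult h L)"
proof (rule abelian_groupI)
  note simps = with_smult_def zero_L add_L C_closed W_closed W_mult W_one
  fix X assume "X \<in> carrier (with_smult h L)"
  then obtain a s where X: "X = frac a s" "a \<in> C" "s \<in> W" by (auto simp: with_smult_def carrier_L)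
  then show "\<zero>\<^bsub>with_smult h L\<^esub> \<oplus>\<^bsub>with_smult h L\<^esub> X = X" by (simp add: simps)
  have "frac (- a) s \<oplus>\<^bsub>L\<^esub> X = frac (s * - a + s * a) (s * s)"
    using X by (simp only: add_L C_uminus)
  also have "\<dots> = frac 0 1"
    using X by (intro frac_eqI) (simp_all add: simps)
  finally have "frac (- a) s \<oplus>\<^bsub>L\<^esub> X = frac 0 1" .
  then show "\<exists>Y\<in>carrier (with_smult h L).
      Y \<oplus>\<^bsub>with_smult h L\<^esub> X = \<zero>\<^bsub>with_smult h L\<^esub>"
    using X by (intro bexI[of _ "frac (- a) s"]) (simp_all add: with_smult_def zero_L frac_carrier C_uminus)
  fix Y assume "Y \<in> carrier (with_smult h L)"
  then obtain b u where Y: "Y = frac b u" "b \<in> C" "u \<in> W" by (auto simp: with_smult_def carrier_L)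
  then show "X \<oplus>\<^bsub>with_smult h L\<^esub> Y \<in> carrier (with_smult h L)"
    using X by (simp add: with_smult_def add_L frac_carrier C_closed W_mult W_closed)
  show "X \<oplus>\<^bsub>with_smult h L\<^esub> Y = Y \<oplus>\<^bsub>with_smult h L\<^esub> X"
    using X Y by (simp add: with_smult_def add_L add.commute mult.commute)
  fix Z assume "Z \<in> carrier (with_smult h L)"
  then obtain c w where Z: "Z = frac c w" "c \<in> C" "w \<in> W" by (auto simp: with_smult_def carrier_L)
  show "X \<oplus>\<^bsub>with_smult h L\<^esub> Y \<oplus>\<^bsub>with_smult h L\<^esub> Z
      = X \<oplus>\<^bsub>with_smult h L\<^esub> (Y \<oplus>\<^bsub>with_smult h L\<^esub> Z)"
    using X Y Z by (simp add: simps algebra_simps)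
qed (auto simp: with_smult_def zero_L frac_carrier C_closed W_one)

lemma prime_power_Suc: "s * s ^ (p ^ e - 1) = s ^ (p ^ e)"
proof -
  have "p ^ e > 0" using prime by (simp add: prime_gt_0_nat)
  then show ?thesis by (simp flip: power_Suc)
qed

lemma action_well_defined:
  assumes "power_linear e P" "linear P" "a \<in> C" "s \<in> W" "b \<in> C" "u \<in> W" "frac a s = frac b u"
  shows "frac (P (a * s ^ (p ^ e - 1))) (s ^ (p ^ e)) = frac (P (b * u ^ (p ^ e - 1))) (u ^ (p ^ e))"
proof -
  let ?q = "p ^ e"
  obtain v where v: "v \<in> W" "v * (u * a) = v * (s * b)"
    by (rule frac_eqE[OF assms(7) assms(3-6)])
  note closed = C_closed(4) C_power W_closed assms(3-6) v(1) linear_closed[OF assms(2)]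
  have "v ^ ?q * (u ^ ?q * P (a * s ^ (?q - 1))) = P (v ^ ?q * (u ^ ?q * (a * s ^ (?q - 1))))"
    by (simp add: power_linearD[OF assms(1)] closed)
  also have "v ^ ?q * (u ^ ?q * (a * s ^ (?q - 1)))
      = (v * (u * a)) * (v ^ (?q - 1) * u ^ (?q - 1) * s ^ (?q - 1))"
    unfolding prime_power_Suc[symmetric] by (simp add: mult_ac)
  also have "\<dots> = v ^ ?q * (s ^ ?q * (b * u ^ (?q - 1)))"
    unfolding prime_power_Suc[symmetric] v(2) by (simp add: mult_ac)
  also have "P \<dots> = v ^ ?q * (s ^ ?q * P (b * u ^ (?q - 1)))"
    by (simp add: power_linearD[OF assms(1)] closed)
  finally show ?thesis
    by (rule frac_eqI'[OF W_power[OF v(1)]]) (simp_all add: W_power closed)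
qed

text \<open>
  The exponent \<open>e\<close> may be enlarged, so that finitely many operators can be treated with a common
  one.
\<close>
lemma action_exponent:
  assumes "power_linear e P" "linear P" "e \<le> e'" "a \<in> C" "s \<in> W"
  shows "frac (P (a * s ^ (p ^ e' - 1))) (s ^ (p ^ e')) = frac (P (a * s ^ (p ^ e - 1))) (s ^ (p ^ e))"
proof -
  note closed = C_closed(4) C_power W_closed assms(4,5) linear_closed[OF assms(2)]
  have q: "p ^ e > 0" "p ^ (e' - e) > 0" "p ^ e' = p ^ e * p ^ (e' - e)"
    using prime assms(3) by (auto simp: prime_gt_0_nat simp flip: power_add)
  obtain k where k: "p ^ (e' - e) = Suc k" using q(2) gr0_implies_Suc by blast
  have "p ^ e' - 1 = p ^ e * (p ^ (e' - e) - 1) + (p ^ e - 1)"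
  proof -
    have "p ^ e + p ^ e * k - 1 = p ^ e * k + (p ^ e - 1)" using q(1) by linarith
    then show ?thesis unfolding q(3) k by simp
  qed
  then have *: "s ^ (p ^ e' - 1) = (s ^ (p ^ (e' - e) - 1)) ^ (p ^ e) * s ^ (p ^ e - 1)"
    by (simp add: power_add mult.commute flip: power_mult)
  have "P (a * s ^ (p ^ e' - 1)) = P ((s ^ (p ^ (e' - e) - 1)) ^ (p ^ e) * (a * s ^ (p ^ e - 1)))"
    unfolding * by (simp add: mult_ac)
  also have "\<dots> = (s ^ (p ^ (e' - e) - 1)) ^ (p ^ e) * P (a * s ^ (p ^ e - 1))"
    by (simp add: power_linearD[OF assms(1)] closed)
  finally have "s ^ (p ^ e) * P (a * s ^ (p ^ e' - 1))
      = (s * s ^ (p ^ (e' - e) - 1)) ^ (p ^ e) * P (a * s ^ (p ^ e - 1))"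
    by (simp add: power_mult_distrib mult_ac)
  also have "(s * s ^ (p ^ (e' - e) - 1)) ^ (p ^ e) = s ^ (p ^ e')"
    unfolding prime_power_Suc using q(3) by (simp add: mult.commute flip: power_mult)
  finally show ?thesis
    by (intro frac_eqI W_power) (simp_all add: closed)
qed

text \<open>
  A fraction \<open>a/s\<close> equals \<open>a s\<^sup>q\<^sup>-\<^sup>1/s\<^sup>q\<close>, and an operator that commutes with \<open>q\<close>-th powers must
  be linear over the new denominator.
\<close>
definition action :: "('s \<Rightarrow> 's) \<Rightarrow> ('s \<times> 's) set \<Rightarrow> ('s \<times> 's) set"
  where "action P X =
    (let q = p ^ (SOME e. power_linear e P) in \<Union>(a, s)\<in>X. frac (P (a * s ^ (q - 1))) (s ^ q))"

lemma action_frac: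
  assumes "linear P" "power_linear e P" "a \<in> C" "s \<in> W"
  shows "action P (frac a s) = frac (P (a * s ^ (p ^ e - 1))) (s ^ (p ^ e))"
proof -
  define e0 where "e0 = (SOME e. power_linear e P)"
  have e0: "power_linear e0 P" unfolding e0_def using assms(2) by (rule someI)
  have "action P (frac a s) = frac (P (a * s ^ (p ^ e0 - 1))) (s ^ (p ^ e0))"
    unfolding action_def Let_def e0_def[symmetric]
  proof (rule UN_frac[OF assms(3,4), where F = "\<lambda>a s. frac (P (a * s ^ (p ^ e0 - 1))) (s ^ (p ^ e0))"])
    fix b u assume "b \<in> C" "u \<in> W" "frac b u = frac a s"
    then show "frac (P (b * u ^ (p ^ e0 - 1))) (u ^ (p ^ e0)) = frac (P (a * s ^ (p ^ e0 - 1))) (s ^ (p ^ e0))"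
      by (rule action_well_defined[OF e0 assms(1) _ _ assms(3,4)])
  qed
  also have "\<dots> = frac (P (a * s ^ (p ^ e - 1))) (s ^ (p ^ e))"
  proof (cases "e \<le> e0")
    case True
    then show ?thesis by (rule action_exponent[OF assms(2,1) _ assms(3,4)])
  next
    case False
    then show ?thesis by (intro action_exponent[OF e0 assms(1) _ assms(3,4), symmetric]) simp
  qed
  finally show ?thesis .
qed

definition L_action :: "('s \<Rightarrow> 's) \<Rightarrow> ('s \<times> 's) set \<Rightarrow> ('s \<times> 's) set"
  where "L_action = (\<lambda>P\<in>diff_ops coeff_ring S. \<lambda>X\<in>carrier L. action P X)"

lemma L_action_frac:
  assumes "P \<in> diff_ops coeff_ring S" "power_linear e P" "a \<in> C" "s \<in> W"
  shows "L_action P (frac a s) = frac (P (a * s ^ (p ^ e - 1))) (s ^ (p ^ e))"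
  using action_frac[OF diff_ops_linear[OF assms(1)] assms(2-4)] assms(1) frac_carrier[OF assms(3,4)]
  by (simp add: L_action_def)

lemma L_action_closed:
  assumes "P \<in> diff_ops coeff_ring S" "X \<in> carrier L"
  shows "L_action P X \<in> carrier L"
proof -
  obtain a s where X: "X = frac a s" "a \<in> C" "s \<in> W" using assms(2) by (auto simp: carrier_L)
  obtain e where "power_linear e P" using assms(1) by (auto simp: diff_ops_iff_power_linear)
  then have "L_action P X = frac (P (a * s ^ (p ^ e - 1))) (s ^ (p ^ e))"
    unfolding X(1) by (rule L_action_frac[OF assms(1) _ X(2,3)])
  also have "\<dots> \<in> carrier L"
    using X linear_closed[OF diff_ops_linear[OF assms(1)]]
    by (intro frac_carrier W_power) (simp_all add: C_closed C_power W_closed)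
  finally show ?thesis .
qed

lemma left_module_L: "left_module (diff_op_ring coeff_ring S) (with_smult L_action L)"
proof -
  let ?D = "diff_ops coeff_ring S"
  have add_op: "L_action (\<lambda>x\<in>C. P x + Q x) X = L_action P X \<oplus>\<^bsub>L\<^esub> L_action Q X"
    if PQ: "P \<in> ?D" "Q \<in> ?D" and XL: "X \<in> carrier L" for P Q X
  proof -
    obtain a s where X: "X = frac a s" "a \<in> C" "s \<in> W" using XL by (auto simp: carrier_L)
    obtain e1 where e1: "power_linear e1 (\<lambda>x\<in>C. P x + Q x)"
      using diff_ops_add[OF PQ] by (auto simp only: diff_ops_iff_power_linear)
    obtain e2 where e2: "power_linear e2 P" "power_linear e2 Q"
      by (rule common_power_linear[OF PQ])
    define e where "e = max e1 e2"
    have e: "power_linear e (\<lambda>x\<in>C. P x + Q x)" "power_linear e P" "power_linear e Q"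
      using e1 e2 by (auto simp: e_def intro: power_linear_mono)
    note closed = X(2,3) linear_closed[OF diff_ops_linear[OF PQ(1)]] linear_closed[OF diff_ops_linear[OF PQ(2)]]
      C_closed C_power W_closed W_power
    let ?b = "a * s ^ (p ^ e - 1)" and ?u = "s ^ (p ^ e)"
    have "L_action (\<lambda>x\<in>C. P x + Q x) X = frac (P ?b + Q ?b) ?u"
      unfolding X(1) L_action_frac[OF diff_ops_add[OF PQ] e(1) X(2,3)] by (simp add: closed)
    also have "\<dots> = frac (?u * P ?b + ?u * Q ?b) (?u * ?u)"
      by (rule frac_eqI) (simp_all add: closed W_mult distrib_left mult.assoc)
    also have "\<dots> = frac (P ?b) ?u \<oplus>\<^bsub>L\<^esub> frac (Q ?b) ?u"
      by (rule add_L[symmetric]) (simp_all add: closed)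
    finally show ?thesis
      unfolding X(1) L_action_frac[OF PQ(1) e(2) X(2,3)] L_action_frac[OF PQ(2) e(3) X(2,3)] .
  qed
  have add_arg: "L_action P (X \<oplus>\<^bsub>L\<^esub> Y) = L_action P X \<oplus>\<^bsub>L\<^esub> L_action P Y"
    if P: "P \<in> ?D" and XL: "X \<in> carrier L" and YL: "Y \<in> carrier L" for P X Y
  proof -
    obtain a s where X: "X = frac a s" "a \<in> C" "s \<in> W" using XL by (auto simp: carrier_L)
    obtain b u where Y: "Y = frac b u" "b \<in> C" "u \<in> W" using YL by (auto simp: carrier_L)
    obtain e where e: "power_linear e P" using P by (auto simp: diff_ops_iff_power_linear)
    let ?q = "p ^ e"
    note closed = X(2,3) Y(2,3) linear_closed[OF diff_ops_linear[OF P]] C_closed C_power W_closed W_power W_mult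
    have "(u * a + s * b) * (s * u) ^ (?q - 1)
        = (u * u ^ (?q - 1)) * (a * s ^ (?q - 1)) + (s * s ^ (?q - 1)) * (b * u ^ (?q - 1))"
      by (simp add: power_mult_distrib algebra_simps)
    also have "\<dots> = u ^ ?q * (a * s ^ (?q - 1)) + s ^ ?q * (b * u ^ (?q - 1))"
      by (simp only: prime_power_Suc)
    finally have "P ((u * a + s * b) * (s * u) ^ (?q - 1))
        = u ^ ?q * P (a * s ^ (?q - 1)) + s ^ ?q * P (b * u ^ (?q - 1))"
      by (simp add: linear_add[OF diff_ops_linear[OF P]] power_linearD[OF e] closed)
    then have "L_action P (X \<oplus>\<^bsub>L\<^esub> Y) = frac (u ^ ?q * P (a * s ^ (?q - 1))
        + s ^ ?q * P (b * u ^ (?q - 1))) (s ^ ?q * u ^ ?q)"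
      unfolding X(1) Y(1) add_L[OF X(2,3) Y(2,3)]
      by (subst L_action_frac[OF P e]) (simp_all add: closed power_mult_distrib)
    also have "\<dots> = frac (P (a * s ^ (?q - 1))) (s ^ ?q) \<oplus>\<^bsub>L\<^esub> frac (P (b * u ^ (?q - 1))) (u ^ ?q)"
      by (rule add_L[symmetric]) (simp_all add: closed)
    finally show ?thesis
      unfolding X(1) Y(1) L_action_frac[OF P e X(2,3)] L_action_frac[OF P e Y(2,3)] .
  qed
  have mult: "L_action (compose C P Q) X = L_action P (L_action Q X)"
    if PQ: "P \<in> ?D" "Q \<in> ?D" and XL: "X \<in> carrier L" for P Q X
  proof -
    obtain a s where X: "X = frac a s" "a \<in> C" "s \<in> W" using XL by (auto simp: carrier_L)
    obtain e1 where e1: "power_linear e1 (compose C P Q)"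
      using diff_ops_compose[OF PQ] by (auto simp only: diff_ops_iff_power_linear)
    obtain e2 where e2: "power_linear e2 P" "power_linear e2 Q"
      by (rule common_power_linear[OF PQ])
    define e where "e = max e1 e2"
    have e: "power_linear e (compose C P Q)" "power_linear e P" "power_linear e Q"
      using e1 e2 by (auto simp: e_def intro: power_linear_mono)
    let ?q = "p ^ e"
    note closed = X(2,3) linear_closed[OF diff_ops_linear[OF PQ(1)]] linear_closed[OF diff_ops_linear[OF PQ(2)]]
      C_closed C_power W_closed W_power
    let ?b = "Q (a * s ^ (?q - 1))"
    have "P (?b * (s ^ ?q) ^ (?q - 1)) = (s ^ (?q - 1)) ^ ?q * P ?b"
      using power_linearD[OF e(2), of "s ^ (?q - 1)" ?b]
      by (simp add: closed mult.commute flip: power_mult)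
    moreover have "s ^ ?q * (s ^ (?q - 1)) ^ ?q = (s ^ ?q) ^ ?q"
      by (simp only: power_mult_distrib[symmetric] prime_power_Suc)
    ultimately have "frac (P (?b * (s ^ ?q) ^ (?q - 1))) ((s ^ ?q) ^ ?q) = frac (P ?b) (s ^ ?q)"
      by (intro frac_eqI) (auto simp: closed mult.assoc[symmetric])
    moreover have "L_action (compose C P Q) X = frac (P ?b) (s ^ ?q)"
      unfolding X(1) L_action_frac[OF diff_ops_compose[OF PQ] e(1) X(2,3)]
      by (simp add: compose_def closed)
    moreover have "L_action P (L_action Q X) = frac (P (?b * (s ^ ?q) ^ (?q - 1))) ((s ^ ?q) ^ ?q)"
      unfolding X(1) L_action_frac[OF PQ(2) e(3) X(2,3)]
      by (rule L_action_frac[OF PQ(1) e(2)]) (simp_all add: closed)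
    ultimately show ?thesis by simp
  qed
  have one: "L_action (\<lambda>x\<in>C. x) X = X" if XL: "X \<in> carrier L" for X
  proof -
    obtain a s where X: "X = frac a s" "a \<in> C" "s \<in> W" using XL by (auto simp: carrier_L)
    have "power_linear 0 (\<lambda>x\<in>C. x)"
      by (auto simp: power_linear_def commutes_on_def C_closed)
    from L_action_frac[OF const_diff_ops(1) this X(2,3)] show ?thesis by (simp add: X)
  qed
  show ?thesis
    unfolding left_module_def
    by (intro conjI ballI ring_diff_op_ring abelian_group_L)
       (simp_all add: with_smult_def diff_op_ring_def S_ops L_action_closed add_op add_arg mult one)
qed

lemma extends_action_L: "extends_action coeff_ring S W L_action"
proof -
  have "L_action (mult_op S r) X = r \<odot>\<^bsub>L\<^esub> X" if r: "r \<in> C" and XL: "X \<in> carrier L" for r X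
  proof -
    obtain a s where X: "X = frac a s" "a \<in> C" "s \<in> W" using XL by (auto simp: carrier_L)
    have "power_linear 0 (mult_op S r)"
      using r by (auto simp: power_linear_def commutes_on_def mult_op_def S_ops C_closed)
    from L_action_frac[OF mult_op_diff_ops[OF r] this X(2,3)] show ?thesis
      using X r by (simp add: smult_L) (simp add: mult_op_def S_ops)
  qed
  moreover have "L_action P (frac a 1) = frac (P a) 1" if "P \<in> diff_ops coeff_ring S" "a \<in> C" for P a
  proof -
    have "\<exists>e. power_linear e P" using that by (simp add: diff_ops_iff_power_linear)
    then obtain e where e: "power_linear e P" by blast
    show ?thesis using L_action_frac[OF that(1) e that(2) W_one] by simp
  qed
  moreover have "L_action \<in> diff_ops coeff_ring S \<rightarrow>\<^sub>E (carrier L \<rightarrow>\<^sub>E carrier L)"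
    using L_action_closed by (auto simp: L_action_def PiE_iff)
  ultimately show ?thesis
    using left_module_L by (simp add: extends_action_def S_ops)
qed

text \<open>
  For any extension, \<open>s\<^sup>q\<close> times the image of \<open>a/s\<close> is the image of \<open>a s\<^sup>q\<^sup>-\<^sup>1/1\<close>, which is
  prescribed; and \<open>s\<^sup>q\<close> is invertible in the localization.
\<close>
lemma extends_action_unique:
  assumes h: "extends_action coeff_ring S W h"
  shows "h = L_action"
proof -
  let ?D = "diff_ops coeff_ring S"
  have h_ext: "h \<in> ?D \<rightarrow>\<^sub>E (carrier L \<rightarrow>\<^sub>E carrier L)"
    and h_mod: "left_module (diff_op_ring coeff_ring S) (with_smult h L)"
    and h_mult: "\<And>r X. r \<in> C \<Longrightarrow> X \<in> carrier L \<Longrightarrow> h (mult_op S r) X = r \<odot>\<^bsub>L\<^esub> X"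
    and h_frac: "\<And>P a. P \<in> ?D \<Longrightarrow> a \<in> C \<Longrightarrow> h P (frac a 1) = frac (P a) 1"
    using h by (simp_all add: extends_action_def S_ops Let_def)
  have h_comp: "h (compose C P Q) X = h P (h Q X)" if "P \<in> ?D" "Q \<in> ?D" "X \<in> carrier L" for P Q X
    using h_mod that by (simp add: left_module_def with_smult_def diff_op_ring_def)
  have eq: "h P X = L_action P X" if P: "P \<in> ?D" and X: "X \<in> carrier L" for P X
  proof -
    obtain a s where as: "X = frac a s" "a \<in> C" "s \<in> W" using X by (auto simp: carrier_L)
    obtain e where e: "power_linear e P" using P by (auto simp: diff_ops_iff_power_linear)
    let ?q = "p ^ e"
    have "h P X \<in> carrier L" using h_ext P X by auto
    then obtain b u where bu: "h P X = frac b u" "b \<in> C" "u \<in> W" by (auto simp: carrier_L)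
    note closed = as(2,3) bu(2,3) linear_closed[OF diff_ops_linear[OF P]] C_closed C_power W_closed W_power
    have sq: "s ^ ?q \<in> C" by (simp add: closed)
    have comm: "compose C (mult_op S (s ^ ?q)) P = compose C P (mult_op S (s ^ ?q))"
      using power_linearD[OF e] sq as
      by (auto simp: compose_def mult_op_def S_ops closed cong: restrict_cong)
    have "frac (s ^ ?q * b) u = h (mult_op S (s ^ ?q)) (h P X)"
      using h_mult[OF sq \<open>h P X \<in> carrier L\<close>] bu by (simp add: smult_L closed)
    also have "\<dots> = h P (h (mult_op S (s ^ ?q)) X)"
      using h_comp[OF mult_op_diff_ops[OF sq] P X] h_comp[OF P mult_op_diff_ops[OF sq] X] comm by simp
    also have "h (mult_op S (s ^ ?q)) X = frac (s ^ ?q * a) s"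
      using h_mult[OF sq X] as by (simp add: smult_L closed)
    also have "\<dots> = frac (a * s ^ (?q - 1)) 1"
      by (rule frac_eqI) (auto simp: closed W_one prime_power_Suc[symmetric])
    also have "h P \<dots> = frac (P (a * s ^ (?q - 1))) 1"
      using P by (intro h_frac) (simp_all add: closed)
    finally have "frac (s ^ ?q * b) u = frac (P (a * s ^ (?q - 1))) 1" .
    then obtain v where v: "v \<in> W" "v * (1 * (s ^ ?q * b)) = v * (u * P (a * s ^ (?q - 1)))"
      by (rule frac_eqE) (simp_all add: closed W_one)
    have "frac b u = frac (P (a * s ^ (?q - 1))) (s ^ ?q)"
      by (rule frac_eqI'[OF v(1)]) (use v(2) in \<open>simp_all add: closed\<close>)
    then show ?thesis using bu L_action_frac[OF P e as(2,3)] as(1) by simp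
  qed
  have "L_action \<in> ?D \<rightarrow>\<^sub>E (carrier L \<rightarrow>\<^sub>E carrier L)"
    using extends_action_L by (simp add: extends_action_def Let_def)
  then show ?thesis
  proof (rule PiE_ext[OF h_ext])
    fix P assume "P \<in> ?D"
    then show "h P = L_action P"
      by (intro PiE_ext[OF PiE_mem[OF h_ext] PiE_mem[OF \<open>L_action \<in> _\<close>] eq])
  qed
qed

lemma D_localization_eq: "D_localization coeff_ring S W = with_smult L_action L"
  unfolding D_localization_def
  using extends_action_L extends_action_unique by (metis (no_types, lifting) the_equality)

end

section \<open>Submodules and quotients of left modules\<close>

definition left_submodule ::
    "('r, 'x) ring_scheme \<Rightarrow> ('r, 'm, 'y) module_scheme \<Rightarrow> 'm set \<Rightarrow> bool"
  where "left_submodule D M K \<longleftrightarrow> K \<subseteq> carrier M \<and> \<zero>\<^bsub>M\<^esub> \<in> K \<and>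
    (\<forall>x\<in>K. \<forall>y\<in>K. x \<oplus>\<^bsub>M\<^esub> y \<in> K) \<and> (\<forall>P\<in>carrier D. \<forall>x\<in>K. P \<odot>\<^bsub>M\<^esub> x \<in> K)"

lemma left_moduleD:
  assumes "left_module D M"
  shows "ring D" "abelian_group M"
    "\<And>P x. P \<in> carrier D \<Longrightarrow> x \<in> carrier M \<Longrightarrow> P \<odot>\<^bsub>M\<^esub> x \<in> carrier M"
    "\<And>P Q x. P \<in> carrier D \<Longrightarrow> Q \<in> carrier D \<Longrightarrow> x \<in> carrier M \<Longrightarrow>
      (P \<oplus>\<^bsub>D\<^esub> Q) \<odot>\<^bsub>M\<^esub> x = (P \<odot>\<^bsub>M\<^esub> x) \<oplus>\<^bsub>M\<^esub> (Q \<odot>\<^bsub>M\<^esub> x)"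
    "\<And>P x y. P \<in> carrier D \<Longrightarrow> x \<in> carrier M \<Longrightarrow> y \<in> carrier M \<Longrightarrow>
      P \<odot>\<^bsub>M\<^esub> (x \<oplus>\<^bsub>M\<^esub> y) = (P \<odot>\<^bsub>M\<^esub> x) \<oplus>\<^bsub>M\<^esub> (P \<odot>\<^bsub>M\<^esub> y)"
    "\<And>P Q x. P \<in> carrier D \<Longrightarrow> Q \<in> carrier D \<Longrightarrow> x \<in> carrier M \<Longrightarrow>
      (P \<otimes>\<^bsub>D\<^esub> Q) \<odot>\<^bsub>M\<^esub> x = P \<odot>\<^bsub>M\<^esub> (Q \<odot>\<^bsub>M\<^esub> x)"
    "\<And>x. x \<in> carrier M \<Longrightarrow> \<one>\<^bsub>D\<^esub> \<odot>\<^bsub>M\<^esub> x = x"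
  using assms unfolding left_module_def by auto

lemma left_submoduleD:
  assumes "left_submodule D M K"
  shows "K \<subseteq> carrier M" "\<zero>\<^bsub>M\<^esub> \<in> K" "\<And>x y. x \<in> K \<Longrightarrow> y \<in> K \<Longrightarrow> x \<oplus>\<^bsub>M\<^esub> y \<in> K"
    "\<And>P x. P \<in> carrier D \<Longrightarrow> x \<in> K \<Longrightarrow> P \<odot>\<^bsub>M\<^esub> x \<in> K"
  using assms unfolding left_submodule_def by auto

lemma left_module_zero_smult:
  assumes M: "left_module D M" and x: "x \<in> carrier M"
  shows "\<zero>\<^bsub>D\<^esub> \<odot>\<^bsub>M\<^esub> x = \<zero>\<^bsub>M\<^esub>"
proof -
  interpret D: ring D by (rule left_moduleD[OF M])
  interpret M: abelian_group M by (rule left_moduleD[OF M])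
  have c: "\<zero>\<^bsub>D\<^esub> \<odot>\<^bsub>M\<^esub> x \<in> carrier M" using left_moduleD(3)[OF M D.zero_closed x] .
  have "(\<zero>\<^bsub>D\<^esub> \<odot>\<^bsub>M\<^esub> x) \<oplus>\<^bsub>M\<^esub> (\<zero>\<^bsub>D\<^esub> \<odot>\<^bsub>M\<^esub> x) = \<zero>\<^bsub>D\<^esub> \<odot>\<^bsub>M\<^esub> x"
    using left_moduleD(4)[OF M D.zero_closed D.zero_closed x] by simp
  then show ?thesis using c by (simp add: M.add.r_cancel_one)
qed

lemma left_module_minus_one_smult:
  assumes M: "left_module D M" and x: "x \<in> carrier M"
  shows "(\<ominus>\<^bsub>D\<^esub> \<one>\<^bsub>D\<^esub>) \<odot>\<^bsub>M\<^esub> x = \<ominus>\<^bsub>M\<^esub> x"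
proof -
  interpret D: ring D by (rule left_moduleD[OF M])
  interpret M: abelian_group M by (rule left_moduleD[OF M])
  have m: "\<ominus>\<^bsub>D\<^esub> \<one>\<^bsub>D\<^esub> \<in> carrier D" by simp
  have "((\<ominus>\<^bsub>D\<^esub> \<one>\<^bsub>D\<^esub>) \<odot>\<^bsub>M\<^esub> x) \<oplus>\<^bsub>M\<^esub> x = \<zero>\<^bsub>M\<^esub>"
    using left_moduleD(4)[OF M m D.one_closed x] left_moduleD(7)[OF M x]
    by (simp add: D.l_neg left_module_zero_smult[OF M x])
  then show ?thesis
    using M.minus_equality[of "(\<ominus>\<^bsub>D\<^esub> \<one>\<^bsub>D\<^esub>) \<odot>\<^bsub>M\<^esub> x" x] x left_moduleD(3)[OF M m x] by simp
qed

lemma left_submodule_subgroup: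
  assumes M: "left_module D M" and K: "left_submodule D M K"
  shows "abelian_subgroup K M"
proof -
  interpret D: ring D by (rule left_moduleD[OF M])
  interpret M: abelian_group M by (rule left_moduleD[OF M])
  have "\<ominus>\<^bsub>M\<^esub> x \<in> K" if "x \<in> K" for x
    using left_submoduleD(4)[OF K, of "\<ominus>\<^bsub>D\<^esub> \<one>\<^bsub>D\<^esub>" x] that left_submoduleD(1)[OF K]
      left_module_minus_one_smult[OF M, of x] by auto
  then have "subgroup K (add_monoid M)"
    using left_submoduleD[OF K] by (intro M.add.subgroupI) (auto simp: a_inv_def)
  then show ?thesis
    using M.abelian_group_axioms by (intro abelian_subgroupI3) (auto simp: additive_subgroup_def)
qed

lemma quotient_smult:
  assumes M: "left_module D M" and K: "left_submodule D M K"
    and P: "P \<in> carrier D" and x: "x \<in> carrier M"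
  shows "P \<odot>\<^bsub>quotient_module M K\<^esub> (K +>\<^bsub>M\<^esub> x) = K +>\<^bsub>M\<^esub> (P \<odot>\<^bsub>M\<^esub> x)"
proof -
  interpret K: abelian_subgroup K M by (rule left_submodule_subgroup[OF M K])
  have "K +>\<^bsub>M\<^esub> (P \<odot>\<^bsub>M\<^esub> y) = K +>\<^bsub>M\<^esub> (P \<odot>\<^bsub>M\<^esub> x)" if y: "y \<in> K +>\<^bsub>M\<^esub> x" for y
  proof -
    obtain k where k: "k \<in> K" "y = k \<oplus>\<^bsub>M\<^esub> x"
      using y by (auto simp: a_r_coset_def r_coset_def)
    have kM: "k \<in> carrier M" using k left_submoduleD(1)[OF K] by blast
    have Pk: "P \<odot>\<^bsub>M\<^esub> k \<in> K" by (rule left_submoduleD(4)[OF K P k(1)])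
    have "K +>\<^bsub>M\<^esub> (P \<odot>\<^bsub>M\<^esub> y) = (K +>\<^bsub>M\<^esub> (P \<odot>\<^bsub>M\<^esub> k)) +>\<^bsub>M\<^esub> (P \<odot>\<^bsub>M\<^esub> x)"
      unfolding k(2) left_moduleD(5)[OF M P kM x]
      using left_submoduleD(1)[OF K] left_moduleD(3)[OF M P] kM x
      by (simp add: K.a_coset_add_assoc)
    also have "K +>\<^bsub>M\<^esub> (P \<odot>\<^bsub>M\<^esub> k) = K" using Pk by (rule K.a_rcos_const)
    finally show ?thesis .
  qed
  moreover have "x \<in> K +>\<^bsub>M\<^esub> x" using x by (rule K.a_rcos_self)
  ultimately have "(\<Union>y\<in>K +>\<^bsub>M\<^esub> x. K +>\<^bsub>M\<^esub> (P \<odot>\<^bsub>M\<^esub> y)) = K +>\<^bsub>M\<^esub> (P \<odot>\<^bsub>M\<^esub> x)"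
    by blast
  then show ?thesis by (simp add: quotient_module_def)
qed

lemma carrier_quotient_module: "carrier (quotient_module M K) = {K +>\<^bsub>M\<^esub> x | x. x \<in> carrier M}"
  by (auto simp: quotient_module_def A_RCOSETS_def RCOSETS_def a_r_coset_def)

lemma zero_quotient_module: "\<zero>\<^bsub>quotient_module M K\<^esub> = K"
  by (simp add: quotient_module_def)

lemma quotient_smult_eq_zero:
  assumes M: "left_module D M" and K: "left_submodule D M K"
    and P: "P \<in> carrier D" and x: "x \<in> carrier M" and "P \<odot>\<^bsub>M\<^esub> x \<in> K"
  shows "P \<odot>\<^bsub>quotient_module M K\<^esub> (K +>\<^bsub>M\<^esub> x) = \<zero>\<^bsub>quotient_module M K\<^esub>"
proof -
  interpret K: abelian_subgroup K M by (rule left_submodule_subgroup[OF M K])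
  show ?thesis
    using assms(5) by (simp add: quotient_smult[OF M K P x] zero_quotient_module K.a_rcos_const)
qed

lemma left_module_quotient:
  assumes M: "left_module D M" and K: "left_submodule D M K"
  shows "left_module D (quotient_module M K)"
proof -
  interpret K: abelian_subgroup K M by (rule left_submodule_subgroup[OF M K])
  interpret D: ring D by (rule left_moduleD[OF M])
  let ?Q = "quotient_module M K"
  note smult = quotient_smult[OF M K] and closed = left_moduleD(3)[OF M]
  have add: "(K +>\<^bsub>M\<^esub> x) \<oplus>\<^bsub>?Q\<^esub> (K +>\<^bsub>M\<^esub> y) = K +>\<^bsub>M\<^esub> (x \<oplus>\<^bsub>M\<^esub> y)"
    if "x \<in> carrier M" "y \<in> carrier M" for x y
    using K.a_rcos_sum[OF that] by (simp add: quotient_module_def)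
  have cosetE: "\<exists>x\<in>carrier M. X = K +>\<^bsub>M\<^esub> x" if "X \<in> carrier ?Q" for X
    using that by (auto simp: carrier_quotient_module)
  have coset: "K +>\<^bsub>M\<^esub> x \<in> carrier ?Q" if "x \<in> carrier M" for x
    using that by (auto simp: carrier_quotient_module)
  have zero: "\<zero>\<^bsub>?Q\<^esub> = K +>\<^bsub>M\<^esub> \<zero>\<^bsub>M\<^esub>"
    using K.a_subset by (simp add: zero_quotient_module)
  have "abelian_group ?Q"
  proof (rule abelian_groupI)
    fix X assume "X \<in> carrier ?Q"
    then obtain x where x: "x \<in> carrier M" "X = K +>\<^bsub>M\<^esub> x" using cosetE by blast
    then show "\<zero>\<^bsub>?Q\<^esub> \<oplus>\<^bsub>?Q\<^esub> X = X" by (simp add: zero add)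
    show "\<exists>Y\<in>carrier ?Q. Y \<oplus>\<^bsub>?Q\<^esub> X = \<zero>\<^bsub>?Q\<^esub>"
      using x by (intro bexI[of _ "K +>\<^bsub>M\<^esub> (\<ominus>\<^bsub>M\<^esub> x)"]) (simp_all add: zero add coset K.l_neg)
    fix Y assume "Y \<in> carrier ?Q"
    then obtain y where y: "y \<in> carrier M" "Y = K +>\<^bsub>M\<^esub> y" using cosetE by blast
    show "X \<oplus>\<^bsub>?Q\<^esub> Y \<in> carrier ?Q" using x y by (simp add: add coset)
    show "X \<oplus>\<^bsub>?Q\<^esub> Y = Y \<oplus>\<^bsub>?Q\<^esub> X" using x y by (simp add: add K.a_comm)
    fix Z assume "Z \<in> carrier ?Q"
    then obtain z where z: "z \<in> carrier M" "Z = K +>\<^bsub>M\<^esub> z" using cosetE by blast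
    show "X \<oplus>\<^bsub>?Q\<^esub> Y \<oplus>\<^bsub>?Q\<^esub> Z = X \<oplus>\<^bsub>?Q\<^esub> (Y \<oplus>\<^bsub>?Q\<^esub> Z)"
      using x y z by (simp add: add K.a_assoc)
  qed (simp add: zero coset)
  moreover have "P \<odot>\<^bsub>?Q\<^esub> X \<in> carrier ?Q" if "P \<in> carrier D" "X \<in> carrier ?Q" for P X
    using cosetE[OF that(2)] that(1) by (auto simp: smult coset closed)
  moreover have "(P \<oplus>\<^bsub>D\<^esub> Q) \<odot>\<^bsub>?Q\<^esub> X = (P \<odot>\<^bsub>?Q\<^esub> X) \<oplus>\<^bsub>?Q\<^esub> (Q \<odot>\<^bsub>?Q\<^esub> X)"
    if "P \<in> carrier D" "Q \<in> carrier D" "X \<in> carrier ?Q" for P Q X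
    using cosetE[OF that(3)] that(1,2) by (auto simp: smult add closed left_moduleD(4)[OF M])
  moreover have "P \<odot>\<^bsub>?Q\<^esub> (X \<oplus>\<^bsub>?Q\<^esub> Y) = (P \<odot>\<^bsub>?Q\<^esub> X) \<oplus>\<^bsub>?Q\<^esub> (P \<odot>\<^bsub>?Q\<^esub> Y)"
    if "P \<in> carrier D" "X \<in> carrier ?Q" "Y \<in> carrier ?Q" for P X Y
    using cosetE[OF that(2)] cosetE[OF that(3)] that(1)
    by (auto simp: smult add closed left_moduleD(5)[OF M])
  moreover have "(P \<otimes>\<^bsub>D\<^esub> Q) \<odot>\<^bsub>?Q\<^esub> X = P \<odot>\<^bsub>?Q\<^esub> (Q \<odot>\<^bsub>?Q\<^esub> X)"
    if "P \<in> carrier D" "Q \<in> carrier D" "X \<in> carrier ?Q" for P Q X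
    using cosetE[OF that(3)] that(1,2) by (auto simp: smult closed left_moduleD(6)[OF M])
  moreover have "\<one>\<^bsub>D\<^esub> \<odot>\<^bsub>?Q\<^esub> X = X" if "X \<in> carrier ?Q" for X
    using cosetE[OF that] by (auto simp: smult left_moduleD(7)[OF M])
  ultimately show ?thesis
    unfolding left_module_def by (simp add: D.ring_axioms)
qed

lemma left_submodule_cyclic:
  assumes M: "left_module D M" and x: "x \<in> carrier M"
  shows "left_submodule D M (cyclic_submodule D M x)"
proof -
  interpret D: ring D by (rule left_moduleD[OF M])
  have "\<zero>\<^bsub>M\<^esub> \<in> cyclic_submodule D M x"
    unfolding cyclic_submodule_def
    by (rule rev_image_eqI[OF D.zero_closed]) (simp add: left_module_zero_smult[OF M x])
  moreover have "P \<odot>\<^bsub>M\<^esub> x \<oplus>\<^bsub>M\<^esub> Q \<odot>\<^bsub>M\<^esub> x \<in> cyclic_submodule D M x"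
    if "P \<in> carrier D" "Q \<in> carrier D" for P Q
    unfolding cyclic_submodule_def
    by (rule rev_image_eqI[of "P \<oplus>\<^bsub>D\<^esub> Q"]) (simp_all add: that left_moduleD(4)[OF M] x)
  moreover have "P \<odot>\<^bsub>M\<^esub> (Q \<odot>\<^bsub>M\<^esub> x) \<in> cyclic_submodule D M x"
    if "P \<in> carrier D" "Q \<in> carrier D" for P Q
    unfolding cyclic_submodule_def
    by (rule rev_image_eqI[of "P \<otimes>\<^bsub>D\<^esub> Q"]) (simp_all add: that left_moduleD(6)[OF M] x)
  ultimately show ?thesis
    using left_moduleD(3)[OF M _ x] unfolding left_submodule_def
    by (auto simp: cyclic_submodule_def)
qed

lemma left_module_restrict:
  assumes M: "left_module D M" and K: "left_submodule D M K"
  shows "left_module D (M\<lparr>carrier := K\<rparr>)"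
proof -
  interpret K: abelian_subgroup K M by (rule left_submodule_subgroup[OF M K])
  have sub: "x \<in> carrier M" if "x \<in> K" for x using that K.a_subset by blast
  have "abelian_group (M\<lparr>carrier := K\<rparr>)"
  proof (rule abelian_groupI)
    fix x assume "x \<in> carrier (M\<lparr>carrier := K\<rparr>)"
    then show "\<exists>y\<in>carrier (M\<lparr>carrier := K\<rparr>). y \<oplus>\<^bsub>M\<lparr>carrier := K\<rparr>\<^esub> x = \<zero>\<^bsub>M\<lparr>carrier := K\<rparr>\<^esub>"
      by (intro bexI[of _ "\<ominus>\<^bsub>M\<^esub> x"]) (auto simp: sub K.l_neg)
  qed (auto simp: sub K.a_ac left_submoduleD(2,3)[OF K])
  then show ?thesis
    unfolding left_module_def
    by (simp add: left_moduleD[OF M] left_submoduleD(4)[OF K] sub)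
qed

lemma left_module_subring:
  assumes M: "left_module D M" and D0: "ring (D\<lparr>carrier := D0\<rparr>)" "D0 \<subseteq> carrier D"
  shows "left_module (D\<lparr>carrier := D0\<rparr>) M"
proof -
  have sub: "P \<in> carrier D" if "P \<in> D0" for P using that D0(2) by blast
  show ?thesis
    unfolding left_module_def by (simp add: left_moduleD[OF M] D0(1) sub)
qed

section \<open>Degree-zero operators on polynomial rings\<close>

lemma poly_mapping_sum_single: "g = (\<Sum>u\<in>Poly_Mapping.keys g. Poly_Mapping.single u (Poly_Mapping.lookup g u))"
proof (rule poly_mapping_eqI)
  fix w
  show "Poly_Mapping.lookup g w =
      Poly_Mapping.lookup (\<Sum>u\<in>Poly_Mapping.keys g. Poly_Mapping.single u (Poly_Mapping.lookup g u)) w"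
    by (auto simp: lookup_sum lookup_single when_def in_keys_iff)
qed

definition mvar :: "nat \<Rightarrow> 'k::comm_ring_1 mpoly"
  where "mvar i = Poly_Mapping.single (Poly_Mapping.single i 1) 1"

lemma mvar_mpolys: "i < n \<Longrightarrow> mvar i \<in> mpolys n"
  by (auto simp: mvar_def mpolys_def)

lemma mconst_simps: "mconst 0 = 0" "mconst 1 = 1"
  by (simp_all add: mconst_def)

lemma ring_gen_sum:
  assumes "0 \<in> ring_gen G" "\<And>i. i \<in> I \<Longrightarrow> g i \<in> ring_gen G"
  shows "(\<Sum>i\<in>I. g i) \<in> ring_gen G"
  using assms(2) by (induction I rule: infinite_finite_induct) (auto simp: assms(1) intro: ring_gen.add)

lemma ring_gen_power:
  assumes "1 \<in> ring_gen G" "g \<in> ring_gen G"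
  shows "g ^ k \<in> ring_gen G"
  by (induction k) (auto simp: assms intro: ring_gen.mult)

lemma mpolys_gen: "mpolys n = (ring_gen (range mconst \<union> mvar ` {..<n}) :: 'k::comm_ring_1 mpoly set)"
proof (intro equalityI subsetI)
  fix g :: "'k mpoly"
  assume "g \<in> ring_gen (range mconst \<union> mvar ` {..<n})"
  then show "g \<in> mpolys n"
    by induction (auto intro: mpolys_closed mvar_mpolys)
next
  let ?G = "range mconst \<union> mvar ` {..<n} :: 'k mpoly set"
  have const: "mconst c \<in> ring_gen ?G" for c by (auto intro: ring_gen.base)
  have monomial: "Poly_Mapping.single u (1::'k) \<in> ring_gen ?G"
    if "Poly_Mapping.keys u \<subseteq> {..<n}" "(\<Sum>i<n. Poly_Mapping.lookup u i) = k" for u k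
    using that
  proof (induction k arbitrary: u)
    case 0
    then have "Poly_Mapping.lookup u i = 0" for i by (cases "i < n") (auto simp: in_keys_iff)
    then have "u = 0" by (intro poly_mapping_eqI) simp
    then show ?case using const[of 1] by (simp add: mconst_def)
  next
    case (Suc k)
    then obtain i where i: "i < n" "Poly_Mapping.lookup u i > 0"
      by (metis gr0I lessThan_iff nat.distinct(1) sum.neutral)
    define v where "v = u - Poly_Mapping.single i 1"
    have u: "u = Poly_Mapping.single i 1 + v"
      using i(2) by (intro poly_mapping_eqI) (auto simp: v_def lookup_add lookup_minus lookup_single when_def)
    have "Poly_Mapping.keys v \<subseteq> Poly_Mapping.keys u"
      by (auto simp: v_def in_keys_iff lookup_minus)
    then have "Poly_Mapping.keys v \<subseteq> {..<n}" using Suc.prems(1) by blast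
    moreover have "(\<Sum>j<n. Poly_Mapping.lookup v j) = k"
    proof -
      have "(\<Sum>j<n. Poly_Mapping.lookup u j) = (\<Sum>j<n. (1 when i = j) + Poly_Mapping.lookup v j)"
        unfolding u by (simp add: lookup_add lookup_single)
      also have "\<dots> = 1 + (\<Sum>j<n. Poly_Mapping.lookup v j)"
        using i(1) by (simp add: sum.distrib when_def)
      finally show ?thesis using Suc.prems(2) by simp
    qed
    ultimately have "Poly_Mapping.single v (1::'k) \<in> ring_gen ?G" by (rule Suc.IH)
    moreover have "mvar i \<in> ring_gen ?G" using i(1) by (auto intro: ring_gen.base)
    ultimately have "mvar i * Poly_Mapping.single v (1::'k) \<in> ring_gen ?G" by (intro ring_gen.mult)
    then show ?case by (simp add: mvar_def mult_single u)
  qed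
  fix g :: "'k mpoly"
  assume g: "g \<in> mpolys n"
  have "Poly_Mapping.single u c \<in> ring_gen ?G" if "u \<in> Poly_Mapping.keys g" for u c
  proof -
    have "Poly_Mapping.single u c = mconst c * Poly_Mapping.single u 1"
      by (simp add: mconst_def mult_single)
    then show ?thesis using g that const monomial by (auto simp: mpolys_def intro: ring_gen.mult)
  qed
  then show "g \<in> ring_gen ?G"
    using const[of 0] by (subst poly_mapping_sum_single) (intro ring_gen_sum, auto simp: mconst_simps)
qed

lemma monom_eq_power: "Polynomial.monom r i = [:r:] * Polynomial.monom 1 1 ^ i"
  by (simp add: monom_power smult_monom)

lemma poly_ring_gen:
  fixes q :: "'r::comm_ring_1 poly"
  assumes "0 \<in> R" "1 \<in> R" "R = ring_gen G" "\<And>i. Polynomial.coeff q i \<in> R"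
  shows "q \<in> ring_gen ((\<lambda>r. [:r:]) ` G \<union> {Polynomial.monom 1 1})"
proof -
  let ?G = "(\<lambda>r. [:r:]) ` G \<union> {Polynomial.monom 1 1}"
  have const: "[:r:] \<in> ring_gen ?G" if "r \<in> R" for r
    using that unfolding assms(3)
  proof induction
    case (add a b)
    then show ?case using ring_gen.add[of "[:a:]" ?G "[:b:]"] by simp
  next
    case (mult a b)
    then show ?case using ring_gen.mult[of "[:a:]" ?G "[:b:]"] by (simp add: mult.commute)
  qed (auto intro: ring_gen.base)
  have one: "1 \<in> ring_gen ?G" and zero: "0 \<in> ring_gen ?G"
    using const[OF assms(1)] const[OF assms(2)] by (simp_all add: one_pCons)
  have "(\<Sum>i\<le>Polynomial.degree q. [:Polynomial.coeff q i:] * Polynomial.monom 1 1 ^ i) \<in> ring_gen ?G"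
    by (intro ring_gen_sum ring_gen.mult const ring_gen_power zero one assms) (auto intro: ring_gen.base)
  then show ?thesis
    by (simp only: monom_eq_power[symmetric] poly_as_sum_of_monoms)
qed

definition degreewise :: "(nat \<Rightarrow> 'r \<Rightarrow> 'r) \<Rightarrow> 'r::comm_ring_1 poly \<Rightarrow> 'r poly"
  where "degreewise d q = (\<Sum>i\<le>Polynomial.degree q. Polynomial.monom (d i (Polynomial.coeff q i)) i)"

lemma coeff_degreewise:
  assumes "\<And>i. d i 0 = 0"
  shows "Polynomial.coeff (degreewise d q) a = d a (Polynomial.coeff q a)"
  using assms by (auto simp: degreewise_def coeff_sum coeff_eq_0)

lemma coeff_const_mult: "Polynomial.coeff ([:c:] * q) i = c * Polynomial.coeff q i"
  for c :: "'r::comm_ring_1"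
  by simp

locale prime_power_coefficients =
  fixes p m n :: nat and coeff_type :: "'k::comm_ring_1 itself"
  assumes prime: "prime p" and char: "of_nat (p ^ Suc m) = (0::'k)"
begin

lemma char_mpoly: "of_nat (p ^ Suc m) = (0 :: 'k mpoly)"
  using char single_of_nat[of "p ^ Suc m", where ?'a = "nat \<Rightarrow>\<^sub>0 nat" and ?'b = 'k]
  by (simp del: of_nat_power)

sublocale At: prime_power_algebra p m "At :: ('k, 'k poly) module" "\<lambda>c. [:c:]" "{Polynomial.monom 1 1}"
proof (rule prime_power_algebra.intro)
  show "prime p" by (rule prime)
  show "of_nat (p ^ Suc m) = (0 :: 'k poly)" using char by (simp add: of_nat_poly del: of_nat_power)
  show "algebra coeff_ring (At :: ('k, 'k poly) module)" by (rule algebra_At)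
  have "UNIV = ring_gen (UNIV :: 'k set)" by (auto intro: ring_gen.base)
  then have "q \<in> ring_gen (range (\<lambda>c. [:c:]) \<union> {Polynomial.monom 1 1})" for q :: "'k poly"
    by (intro poly_ring_gen[of UNIV]) auto
  then show "carrier (At :: ('k, 'k poly) module) = ring_gen (range (\<lambda>c. [:c:]) \<union> {Polynomial.monom 1 1})"
    by (auto simp: At_def)
qed (auto simp: At_def)

sublocale Rt: prime_power_algebra p m "Rt n :: ('k, 'k mpoly poly) module" "\<lambda>c. [:mconst c:]"
  "(\<lambda>i. [:mvar i:]) ` {..<n} \<union> {Polynomial.monom 1 1}"
proof (rule prime_power_algebra.intro)
  let ?G = "range (\<lambda>c. [:mconst c :: 'k mpoly:]) \<union> ((\<lambda>i. [:mvar i:]) ` {..<n} \<union> {Polynomial.monom 1 1})"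
  show "prime p" by (rule prime)
  show "of_nat (p ^ Suc m) = (0 :: 'k mpoly poly)" using char_mpoly by (simp add: of_nat_poly del: of_nat_power)
  show "algebra coeff_ring (Rt n :: ('k, 'k mpoly poly) module)" by (rule algebra_Rt)
  have G: "?G = (\<lambda>r. [:r:]) ` (range mconst \<union> mvar ` {..<n}) \<union> {Polynomial.monom 1 1}"
    by (auto simp: image_image)
  show "carrier (Rt n :: ('k, 'k mpoly poly) module) = ring_gen ?G"
  proof (intro equalityI subsetI)
    fix q :: "'k mpoly poly" assume "q \<in> carrier (Rt n)"
    then show "q \<in> ring_gen ?G"
      unfolding G by (intro poly_ring_gen[OF mpolys_closed(1,2) mpolys_gen]) (simp add: Rt_def)
  next
    fix q assume "q \<in> ring_gen ?G"
    then show "q \<in> carrier (Rt n :: ('k, 'k mpoly poly) module)"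
    proof induction
      case (base g)
      then show ?case
        by (auto simp: Rt_def coeff_pCons mpolys_closed mvar_mpolys split: nat.split)
    qed (auto simp: Rt_def coeff_mult intro!: mpolys_closed mpolys_sum)
  qed
qed (auto simp: Rt_def)

abbreviation (input) Rc :: "'k mpoly poly set" where "Rc \<equiv> carrier (Rt n)"

lemma Rc_iff: "q \<in> Rc \<longleftrightarrow> (\<forall>i. Polynomial.coeff q i \<in> mpolys n)"
  by (simp add: Rt_def)

lemma Rc_const: "r \<in> mpolys n \<Longrightarrow> [:r:] \<in> Rc"
  and Rc_monom: "r \<in> mpolys n \<Longrightarrow> Polynomial.monom r i \<in> Rc"
  by (auto simp: Rc_iff coeff_pCons mpolys_closed split: nat.split)

lemma carrier_D0:
  "carrier (D0_Rt n) = {\<phi> \<in> diff_ops coeff_ring (Rt n). \<forall>k. \<forall>r\<in>mpolys n. \<exists>r'\<in>mpolys n.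
      \<phi> (Polynomial.monom r k) = (Polynomial.monom r' k :: 'k mpoly poly)}"
  by (fastforce simp: D0_Rt_def diff_op_ring_deg0_def Rt_component_def)

lemma ring_D0: "ring (D0_Rt n :: ('k mpoly poly \<Rightarrow> 'k mpoly poly) ring)"
proof -
  let ?D = "diff_op_ring coeff_ring (Rt n) :: ('k mpoly poly \<Rightarrow> 'k mpoly poly) ring"
  let ?Z = "carrier (D0_Rt n) :: ('k mpoly poly \<Rightarrow> 'k mpoly poly) set"
  interpret D: ring ?D by (rule Rt.ring_diff_op_ring)
  have "ring (?D\<lparr>carrier := ?Z\<rparr>)"
  proof (rule D.subring_is_ring, rule D.subringI)
    show "?Z \<subseteq> carrier ?D" by (auto simp: carrier_D0 diff_op_ring_def)
    show "\<one>\<^bsub>?D\<^esub> \<in> ?Z"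
      by (auto simp: carrier_D0 diff_op_ring_def Rt.const_diff_ops Rc_monom)
    fix \<phi> assume \<phi>: "\<phi> \<in> ?Z"
    then have \<phi>D: "\<phi> \<in> diff_ops coeff_ring (Rt n)" by (simp add: carrier_D0)
    let ?\<psi> = "\<lambda>x\<in>Rc. - \<phi> x"
    have \<psi>: "?\<psi> \<in> diff_ops coeff_ring (Rt n)"
      using Rt.diff_ops_compose[OF \<phi>D Rt.const_diff_ops(3)] by (simp add: Rt.compose_uminus \<phi>D)
    have "?\<psi> \<oplus>\<^bsub>?D\<^esub> \<phi> = \<zero>\<^bsub>?D\<^esub>"
      by (auto simp: diff_op_ring_def Rt.S_ops cong: restrict_cong)
    then have "\<ominus>\<^bsub>?D\<^esub> \<phi> = ?\<psi>"
      using \<phi>D \<psi> by (intro D.minus_equality) (auto simp: diff_op_ring_def)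
    moreover have "?\<psi> \<in> ?Z"
      unfolding carrier_D0
    proof (intro CollectI conjI allI ballI \<psi>)
      fix k and r :: "'k mpoly" assume r: "r \<in> mpolys n"
      obtain r' where "r' \<in> mpolys n" "\<phi> (Polynomial.monom r k) = Polynomial.monom r' k"
        using \<phi> r by (auto simp: carrier_D0)
      then show "\<exists>r'\<in>mpolys n. ?\<psi> (Polynomial.monom r k) = Polynomial.monom r' k"
        using r by (intro bexI[of _ "- r'"]) (simp_all add: Rc_monom minus_monom mpolys_closed)
    qed
    ultimately show "\<ominus>\<^bsub>?D\<^esub> \<phi> \<in> ?Z" by simp
    fix \<psi> assume \<psi>: "\<psi> \<in> ?Z"
    show "\<phi> \<otimes>\<^bsub>?D\<^esub> \<psi> \<in> ?Z"
      unfolding carrier_D0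
    proof (intro CollectI conjI allI ballI)
      fix k and r :: "'k mpoly" assume r: "r \<in> mpolys n"
      obtain r' where r': "r' \<in> mpolys n" "\<psi> (Polynomial.monom r k) = Polynomial.monom r' k"
        using \<psi> r by (auto simp: carrier_D0)
      obtain r'' where "r'' \<in> mpolys n" "\<phi> (Polynomial.monom r' k) = Polynomial.monom r'' k"
        using \<phi> r'(1) by (auto simp: carrier_D0)
      then show "\<exists>r'\<in>mpolys n. (\<phi> \<otimes>\<^bsub>?D\<^esub> \<psi>) (Polynomial.monom r k) = Polynomial.monom r' k"
        using r r' by (intro bexI[of _ r'']) (simp_all add: diff_op_ring_def compose_def Rc_monom)
    qed (use Rt.diff_ops_compose[OF \<phi>D] \<psi> in \<open>simp add: carrier_D0 diff_op_ring_def\<close>)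
    show "\<phi> \<oplus>\<^bsub>?D\<^esub> \<psi> \<in> ?Z"
      unfolding carrier_D0
    proof (intro CollectI conjI allI ballI)
      fix k and r :: "'k mpoly" assume r: "r \<in> mpolys n"
      obtain s where s: "s \<in> mpolys n" "\<psi> (Polynomial.monom r k) = Polynomial.monom s k"
        using \<psi> r by (auto simp: carrier_D0)
      obtain t where t: "t \<in> mpolys n" "\<phi> (Polynomial.monom r k) = Polynomial.monom t k"
        using \<phi> r by (auto simp: carrier_D0)
      show "\<exists>r'\<in>mpolys n. (\<phi> \<oplus>\<^bsub>?D\<^esub> \<psi>) (Polynomial.monom r k) = Polynomial.monom r' k"
        using r s t by (intro bexI[of _ "t + s"])
          (simp_all add: diff_op_ring_def Rt.S_ops Rc_monom add_monom mpolys_closed)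
    qed (use Rt.diff_ops_add[OF \<phi>D] \<psi> in \<open>simp add: carrier_D0 diff_op_ring_def Rt.S_ops\<close>)
  qed
  then show ?thesis by (simp add: D0_Rt_def diff_op_ring_deg0_def)
qed

text \<open>
  Periodicity in the degree \<open>i\<close> expresses that the operator commutes with \<open>t\<close> to the power
  \<open>p\<^sup>e\<close>.
\<close>
lemma degreewise_D0:
  fixes d :: "nat \<Rightarrow> 'k mpoly \<Rightarrow> 'k mpoly"
  assumes closed: "\<And>i r. r \<in> mpolys n \<Longrightarrow> d i r \<in> mpolys n"
    and add: "\<And>i r s. r \<in> mpolys n \<Longrightarrow> s \<in> mpolys n \<Longrightarrow> d i (r + s) = d i r + d i s"
    and const: "\<And>i c r. r \<in> mpolys n \<Longrightarrow> d i (mconst c * r) = mconst c * d i r"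
    and var: "\<And>i j r. r \<in> mpolys n \<Longrightarrow> j < n \<Longrightarrow> d i (mvar j ^ (p ^ e) * r) = mvar j ^ (p ^ e) * d i r"
    and periodic: "\<And>i r. r \<in> mpolys n \<Longrightarrow> d (i + p ^ e) r = d i r"
  shows "(\<lambda>q\<in>Rc. degreewise d q) \<in> carrier (D0_Rt n)"
proof -
  let ?\<phi> = "\<lambda>q\<in>Rc. degreewise d q"
  have "d i 0 = 0" for i using add[of 0 0 i] by (simp add: mpolys_closed)
  note coeff = coeff_degreewise[of d, OF this] \<open>\<And>i. d i 0 = 0\<close>
  have coeff_mem: "Polynomial.coeff q i \<in> mpolys n" if "q \<in> Rc" for q i
    using that by (simp add: Rc_iff)
  have "Rt.linear ?\<phi>"
    unfolding Rt.linear_def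
    using add closed const
    by (auto simp: coeff coeff_mem Rt.C_closed Rc_iff mpolys_closed intro!: poly_eqI)
  moreover have "commutes_on Rc ?\<phi> (y ^ (p ^ e))"
    if "y \<in> (\<lambda>i. [:mvar i:]) ` {..<n} \<union> {Polynomial.monom 1 1}" for y
    using that
  proof
    assume "y \<in> (\<lambda>i. [:mvar i:]) ` {..<n}"
    then obtain j where j: "j < n" "y = [:mvar j:]" by blast
    have y: "y ^ (p ^ e) = [:mvar j ^ (p ^ e):]" unfolding j(2) by (rule poly_const_pow)
    have "y ^ (p ^ e) \<in> Rc" using j by (intro Rt.C_power) (simp add: Rc_const mvar_mpolys)
    then show ?thesis
      using j(1) unfolding y commutes_on_def
      by (auto simp: Rt.C_closed coeff coeff_mem var coeff_const_mult simp del: mult_pCons_left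
          intro!: poly_eqI)
  next
    assume "y \<in> {Polynomial.monom 1 1}"
    then have y: "y ^ (p ^ e) = Polynomial.monom 1 (p ^ e)" by (simp add: monom_power)
    have "Polynomial.monom 1 (p ^ e) \<in> Rc" by (intro Rc_monom mpolys_closed)
    moreover have "d i (Polynomial.coeff q (i - p ^ e)) = d (i - p ^ e) (Polynomial.coeff q (i - p ^ e))"
      if "q \<in> Rc" "p ^ e \<le> i" for q i
      using periodic[of "Polynomial.coeff q (i - p ^ e)" "i - p ^ e"] that by (simp add: coeff_mem)
    ultimately show ?thesis
      unfolding y commutes_on_def
      by (auto simp: Rt.C_closed coeff coeff_monom_mult intro!: poly_eqI)
  qed
  ultimately have "?\<phi> \<in> diff_ops coeff_ring (Rt n)"
    by (intro Rt.diff_opsI) auto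
  moreover have "degreewise d (Polynomial.monom r k) = Polynomial.monom (d k r) k" for r k
    by (rule poly_eqI) (simp add: coeff)
  ultimately show ?thesis using closed by (auto simp: carrier_D0 Rc_monom)
qed

lemma mult_op_D0: "(r :: 'k mpoly) \<in> mpolys n \<Longrightarrow> mult_op (Rt n) [:r:] \<in> carrier (D0_Rt n)"
proof -
  assume r: "r \<in> mpolys n"
  have "mult_op (Rt n) [:r:] (Polynomial.monom s k) = Polynomial.monom (r * s) k"
    if "s \<in> mpolys n" for s k
    using that by (simp add: mult_op_def Rt.S_ops Rc_monom smult_monom)
  then show ?thesis
    using r Rt.mult_op_diff_ops[OF Rc_const[OF r]] mpolys_closed(6) unfolding carrier_D0 by blast
qed

lemma C_ring_eigenvalues:
  assumes "P \<in> carrier (C_ring :: ('k poly \<Rightarrow> 'k poly) ring)"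
  obtains c e where "\<And>i. P (Polynomial.monom 1 i) = Polynomial.monom (c i) i"
    "\<And>i. c (i + p ^ e) = c i"
    "R_extension n P = (\<lambda>q\<in>Rc. degreewise (\<lambda>i r. mconst (c i) * r) q)"
proof -
  have P: "P \<in> diff_ops coeff_ring (At :: ('k, 'k poly) module)"
    and deg: "\<And>k. P ` At_component k \<subseteq> At_component k"
    using assms by (auto simp: C_ring_def diff_op_ring_deg0_def)
  have "\<forall>i. \<exists>c. P (Polynomial.monom 1 i) = Polynomial.monom c i"
    using deg by (fastforce simp: At_component_def)
  then obtain c where c: "\<And>i. P (Polynomial.monom 1 i) = Polynomial.monom (c i) i" by metis
  obtain e where e: "\<And>s. s \<in> carrier At \<Longrightarrow> commutes_on (carrier At) P (s ^ (p ^ e))"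
    using P by (auto simp: At.diff_ops_iff)
  have "c (i + p ^ e) = c i" for i
  proof -
    have "P (Polynomial.monom 1 1 ^ (p ^ e) * Polynomial.monom 1 i)
        = Polynomial.monom 1 1 ^ (p ^ e) * P (Polynomial.monom 1 i)"
      using e[of "Polynomial.monom 1 1"] by (simp add: commutes_on_def At_def)
    then show ?thesis
      by (simp add: monom_power mult_monom c add.commute)
  qed
  moreover have "R_extension n P = (\<lambda>q\<in>Rc. degreewise (\<lambda>i r. mconst (c i) * r) q)"
    unfolding R_extension_def degreewise_def c
    by (simp add: map_poly_monom mconst_simps smult_monom mult.commute cong: restrict_cong)
  ultimately show ?thesis using c that by blast
qed

lemma R_extension_D0:
  assumes "P \<in> carrier C_ring"
  shows "R_extension n P \<in> carrier (D0_Rt n :: ('k mpoly poly \<Rightarrow> 'k mpoly poly) ring)"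
proof -
  obtain c e where ce: "\<And>i. c (i + p ^ e) = (c i :: 'k)"
    "R_extension n P = (\<lambda>q\<in>Rc. degreewise (\<lambda>i r. mconst (c i) * r) q)"
    using C_ring_eigenvalues[OF assms] by metis
  show ?thesis
    unfolding ce(2)
    by (rule degreewise_D0[where e = e]) (auto simp: mpolys_closed algebra_simps ce(1))
qed

text \<open>
  An element of \<open>C\<^sub>m\<close> is a scalar of \<open>A\<close> on each \<open>R t\<^sup>i\<close>, and a degree-zero operator preserves
  \<open>R t\<^sup>i\<close> and is \<open>A\<close>-linear there.
\<close>
lemma R_extension_central:
  assumes "P \<in> carrier C_ring" "\<phi> \<in> carrier (D0_Rt n :: ('k mpoly poly \<Rightarrow> 'k mpoly poly) ring)"
  shows "compose Rc (R_extension n P) \<phi> = compose Rc \<phi> (R_extension n P)"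
proof -
  let ?E = "R_extension n P"
  obtain c where c: "?E = (\<lambda>q\<in>Rc. degreewise (\<lambda>i r. mconst (c i) * r) q)"
    using C_ring_eigenvalues[OF assms(1)] by metis
  have E: "Rt.linear ?E" using R_extension_D0[OF assms(1)] by (auto simp: carrier_D0 Rt.diff_ops_linear)
  have \<phi>: "Rt.linear \<phi>" using assms(2) by (auto simp: carrier_D0 Rt.diff_ops_linear)
  have E_monom: "?E (Polynomial.monom r i) = [:mconst (c i):] * Polynomial.monom r i"
    if "r \<in> mpolys n" for r i
    using that by (intro poly_eqI) (simp add: c Rc_monom coeff_degreewise)
  have monom: "?E (\<phi> (Polynomial.monom r i)) = \<phi> (?E (Polynomial.monom r i))" if r: "r \<in> mpolys n" for r i
  proof -
    obtain r' where "r' \<in> mpolys n" "\<phi> (Polynomial.monom r i) = Polynomial.monom r' i"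
      using assms(2) r by (auto simp: carrier_D0)
    then show ?thesis
      using Rt.linear_const[OF \<phi> Rc_monom[OF r], of "c i" i] by (simp only: E_monom r)
  qed
  have "?E (\<phi> q) = \<phi> (?E q)" if q: "q \<in> Rc" for q
  proof -
    let ?q = "\<lambda>i. Polynomial.monom (Polynomial.coeff q i) i"
    have mem: "Polynomial.coeff q i \<in> mpolys n" for i using q by (simp add: Rc_iff)
    then have m: "?q i \<in> Rc" for i by (rule Rc_monom)
    have q_sum: "q = (\<Sum>i\<le>Polynomial.degree q. ?q i)" by (simp add: poly_as_sum_of_monoms)
    have "?E (\<phi> q) = (\<Sum>i\<le>Polynomial.degree q. ?E (\<phi> (?q i)))"
      by (subst q_sum) (simp add: Rt.linear_sum(1)[OF \<phi>] Rt.linear_sum(1)[OF E] m Rt.linear_closed[OF \<phi>])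
    also have "\<dots> = (\<Sum>i\<le>Polynomial.degree q. \<phi> (?E (?q i)))"
      by (simp add: monom mem)
    also have "\<dots> = \<phi> (?E q)"
    proof -
      have "\<phi> (?E q) = \<phi> (?E (\<Sum>i\<le>Polynomial.degree q. ?q i))" by (simp only: q_sum[symmetric])
      then show ?thesis
        by (simp add: Rt.linear_sum(1)[OF \<phi>] Rt.linear_sum(1)[OF E] m Rt.linear_closed[OF E])
    qed
    finally show ?thesis .
  qed
  then show ?thesis by (auto simp: compose_def cong: restrict_cong)
qed

end

section \<open>The idempotents of \<open>C\<^sub>m\<close> attached to residue classes\<close>

lemma padic_ints_mod:
  assumes "\<alpha> \<in> padic_ints p" "k \<le> l"
  shows "\<alpha> l mod int p ^ k = \<alpha> k"
  using assms(2)
proof (induction l rule: dec_induct)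
  case base
  then show ?case using assms(1) by (simp add: padic_ints_def)
next
  case (step l)
  have "\<alpha> (Suc l) mod int p ^ k = \<alpha> (Suc l) mod int p ^ l mod int p ^ k"
    using step.hyps(1) by (simp add: mod_mod_cancel le_imp_power_dvd)
  then show ?case using assms(1) step.IH by (simp add: padic_ints_def)
qed

lemma padic_of_int_padic_ints: "p > 0 \<Longrightarrow> padic_of_int p a \<in> padic_ints p"
  by (auto simp: padic_ints_def padic_of_int_def mod_mod_cancel)

lemma negative_integers_dense:
  assumes "p > 0" "\<beta> \<in> padic_ints p"
  obtains a :: nat where "\<And>l. l \<le> k \<Longrightarrow> padic_of_int p (- 1 - int a) l = \<beta> l"
proof -
  \<comment> \<open>Chosen so that \<open>- 1 - a = \<beta> k - p\<^sup>k\<close>.\<close>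
  define a where "a = nat (int p ^ k - 1 - \<beta> k)"
  have \<beta>: "0 \<le> \<beta> k" "\<beta> k < int p ^ k" using assms(2) by (auto simp: padic_ints_def)
  then have a: "- 1 - int a = \<beta> k - int p ^ k" by (simp add: a_def)
  have "padic_of_int p (- 1 - int a) l = \<beta> l" if "l \<le> k" for l
  proof -
    have "int p ^ l dvd int p ^ k" using that by (rule le_imp_power_dvd)
    then have "(\<beta> k - int p ^ k) mod int p ^ l = \<beta> k mod int p ^ l"
      by (auto simp: mod_eq_dvd_iff)
    then show ?thesis
      by (simp add: padic_of_int_def a padic_ints_mod[OF assms(2) that])
  qed
  then show ?thesis using that by blast
qed

text \<open>
  On \<open>A[t]\<close>, the element of \<open>C\<^sub>m\<close> whose eigenvalue function is the indicator of the ball of \<open>p\<close>-adic integers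
  congruent to \<open>s\<close> modulo \<open>p\<^sup>k\<close>.
\<close>
definition residue_projector :: "nat \<Rightarrow> nat \<Rightarrow> int \<Rightarrow> 'r poly \<Rightarrow> 'r::comm_ring_1 poly"
  where "residue_projector p k s = degreewise (\<lambda>i r. if (- 1 - int i) mod int p ^ k = s then r else 0)"

lemma coeff_residue_projector:
  "Polynomial.coeff (residue_projector p k s q) i =
    (if (- 1 - int i) mod int p ^ k = s then Polynomial.coeff q i else 0)"
  by (simp add: residue_projector_def coeff_degreewise)

lemma residue_shift: "(- 1 - int (i + p ^ k)) mod int p ^ k = (- 1 - int i) mod int p ^ k"
  by (simp add: mod_eq_dvd_iff)

lemma residue_projector_monom:
  "residue_projector p k s (Polynomial.monom r i) =
    Polynomial.monom (if (- 1 - int i) mod int p ^ k = s then r else 0) i"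
  by (rule poly_eqI) (simp add: coeff_residue_projector)

text \<open>
  The integers \<open>- 1 - a\<close> with \<open>a \<ge> 0\<close> are dense in \<open>\<int>\<^sub>p\<close>, so a locally constant function is
  determined by its values there.
\<close>
lemma eigenvalue_function_residue_projector:
  fixes \<alpha> :: "nat \<Rightarrow> int"
  assumes "p > 0" "\<alpha> \<in> padic_ints p"
  shows "eigenvalue_function p (residue_projector p k (\<alpha> k) :: 'k::comm_ring_1 poly \<Rightarrow> 'k poly) \<alpha> = 1"
proof -
  let ?P = "residue_projector p k (\<alpha> k) :: 'k poly \<Rightarrow> 'k poly"
  let ?good = "\<lambda>\<phi> :: (nat \<Rightarrow> int) \<Rightarrow> 'k. \<phi> \<in> extensional (padic_ints p) \<and> padic_locally_constant p \<phi> \<and>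
      (\<forall>a::nat. ?P (Polynomial.monom 1 a) =
        Polynomial.smult (\<phi> (padic_of_int p (- 1 - int a))) (Polynomial.monom 1 a))"
  define \<phi> :: "(nat \<Rightarrow> int) \<Rightarrow> 'k" where "\<phi> = (\<lambda>\<beta>\<in>padic_ints p. if \<beta> k = \<alpha> k then 1 else 0)"
  have mem: "padic_of_int p a \<in> padic_ints p" for a by (rule padic_of_int_padic_ints[OF assms(1)])
  have "\<forall>\<beta>\<in>padic_ints p. \<exists>l. \<forall>\<gamma>\<in>padic_ints p. \<gamma> l = \<beta> l \<longrightarrow> \<phi> \<gamma> = \<phi> \<beta>"
    by (intro ballI exI[of _ k]) (auto simp: \<phi>_def)
  then have good: "?good \<phi>"
    unfolding padic_locally_constant_def
    by (auto simp: \<phi>_def mem residue_projector_monom smult_monom) (simp_all add: padic_of_int_def)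
  moreover have "\<psi> = \<phi>" if \<psi>: "?good \<psi>" for \<psi>
  proof (rule extensionalityI[of _ "padic_ints p"])
    fix \<beta> assume \<beta>: "\<beta> \<in> padic_ints p"
    obtain k1 where k1: "\<And>\<gamma>. \<gamma> \<in> padic_ints p \<Longrightarrow> \<gamma> k1 = \<beta> k1 \<Longrightarrow> \<phi> \<gamma> = \<phi> \<beta>"
      using good \<beta> unfolding padic_locally_constant_def by blast
    obtain k2 where k2: "\<And>\<gamma>. \<gamma> \<in> padic_ints p \<Longrightarrow> \<gamma> k2 = \<beta> k2 \<Longrightarrow> \<psi> \<gamma> = \<psi> \<beta>"
      using \<psi> \<beta> unfolding padic_locally_constant_def by blast
    obtain a :: nat where a: "\<And>l. l \<le> max k1 k2 \<Longrightarrow> padic_of_int p (- 1 - int a) l = \<beta> l"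
      using negative_integers_dense[OF assms(1) \<beta>] by metis
    let ?\<gamma> = "padic_of_int p (- 1 - int a)"
    have "Polynomial.smult (\<psi> ?\<gamma>) (Polynomial.monom 1 a) = Polynomial.smult (\<phi> ?\<gamma>) (Polynomial.monom 1 a)"
      using good \<psi> by metis
    then have "\<psi> ?\<gamma> = \<phi> ?\<gamma>" by (simp add: smult_monom)
    moreover have "\<psi> ?\<gamma> = \<psi> \<beta>" by (rule k2[OF mem a]) simp
    moreover have "\<phi> ?\<gamma> = \<phi> \<beta>" by (rule k1[OF mem a]) simp
    ultimately show "\<psi> \<beta> = \<phi> \<beta>" by simp
  qed (use good \<psi> in auto)
  ultimately have "eigenvalue_function p ?P = \<phi>"
    unfolding eigenvalue_function_def by (rule the_equality)
  then show ?thesis using assms(2) by (simp add: \<phi>_def)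
qed

section \<open>Residue classes without Bernstein-Sato roots\<close>

text \<open>The endomorphisms of \<open>A[x\<^sub>1, \<dots>, x\<^sub>n]\<close> that are linear over the subring \<open>A[x\<^sup>q]\<close>.\<close>
definition frobenius_linear :: "nat \<Rightarrow> nat \<Rightarrow> ('k::comm_ring_1 mpoly \<Rightarrow> 'k mpoly) \<Rightarrow> bool"
  where "frobenius_linear q n D \<longleftrightarrow>
    (\<forall>r\<in>mpolys n. D r \<in> mpolys n) \<and>
    (\<forall>r\<in>mpolys n. \<forall>s\<in>mpolys n. D (r + s) = D r + D s) \<and>
    (\<forall>c. \<forall>r\<in>mpolys n. D (mconst c * r) = mconst c * D r) \<and>
    (\<forall>j<n. \<forall>r\<in>mpolys n. D (mvar j ^ q * r) = mvar j ^ q * D r)"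

lemma mpolys_power: "r \<in> mpolys n \<Longrightarrow> r ^ k \<in> mpolys n"
  by (induction k) (auto intro: mpolys_closed)

context prime_power_coefficients
begin

lemma p_not_dvd_one: "\<not> of_nat p dvd (1 :: 'k)"
proof
  assume "of_nat p dvd (1 :: 'k)"
  then obtain x :: 'k where "1 = of_nat p * x" by (rule dvdE)
  then have "(1 :: 'k) = (of_nat p * x) ^ Suc m" by (metis power_one)
  also have "\<dots> = of_nat (p ^ Suc m) * x ^ Suc m" by (simp only: power_mult_distrib of_nat_power)
  finally show False using char by simp
qed

lemma residue_projector_C_ring:
  "residue_projector p k s \<in> carrier (C_ring :: ('k poly \<Rightarrow> 'k poly) ring)"
proof -
  let ?P = "residue_projector p k s :: 'k poly \<Rightarrow> 'k poly"
  have UNIV: "carrier (At :: ('k, 'k poly) module) = UNIV" by (simp add: At_def)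
  have "At.linear ?P"
    unfolding At.linear_def UNIV by (auto intro!: poly_eqI simp: coeff_residue_projector)
  moreover have "commutes_on UNIV ?P (Polynomial.monom 1 1 ^ (p ^ k))"
    unfolding commutes_on_def
  proof (intro ballI poly_eqI)
    fix q :: "'k poly" and i
    have "(- 1 - int i) mod int p ^ k = (- 1 - int (i - p ^ k)) mod int p ^ k" if "p ^ k \<le> i"
      using residue_shift[of "i - p ^ k" p k] that by simp
    then show "Polynomial.coeff (?P (Polynomial.monom 1 1 ^ (p ^ k) * q)) i =
      Polynomial.coeff (Polynomial.monom 1 1 ^ (p ^ k) * ?P q) i"
      by (simp add: coeff_residue_projector monom_power coeff_monom_mult)
  qed
  ultimately have "?P \<in> diff_ops coeff_ring At"
    by (intro At.diff_opsI[where e = k]) (auto simp: UNIV)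
  moreover have "?P ` At_component i \<subseteq> At_component i" for i
    by (auto simp: At_component_def residue_projector_monom)
  ultimately show ?thesis by (auto simp: C_ring_def diff_op_ring_deg0_def)
qed

lemma R_extension_residue_projector:
  "R_extension n (residue_projector p k s) = (\<lambda>q\<in>Rc. residue_projector p k s q)"
  unfolding R_extension_def residue_projector_monom
  unfolding residue_projector_def degreewise_def
  by (auto simp: map_poly_monom mconst_simps smult_monom intro!: restrict_ext sum.cong)

lemma C_ring_one: "\<one>\<^bsub>C_ring\<^esub> \<in> carrier (C_ring :: ('k poly \<Rightarrow> 'k poly) ring)"
  using At.const_diff_ops(1)
  by (auto simp: C_ring_def diff_op_ring_deg0_def diff_op_ring_def At_component_def) (simp add: At_def)

lemma frobenius_linear_commutes:
  fixes D :: "'k mpoly \<Rightarrow> 'k mpoly"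
  assumes D: "frobenius_linear (p ^ e) n D" and "r \<in> mpolys n" "x \<in> mpolys n"
  shows "D (r ^ (p ^ (e + m)) * x) = r ^ (p ^ (e + m)) * D x"
proof -
  have "commutes_on (mpolys n) D (g ^ (p ^ e))"
    if "g \<in> range mconst \<union> mvar ` {..<n}" for g
    using that
  proof
    assume "g \<in> range mconst"
    then show ?thesis
      using D by (intro commutes_on_power) (auto simp: commutes_on_def frobenius_linear_def mpolys_closed)
  next
    assume "g \<in> mvar ` {..<n}"
    then show ?thesis using D by (auto simp: commutes_on_def frobenius_linear_def)
  qed
  then have "commutes_on (mpolys n) D (r ^ (p ^ (e + m)))"
    using D assms(2)
    by (intro commutes_with_prime_powers[OF prime char_mpoly mpolys_gen])
       (auto simp: frobenius_linear_def mpolys_closed)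
  then show ?thesis using assms(3) by (rule commutes_onD)
qed

end

locale bernstein_sato_setting = prime_power_coefficients p m n coeff_type
  for p m n :: nat and coeff_type :: "'k::comm_ring_1 itself" +
  fixes f :: "'k mpoly"
  assumes f: "f \<in> mpolys n"
begin

lemma f_minus_t: "[:f, -1:] \<in> Rc"
  using f by (auto simp: Rc_iff coeff_pCons mpolys_closed split: nat.split)

sublocale loc: prime_power_localization p m "Rt n :: ('k, 'k mpoly poly) module" "\<lambda>c. [:mconst c:]"
  "(\<lambda>i. [:mvar i:]) ` {..<n} \<union> {Polynomial.monom 1 1}" "denominators f"
proof
  show "denominators f \<subseteq> carrier (Rt n)"
    using Rc_const[OF f] f_minus_t
    by (auto simp: denominators_def intro!: Rt.C_closed(4) Rt.C_power simp del: mult_pCons_left)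
  have "1 = [:f:] ^ 0 * [:f, -1:] ^ 0" by simp
  then show "1 \<in> denominators f" unfolding denominators_def by blast
  fix s u assume "s \<in> denominators f" "u \<in> denominators f"
  then obtain i j k l where "s = [:f:] ^ i * [:f, -1:] ^ j" "u = [:f:] ^ k * [:f, -1:] ^ l"
    by (auto simp: denominators_def)
  then have "s * u = [:f:] ^ (i + k) * [:f, -1:] ^ (j + l)" by (simp only: power_add mult_ac)
  then show "s * u \<in> denominators f" unfolding denominators_def by blast
qed

lemma denominators_mem: "[:f:] ^ i \<in> denominators f" "[:f, -1:] \<in> denominators f"
proof -
  have "[:f:] ^ i = [:f:] ^ i * [:f, -1:] ^ 0" "[:f, -1:] = [:f:] ^ 0 * [:f, -1:] ^ 1" by simp_all
  then show "[:f:] ^ i \<in> denominators f" "[:f, -1:] \<in> denominators f"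
    unfolding denominators_def by blast+
qed

abbreviation (input) DR :: "('k mpoly poly \<Rightarrow> 'k mpoly poly) ring"
  where "DR \<equiv> diff_op_ring coeff_ring (Rt n)"

lemma local_Rt_eq: "local_Rt n f = with_smult loc.L_action loc.L"
  by (simp add: local_Rt_def loc.D_localization_eq)

lemma left_module_local_Rt: "left_module DR (local_Rt n f)"
  unfolding local_Rt_eq by (rule loc.left_module_L)

lemma local_frac_carrier: "a \<in> Rc \<Longrightarrow> s \<in> denominators f \<Longrightarrow> local_frac n f a s \<in> carrier (local_Rt n f)"
  by (simp add: local_Rt_eq with_smult_def local_frac_def loc.frac_carrier)

lemma smult_local_frac:
  "P \<in> diff_ops coeff_ring (Rt n) \<Longrightarrow> Rt.power_linear e P \<Longrightarrow> a \<in> Rc \<Longrightarrow> s \<in> denominators f \<Longrightarrow>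
    P \<odot>\<^bsub>local_Rt n f\<^esub> local_frac n f a s = local_frac n f (P (a * s ^ (p ^ e - 1))) (s ^ (p ^ e))"
  by (simp add: local_Rt_eq with_smult_def local_frac_def loc.L_action_frac)

lemma left_submodule_f_inverse: "left_submodule DR (local_Rt n f) (Rt_f_inverse n f)"
  unfolding left_submodule_def
proof (intro conjI ballI subsetI)
  fix X assume "X \<in> Rt_f_inverse n f"
  then obtain a i where X: "X = local_frac n f a ([:f:] ^ i)" "a \<in> Rc" by (auto simp: Rt_f_inverse_def)
  then show "X \<in> carrier (local_Rt n f)" by (simp add: local_frac_carrier denominators_mem)
  show "P \<odot>\<^bsub>local_Rt n f\<^esub> X \<in> Rt_f_inverse n f" if "P \<in> carrier DR" for P
  proof -
    have P: "P \<in> diff_ops coeff_ring (Rt n)" using that by (simp add: diff_op_ring_def)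
    then have "\<exists>e. Rt.power_linear e P" by (simp add: Rt.diff_ops_iff_power_linear)
    then obtain e where e: "Rt.power_linear e P" by blast
    have "P (a * ([:f:] ^ i) ^ (p ^ e - 1)) \<in> Rc"
      using X(2) Rc_const[OF f] Rt.linear_closed[OF Rt.diff_ops_linear[OF P]]
      by (simp add: Rt.C_closed Rt.C_power)
    then show ?thesis
      unfolding X(1) smult_local_frac[OF P e X(2) denominators_mem(1)] power_mult[symmetric]
      by (auto simp: Rt_f_inverse_def)
  qed
  fix Y assume "Y \<in> Rt_f_inverse n f"
  then obtain b j where Y: "Y = local_frac n f b ([:f:] ^ j)" "b \<in> Rc" by (auto simp: Rt_f_inverse_def)
  have "X \<oplus>\<^bsub>local_Rt n f\<^esub> Y = local_frac n f ([:f:] ^ j * a + [:f:] ^ i * b) ([:f:] ^ (i + j))"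
    using X Y
    by (simp add: local_Rt_eq with_smult_def local_frac_def loc.add_L denominators_mem power_add)
  moreover have "[:f:] ^ j * a + [:f:] ^ i * b \<in> Rc"
    using X Y Rc_const[OF f] by (intro Rt.C_closed(3,4) Rt.C_power)
  ultimately show "X \<oplus>\<^bsub>local_Rt n f\<^esub> Y \<in> Rt_f_inverse n f"
    by (auto simp: Rt_f_inverse_def)
next
  have "\<zero>\<^bsub>local_Rt n f\<^esub> = local_frac n f 0 ([:f:] ^ 0)"
    by (simp add: local_Rt_eq with_smult_def local_frac_def loc.zero_L)
  then show "\<zero>\<^bsub>local_Rt n f\<^esub> \<in> Rt_f_inverse n f"
    unfolding Rt_f_inverse_def using Rt.C_closed(1) by blast
qed

lemma D0_subset: "carrier (D0_Rt n :: ('k mpoly poly \<Rightarrow> 'k mpoly poly) ring) \<subseteq> carrier DR"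
  by (auto simp: carrier_D0 diff_op_ring_def)

lemma D0_eq: "DR\<lparr>carrier := carrier (D0_Rt n)\<rparr> = (D0_Rt n :: ('k mpoly poly \<Rightarrow> 'k mpoly poly) ring)"
  by (simp add: D0_Rt_def diff_op_ring_deg0_def)

lemma left_module_H: "left_module DR (H_module n f)"
  unfolding H_module_def by (rule left_module_quotient[OF left_module_local_Rt left_submodule_f_inverse])

lemma left_module_H0: "left_module (D0_Rt n) (H_module n f)"
  using left_module_subring[OF left_module_H _ D0_subset] ring_D0 by (simp only: D0_eq)

lemma delta0_carrier: "delta0 n f \<in> carrier (H_module n f)"
  unfolding delta0_def H_module_def carrier_quotient_module
  using local_frac_carrier[OF Rt.C_closed(2) denominators_mem(2)] by blast

abbreviation (input) f_delta0 where "f_delta0 \<equiv> mult_op (Rt n) [:f:] \<odot>\<^bsub>H_module n f\<^esub> delta0 n f"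
abbreviation (input) Delta_module
  where "Delta_module \<equiv> (H_module n f)\<lparr>carrier := cyclic_submodule (D0_Rt n) (H_module n f) (delta0 n f)\<rparr>"
abbreviation (input) f_Delta where "f_Delta \<equiv> cyclic_submodule (D0_Rt n) (H_module n f) f_delta0"

lemma f_delta0_carrier: "f_delta0 \<in> carrier (H_module n f)"
  by (rule left_moduleD(3)[OF left_module_H0 mult_op_D0[OF f] delta0_carrier])

lemma left_module_Delta: "left_module (D0_Rt n) Delta_module"
  by (rule left_module_restrict[OF left_module_H0 left_submodule_cyclic[OF left_module_H0 delta0_carrier]])

lemma left_submodule_f_Delta: "left_submodule (D0_Rt n) Delta_module f_Delta"
proof -
  note sub = left_submodule_cyclic[OF left_module_H0 delta0_carrier]
    and fsub = left_submodule_cyclic[OF left_module_H0 f_delta0_carrier]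
  have "f_delta0 \<in> cyclic_submodule (D0_Rt n) (H_module n f) (delta0 n f)"
    using mult_op_D0[OF f] by (auto simp: cyclic_submodule_def)
  then have "f_Delta \<subseteq> cyclic_submodule (D0_Rt n) (H_module n f) (delta0 n f)"
    using left_submoduleD(4)[OF sub] by (auto simp: cyclic_submodule_def)
  then show ?thesis
    using left_submoduleD[OF fsub] by (simp add: left_submodule_def)
qed

abbreviation (input) N where "N \<equiv> N_module n f"
abbreviation (input) NQ where "NQ \<equiv> quotient_module Delta_module f_Delta"

lemma N_eq: "N = with_smult (\<lambda>P x. R_extension n P \<odot>\<^bsub>NQ\<^esub> x) NQ"
  by (simp add: N_module_def Let_def)

lemma left_module_NQ: "left_module (D0_Rt n) NQ"
  by (rule left_module_quotient[OF left_module_Delta left_submodule_f_Delta])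

lemma N_smult_closed:
  assumes "P \<in> carrier C_ring" "X \<in> carrier N"
  shows "P \<odot>\<^bsub>N\<^esub> X \<in> carrier N"
  using assms left_moduleD(3)[OF left_module_NQ R_extension_D0[OF assms(1)]]
  by (simp add: N_eq with_smult_def)

lemma N_zero_carrier: "\<zero>\<^bsub>N\<^esub> \<in> carrier N"
proof -
  interpret abelian_group NQ by (rule left_moduleD(2)[OF left_module_NQ])
  show ?thesis by (simp add: N_eq with_smult_def)
qed

text \<open>
  \<open>N\<^sub>f\<close> is generated by \<open>\<delta>\<^sub>0\<close> over the degree-zero operators, and \<open>P\<close> is central among these; hence
  it suffices that \<open>P\<close> maps \<open>\<delta>\<^sub>0\<close> into the submodule generated by \<open>f \<delta>\<^sub>0\<close>.
\<close>
lemma kills_N: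
  assumes P: "P \<in> carrier C_ring" and \<phi>: "\<phi> \<in> carrier (D0_Rt n)"
    and eq: "R_extension n P \<odot>\<^bsub>H_module n f\<^esub> delta0 n f = \<phi> \<odot>\<^bsub>H_module n f\<^esub> f_delta0"
    and X: "X \<in> carrier N"
  shows "P \<odot>\<^bsub>N\<^esub> X = \<zero>\<^bsub>N\<^esub>"
proof -
  let ?E = "R_extension n P" and ?H = "H_module n f"
  note E = R_extension_D0[OF P]
  have "X \<in> carrier NQ" using X by (simp add: N_eq with_smult_def)
  then obtain x where x: "x \<in> carrier Delta_module" "X = f_Delta +>\<^bsub>Delta_module\<^esub> x"
    unfolding carrier_quotient_module by blast
  then obtain Q where Q: "Q \<in> carrier (D0_Rt n)" "x = Q \<odot>\<^bsub>?H\<^esub> delta0 n f"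
    by (auto simp: cyclic_submodule_def)
  interpret D0: ring "D0_Rt n :: ('k mpoly poly \<Rightarrow> 'k mpoly poly) ring" by (rule ring_D0)
  have mult: "A \<otimes>\<^bsub>D0_Rt n\<^esub> B = compose Rc A B" for A B :: "'k mpoly poly \<Rightarrow> 'k mpoly poly"
    by (simp add: D0_Rt_def diff_op_ring_deg0_def diff_op_ring_def)
  note assoc = left_moduleD(6)[OF left_module_H0]
  have "?E \<odot>\<^bsub>?H\<^esub> x = (?E \<otimes>\<^bsub>D0_Rt n\<^esub> Q) \<odot>\<^bsub>?H\<^esub> delta0 n f"
    unfolding Q(2) by (rule assoc[OF E Q(1) delta0_carrier, symmetric])
  also have "?E \<otimes>\<^bsub>D0_Rt n\<^esub> Q = Q \<otimes>\<^bsub>D0_Rt n\<^esub> ?E"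
    unfolding mult by (rule R_extension_central[OF P Q(1)])
  also have "\<dots> \<odot>\<^bsub>?H\<^esub> delta0 n f = Q \<odot>\<^bsub>?H\<^esub> (?E \<odot>\<^bsub>?H\<^esub> delta0 n f)"
    by (rule assoc[OF Q(1) E delta0_carrier])
  also have "\<dots> = (Q \<otimes>\<^bsub>D0_Rt n\<^esub> \<phi>) \<odot>\<^bsub>?H\<^esub> f_delta0"
    unfolding eq by (rule assoc[OF Q(1) \<phi> f_delta0_carrier, symmetric])
  also have "\<dots> \<in> f_Delta"
    unfolding cyclic_submodule_def using Q(1) \<phi> by (intro imageI) simp
  finally have "?E \<odot>\<^bsub>Delta_module\<^esub> x \<in> f_Delta" by simp
  then have "?E \<odot>\<^bsub>NQ\<^esub> X = \<zero>\<^bsub>NQ\<^esub>"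
    unfolding x(2) by (rule quotient_smult_eq_zero[OF left_module_Delta left_submodule_f_Delta E x(1)])
  then show ?thesis by (simp add: N_eq with_smult_def)
qed

lemma N_localized_trivial:
  assumes P: "P \<in> carrier C_ring - C_prime p \<alpha>"
    and kills: "\<And>X. X \<in> carrier N \<Longrightarrow> P \<odot>\<^bsub>N\<^esub> X = \<zero>\<^bsub>N\<^esub>"
  shows "carrier (N_localized p n f \<alpha>) = {\<zero>\<^bsub>N_localized p n f \<alpha>\<^esub>}"
proof -
  let ?W = "carrier C_ring - C_prime p \<alpha>"
  have frac: "fraction N ?W x s = carrier N \<times> ?W" if "x \<in> carrier N" "s \<in> carrier C_ring" for x s
  proof -
    have "P \<odot>\<^bsub>N\<^esub> (u \<odot>\<^bsub>N\<^esub> x) = P \<odot>\<^bsub>N\<^esub> (s \<odot>\<^bsub>N\<^esub> y)" if "u \<in> ?W" "y \<in> carrier N" for u y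
      using that \<open>x \<in> carrier N\<close> \<open>s \<in> carrier C_ring\<close> by (simp add: kills N_smult_closed)
    then show ?thesis using P unfolding fraction_def by blast
  qed
  have "carrier (N_localized p n f \<alpha>) = {fraction N ?W x s | x s. x \<in> carrier N \<and> s \<in> ?W}"
    by (simp add: N_localized_def localization_def)
  also have "\<dots> = {carrier N \<times> ?W}"
    using N_zero_carrier P frac by (auto intro!: exI[of _ "\<zero>\<^bsub>N\<^esub>"] exI[of _ P])
  also have "carrier N \<times> ?W = \<zero>\<^bsub>N_localized p n f \<alpha>\<^esub>"
    using frac[OF N_zero_carrier C_ring_one] by (simp add: N_localized_def localization_def)
  finally show ?thesis .
qed

lemma nonzerodivisor_f_t:
  assumes "q > 0" "([:f:] ^ q - Polynomial.monom 1 1 ^ q) * z = 0"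
  shows "z = 0"
proof (rule ccontr)
  assume "z \<noteq> 0"
  have "Polynomial.monom 1 q * z = [:f ^ q:] * z"
    using assms(2) by (simp add: algebra_simps monom_power poly_const_pow del: mult_pCons_left)
  then have "Polynomial.coeff (Polynomial.monom 1 q * z) (q + Polynomial.degree z)
      = Polynomial.coeff ([:f ^ q:] * z) (q + Polynomial.degree z)" by simp
  then have "Polynomial.coeff z (Polynomial.degree z) = f ^ q * Polynomial.coeff z (q + Polynomial.degree z)"
    by (simp only: coeff_monom_mult coeff_const_mult) simp
  also have "\<dots> = 0" using assms(1) by (simp add: coeff_eq_0)
  finally show False using \<open>z \<noteq> 0\<close> by simp
qed

text \<open>
  The operator \<open>\<phi>\<close> applies \<open>D\<close> to the coefficients in degrees \<open>i\<close> with
  \<open>- 1 - i \<equiv> s (mod p\<^sup>e\<^sup>+\<^sup>m)\<close> and annihilates the others. The expansion of \<open>1/(f - t)\<close> into a power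
  series is replaced by the exact identity \<open>f\<^sup>q - t\<^sup>q = (f - t) g\<close>, where \<open>q\<close> is a power of \<open>p\<close> so
  large that all operators involved commute with \<open>f\<^sup>q - t\<^sup>q\<close> and with \<open>(f - t)\<^sup>q\<close>: the equation
  \<open>\<phi>(f g) = \<pi> g\<close> is read off coefficientwise, and the nonzerodivisor \<open>f\<^sup>q - t\<^sup>q\<close> carries it over
  to \<open>(f - t)\<^sup>q\<^sup>-\<^sup>1\<close>, the numerator of \<open>1/(f - t)\<close> over \<open>(f - t)\<^sup>q\<close>.
\<close>
lemma lowering_operator:
  assumes D: "frobenius_linear (p ^ e) n D" and s: "s < p ^ (e + m)" and Df: "D (f ^ (s + 1)) = f ^ s"
  obtains \<phi> where "\<phi> \<in> carrier (D0_Rt n)"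
    "R_extension n (residue_projector p (e + m) (int s)) \<odot>\<^bsub>H_module n f\<^esub> delta0 n f
      = \<phi> \<odot>\<^bsub>H_module n f\<^esub> f_delta0"
proof -
  let ?k = "e + m"
  let ?cond = "\<lambda>i. (- 1 - int i) mod int p ^ ?k = int s"
  let ?E = "R_extension n (residue_projector p ?k (int s)) :: 'k mpoly poly \<Rightarrow> 'k mpoly poly"
  let ?d = "\<lambda>i r. if ?cond i then D r else 0"
  define \<phi> where "\<phi> = (\<lambda>q\<in>Rc. degreewise ?d q)"
  have p0: "p > 0" using prime by (rule prime_gt_0_nat)
  have D_closed: "D r \<in> mpolys n" if "r \<in> mpolys n" for r
    using D that by (simp add: frobenius_linear_def)
  have D_add: "D (r + s) = D r + D s" if "r \<in> mpolys n" "s \<in> mpolys n" for r s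
    using D that by (simp add: frobenius_linear_def)
  have D_const: "D (mconst c * r) = mconst c * D r" if "r \<in> mpolys n" for c r
    using D that by (simp add: frobenius_linear_def)
  have D0: "D 0 = 0" using D_add[of 0 0] by (simp add: mpolys_closed)
  have \<phi>: "\<phi> \<in> carrier (D0_Rt n)"
    unfolding \<phi>_def
  proof (rule degreewise_D0[where e = ?k])
    fix i j and r :: "'k mpoly" assume "r \<in> mpolys n" "j < n"
    then show "?d i (mvar j ^ (p ^ ?k) * r) = mvar j ^ (p ^ ?k) * ?d i r"
      using frobenius_linear_commutes[OF D mvar_mpolys] by simp
  qed (use residue_shift[of _ p ?k] in \<open>auto simp: D_closed D_add D_const mpolys_closed\<close>)
  have E: "?E \<in> carrier (D0_Rt n)" by (rule R_extension_D0[OF residue_projector_C_ring])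
  have \<phi>D: "\<phi> \<in> diff_ops coeff_ring (Rt n)" and ED: "?E \<in> diff_ops coeff_ring (Rt n)"
    using \<phi> E by (simp_all add: carrier_D0)
  obtain e0 where e0: "Rt.power_linear e0 \<phi>" "Rt.power_linear e0 ?E"
    by (rule Rt.common_power_linear[OF \<phi>D ED])
  define l where "l = max e0 ?k"
  have l: "Rt.power_linear l \<phi>" "Rt.power_linear l ?E"
    using e0 by (auto simp: l_def intro: Rt.power_linear_mono)
  define q where "q = p ^ l"
  have q: "q > 0" using p0 by (simp add: q_def)
  have k_dvd_q: "p ^ ?k dvd q" unfolding q_def l_def by (rule le_imp_power_dvd) simp
  define h where "h = [:f, -1:]"
  define t :: "'k mpoly poly" where "t = Polynomial.monom 1 1"
  define g where "g = (\<Sum>i<q. [:f:] ^ (q - Suc i) * t ^ i)"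
  define b where "b = [:f:] ^ q - t ^ q"
  have h_eq: "h = [:f:] - t" by (simp add: h_def t_def monom_altdef)
  have "t ^ q - [:f:] ^ q = (t - [:f:]) * g" unfolding g_def by (rule power_diff_sumr2)
  then have b_eq: "b = h * g" unfolding b_def h_eq by (metis minus_diff_eq mult_minus_left)
  have mem: "h \<in> Rc" "[:f:] \<in> Rc" "t \<in> Rc"
    using f_minus_t Rc_const[OF f] by (auto simp: h_def t_def intro!: Rc_monom mpolys_closed)
  have coeff_g: "Polynomial.coeff g i = (if i < q then f ^ (q - Suc i) else 0)" for i
  proof -
    have "[:f:] ^ (q - Suc i) * t ^ i = Polynomial.monom (f ^ (q - Suc i)) i" for i
      by (simp add: t_def monom_power poly_const_pow smult_monom)
    then show ?thesis by (simp add: g_def coeff_sum)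
  qed
  have g: "g \<in> Rc" by (auto simp: Rc_iff coeff_g mpolys_power f mpolys_closed)
  have key: "\<phi> ([:f:] * g) = ?E g"
  proof (rule poly_eqI)
    fix i
    have "D (f * f ^ (q - Suc i)) = f ^ (q - Suc i)" if "i < q" "?cond i"
    proof -
      \<comment> \<open>\<open>q - 1 - i\<close> is a nonnegative representative of the residue class of \<open>- 1 - i\<close>.\<close>
      have "int (q - Suc i) mod int p ^ ?k = (int q + (- 1 - int i)) mod int p ^ ?k"
        using that(1) by (simp add: of_nat_diff algebra_simps)
      also have "\<dots> = (- 1 - int i) mod int p ^ ?k"
      proof -
        have "int p ^ ?k dvd int q" using k_dvd_q by (metis of_nat_dvd_iff of_nat_power)
        then show ?thesis by (auto simp: mod_eq_dvd_iff)
      qed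
      finally have "int (q - Suc i) mod int p ^ ?k = int s" using that(2) by simp
      then have "(q - Suc i) mod p ^ ?k = s" by (metis of_nat_eq_iff of_nat_mod of_nat_power)
      then obtain j where j: "q - Suc i = s + p ^ ?k * j"
        by (metis add.commute mod_mult_div_eq)
      have "f * f ^ (q - Suc i) = (f ^ j) ^ (p ^ ?k) * f ^ (s + 1)"
        unfolding j by (simp add: power_add mult_ac flip: power_mult)
      then have "D (f * f ^ (q - Suc i)) = (f ^ j) ^ (p ^ ?k) * D (f ^ (s + 1))"
        using frobenius_linear_commutes[OF D, of "f ^ j" "f ^ (s + 1)"] by (simp only: mpolys_power f)
      also have "\<dots> = f ^ (q - Suc i)"
        unfolding Df j by (simp add: power_add mult_ac flip: power_mult)
      finally show ?thesis .
    qed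
    then show "Polynomial.coeff (\<phi> ([:f:] * g)) i = Polynomial.coeff (?E g) i"
      using g mem(2)
      by (simp add: \<phi>_def R_extension_residue_projector Rt.C_closed(4) coeff_degreewise D0
          coeff_residue_projector coeff_const_mult coeff_g del: mult_pCons_left)
  qed
  \<comment> \<open>Multiplying by \<open>b = h g\<close> trades \<open>w\<close> for \<open>h\<^sup>q g\<close>, because \<open>h w = h\<^sup>q\<close>.\<close>
  define w where "w = h ^ (q - 1)"
  have w: "w \<in> Rc" using mem by (simp add: w_def Rt.C_power)
  have hw: "h * w = h ^ q" unfolding w_def q_def by (rule loc.prime_power_Suc)
  note lin = Rt.diff_ops_linear
  have b_comm: "\<psi> (b * x) = b * \<psi> x" if "\<psi> \<in> diff_ops coeff_ring (Rt n)" "Rt.power_linear l \<psi>" "x \<in> Rc" for \<psi> x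
  proof -
    have "\<psi> (b * x) = \<psi> ([:f:] ^ q * x) - \<psi> (t ^ q * x)"
      unfolding b_def left_diff_distrib using that mem
      by (intro Rt.linear_diff lin Rt.C_closed(4) Rt.C_power)
    also have "\<dots> = b * \<psi> x"
      unfolding q_def using that mem
      by (simp only: Rt.power_linearD b_def q_def left_diff_distrib)
    finally show ?thesis .
  qed
  have "b * \<phi> ([:f:] * w) = \<phi> (b * ([:f:] * w))"
    using \<phi>D l(1) mem w by (intro b_comm[symmetric] Rt.C_closed(4))
  also have "b * ([:f:] * w) = h ^ q * ([:f:] * g)"
    unfolding b_eq hw[symmetric] by (simp only: mult_ac)
  also have "\<phi> \<dots> = h ^ q * \<phi> ([:f:] * g)"
    unfolding q_def using l(1) mem g by (intro Rt.power_linearD Rt.C_closed(4))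
  also have "\<dots> = ?E (h ^ q * g)"
    unfolding key unfolding q_def using l(2) mem g by (intro Rt.power_linearD[symmetric])
  also have "h ^ q * g = b * w"
    unfolding b_eq hw[symmetric] by (simp only: mult_ac)
  also have "?E \<dots> = b * ?E w"
    using ED l(2) w by (intro b_comm)
  finally have "b * (\<phi> ([:f:] * w) - ?E w) = 0" by (simp add: right_diff_distrib)
  then have \<phi>w: "\<phi> ([:f:] * w) = ?E w"
    using nonzerodivisor_f_t[OF q, of "\<phi> ([:f:] * w) - ?E w"] by (simp add: b_def t_def)
  note den = denominators_mem(2)[folded h_def]
  let ?K = "Rt_f_inverse n f" and ?L = "local_Rt n f"
  have D0D: "\<psi> \<in> carrier DR" if "\<psi> \<in> carrier (D0_Rt n)" for \<psi> using that D0_subset by blast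
  have smult: "\<psi> \<odot>\<^bsub>H_module n f\<^esub> (?K +>\<^bsub>?L\<^esub> local_frac n f a h)
      = ?K +>\<^bsub>?L\<^esub> (\<psi> \<odot>\<^bsub>?L\<^esub> local_frac n f a h)" if "\<psi> \<in> carrier (D0_Rt n)" "a \<in> Rc" for \<psi> a
    unfolding H_module_def
    by (rule quotient_smult[OF left_module_local_Rt left_submodule_f_inverse D0D[OF that(1)]
          local_frac_carrier[OF that(2) den]])
  have delta: "delta0 n f = ?K +>\<^bsub>?L\<^esub> local_frac n f 1 h"
    by (simp add: delta0_def h_def)
  have mf: "mult_op (Rt n) [:f:] \<in> carrier (D0_Rt n)" by (rule mult_op_D0[OF f])
  have "mult_op (Rt n) [:f:] \<odot>\<^bsub>?L\<^esub> local_frac n f 1 h = local_frac n f [:f:] h"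
  proof -
    have "Rt.power_linear 0 (mult_op (Rt n) [:f:])"
      using mem(2) by (auto simp: Rt.power_linear_def commutes_on_def mult_op_def Rt.S_ops
          Rt.C_closed mult.left_commute simp del: mult_pCons_left)
    from smult_local_frac[OF Rt.mult_op_diff_ops[OF mem(2)] this Rt.C_closed(2) den]
    show ?thesis by (simp add: mult_op_def Rt.S_ops Rt.C_closed)
  qed
  then have f_delta: "f_delta0 = ?K +>\<^bsub>?L\<^esub> local_frac n f [:f:] h"
    unfolding delta smult[OF mf Rt.C_closed(2)] by simp
  have "?E \<odot>\<^bsub>?L\<^esub> local_frac n f 1 h = \<phi> \<odot>\<^bsub>?L\<^esub> local_frac n f [:f:] h"
    unfolding smult_local_frac[OF ED l(2) Rt.C_closed(2) den]
      smult_local_frac[OF \<phi>D l(1) mem(2) den] q_def[symmetric] w_def[symmetric] \<phi>w by simp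
  then have "?E \<odot>\<^bsub>H_module n f\<^esub> delta0 n f = \<phi> \<odot>\<^bsub>H_module n f\<^esub> f_delta0"
    unfolding f_delta unfolding delta smult[OF E Rt.C_closed(2)] smult[OF \<phi> mem(2)] by simp
  then show ?thesis using \<phi> that by blast
qed

lemma not_bernstein_sato_root:
  assumes D: "frobenius_linear (p ^ e) n D" and Df: "D (f ^ (s + 1)) = f ^ s"
    and \<alpha>: "\<alpha> \<in> padic_ints p" "\<alpha> (e + m) = int s"
  shows "\<alpha> \<notin> bernstein_sato_roots p n f"
proof -
  let ?P = "residue_projector p (e + m) (int s) :: 'k poly \<Rightarrow> 'k poly"
  have "int s < int p ^ (e + m)" using \<alpha> by (auto simp: padic_ints_def simp flip: \<alpha>(2))
  then have "s < p ^ (e + m)" by (metis of_nat_less_iff of_nat_power)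
  then obtain \<phi> where \<phi>: "\<phi> \<in> carrier (D0_Rt n)"
    "R_extension n ?P \<odot>\<^bsub>H_module n f\<^esub> delta0 n f = \<phi> \<odot>\<^bsub>H_module n f\<^esub> f_delta0"
    using lowering_operator[OF D _ Df] by blast
  have "eigenvalue_function p ?P \<alpha> = 1"
    using eigenvalue_function_residue_projector[of p \<alpha> "e + m", where ?'k = 'k] \<alpha>
      prime_gt_0_nat[OF prime] by simp
  then have "?P \<in> carrier C_ring - C_prime p \<alpha>"
    using residue_projector_C_ring p_not_dvd_one by (simp add: C_prime_def)
  then have "carrier (N_localized p n f \<alpha>) = {\<zero>\<^bsub>N_localized p n f \<alpha>\<^esub>}"
    by (rule N_localized_trivial) (rule kills_N[OF residue_projector_C_ring \<phi>])
  then show ?thesis by (simp add: bernstein_sato_roots_def)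
qed

end

section \<open>Counting the exceptional exponents\<close>

lemma lookup_monomial_mult:
  fixes g :: "'k::comm_ring_1 mpoly"
  shows "Poly_Mapping.lookup (Poly_Mapping.single v c * g) w =
    (if \<forall>i. Poly_Mapping.lookup v i \<le> Poly_Mapping.lookup w i
     then c * Poly_Mapping.lookup g (w - v) else 0)"
proof -
  have w: "w = v + (w - v)" if "\<forall>i. Poly_Mapping.lookup v i \<le> Poly_Mapping.lookup w i"
    using that by (intro poly_mapping_eqI) (simp add: lookup_add lookup_minus)
  have "Poly_Mapping.single v c * g =
      (\<Sum>u\<in>Poly_Mapping.keys g. Poly_Mapping.single (v + u) (c * Poly_Mapping.lookup g u))"
    by (subst poly_mapping_sum_single[of g]) (simp add: sum_distrib_left mult_single)
  then have eq: "Poly_Mapping.lookup (Poly_Mapping.single v c * g) w =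
      (\<Sum>u\<in>Poly_Mapping.keys g. (c * Poly_Mapping.lookup g u when v + u = w))"
    by (simp add: lookup_sum lookup_single)
  show ?thesis
  proof (cases "\<forall>i. Poly_Mapping.lookup v i \<le> Poly_Mapping.lookup w i")
    case True
    then have "v + u = w \<longleftrightarrow> u = w - v" for u
      using w[OF True] by (metis add_diff_cancel_left')
    then have "Poly_Mapping.lookup (Poly_Mapping.single v c * g) w =
        (\<Sum>u\<in>Poly_Mapping.keys g. if u = w - v then c * Poly_Mapping.lookup g u else 0)"
      unfolding eq by (intro sum.cong) (auto simp: when_def)
    then show ?thesis using True by (auto simp: in_keys_iff)
  next
    case False
    then have "v + u \<noteq> w" for u by (auto simp: lookup_add)
    then show ?thesis unfolding eq if_not_P[OF False] by (simp add: when_def)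
  qed
qed

text \<open>
  When all exponents of \<open>u\<close> are below \<open>q\<close>, this is the coefficient of \<open>x\<^sup>u\<close> in \<open>g\<close> with respect to
  the basis of \<open>A[x]\<close> over \<open>A[x\<^sup>q]\<close> formed by such monomials.
\<close>
definition frobenius_coefficient ::
    "nat \<Rightarrow> (nat \<Rightarrow>\<^sub>0 nat) \<Rightarrow> 'k::comm_ring_1 mpoly \<Rightarrow> 'k mpoly"
  where "frobenius_coefficient q u g = Poly_Mapping.Abs_poly_mapping (\<lambda>w.
    if \<forall>i. q dvd Poly_Mapping.lookup w i then Poly_Mapping.lookup g (w + u) else 0)"

lemma lookup_frobenius_coefficient:
  "Poly_Mapping.lookup (frobenius_coefficient q u g) w =
    (if \<forall>i. q dvd Poly_Mapping.lookup w i then Poly_Mapping.lookup g (w + u) else 0)"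
proof -
  have "finite ((\<lambda>w. w + u) -` Poly_Mapping.keys g)"
    by (rule finite_vimageI) (simp_all add: inj_on_def)
  then have "finite {w. (if \<forall>i. q dvd Poly_Mapping.lookup w i then Poly_Mapping.lookup g (w + u) else 0) \<noteq> 0}"
    by (rule finite_subset[rotated]) (auto simp: in_keys_iff)
  then show ?thesis by (simp add: frobenius_coefficient_def lookup_Abs_poly_mapping)
qed

lemma mvar_power: "mvar j ^ k = Poly_Mapping.single (Poly_Mapping.single j k) 1"
proof (induction k)
  case (Suc k)
  have "Poly_Mapping.single j (1::nat) + Poly_Mapping.single j k = Poly_Mapping.single j (Suc k)"
    using single_add[of j 1 k] by simp
  then show ?case by (simp add: Suc mult_single) (simp add: mvar_def mult_single)
qed simp

lemma frobenius_coefficient_mpolys: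
  assumes "g \<in> mpolys n"
  shows "frobenius_coefficient q u g \<in> mpolys n"
  unfolding mpolys_def
proof clarify
  fix w i assume w: "w \<in> Poly_Mapping.keys (frobenius_coefficient q u g)" and i: "i \<in> Poly_Mapping.keys w"
  have "w + u \<in> Poly_Mapping.keys g"
    using w by (auto simp: in_keys_iff lookup_frobenius_coefficient split: if_splits)
  moreover have "i \<in> Poly_Mapping.keys (w + u)" using i by (simp add: in_keys_iff lookup_add)
  ultimately show "i < n" using assms unfolding mpolys_def by blast
qed

lemma frobenius_linear_coefficient:
  assumes "\<And>i. Poly_Mapping.lookup u i < q"
  shows "frobenius_linear q n (frobenius_coefficient q u :: 'k::comm_ring_1 mpoly \<Rightarrow> 'k mpoly)"
  unfolding frobenius_linear_def
proof (intro conjI allI ballI impI)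
  fix r s :: "'k mpoly" and c :: 'k and j
  show "frobenius_coefficient q u (r + s) = frobenius_coefficient q u r + frobenius_coefficient q u s"
    by (rule poly_mapping_eqI) (simp add: lookup_frobenius_coefficient lookup_add)
  show "frobenius_coefficient q u (mconst c * r) = mconst c * frobenius_coefficient q u r"
    by (rule poly_mapping_eqI)
       (simp add: lookup_frobenius_coefficient mconst_def lookup_monomial_mult)
  show "frobenius_coefficient q u (mvar j ^ q * r) = mvar j ^ q * frobenius_coefficient q u r"
  proof (rule poly_mapping_eqI)
    fix w :: "nat \<Rightarrow>\<^sub>0 nat"
    let ?v = "Poly_Mapping.single j q"
    have le: "(\<forall>i. Poly_Mapping.lookup ?v i \<le> Poly_Mapping.lookup w i) \<longleftrightarrow> q \<le> Poly_Mapping.lookup w j"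
      for w :: "nat \<Rightarrow>\<^sub>0 nat"
      by (auto simp: lookup_single when_def)
    have le': "(\<forall>i. Poly_Mapping.lookup ?v i \<le> Poly_Mapping.lookup w i + Poly_Mapping.lookup u i)
        \<longleftrightarrow> q \<le> Poly_Mapping.lookup w j + Poly_Mapping.lookup u j"
      by (auto simp: lookup_single when_def)
    show "Poly_Mapping.lookup (frobenius_coefficient q u (mvar j ^ q * r)) w =
        Poly_Mapping.lookup (mvar j ^ q * frobenius_coefficient q u r) w"
    proof (cases "\<forall>i. q dvd Poly_Mapping.lookup w i")
      case True
      have *: "q \<le> Poly_Mapping.lookup w j + Poly_Mapping.lookup u j \<longleftrightarrow> q \<le> Poly_Mapping.lookup w j"
      proof -
        obtain a where a: "Poly_Mapping.lookup w j = q * a" using True by blast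
        show ?thesis using assms[of j] unfolding a by (cases a) auto
      qed
      have "q dvd Poly_Mapping.lookup (w - ?v) i" if "q \<le> Poly_Mapping.lookup w j" for i
        using True that by (auto simp: lookup_minus lookup_single when_def intro: dvd_diff_nat)
      moreover have "w + u - ?v = w - ?v + u" if "q \<le> Poly_Mapping.lookup w j"
        using that by (intro poly_mapping_eqI) (auto simp: lookup_minus lookup_add lookup_single when_def)
      ultimately show ?thesis
        using True * by (simp add: lookup_frobenius_coefficient mvar_power lookup_monomial_mult le le'
            lookup_add)
    next
      case False
      then obtain i where i: "\<not> q dvd Poly_Mapping.lookup w i" by blast
      have "\<not> (\<forall>i. q dvd Poly_Mapping.lookup (w - ?v) i)" if "q \<le> Poly_Mapping.lookup w j"
      proof -
        have "Poly_Mapping.lookup w i = Poly_Mapping.lookup (w - ?v) i + (q when j = i)"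
          using that by (auto simp: lookup_minus lookup_single when_def)
        then have "\<not> q dvd Poly_Mapping.lookup (w - ?v) i" using i by (auto simp: when_def)
        then show ?thesis by blast
      qed
      then show ?thesis
        unfolding lookup_frobenius_coefficient mvar_power lookup_monomial_mult le if_not_P[OF False]
        by auto
    qed
  qed
qed (rule frobenius_coefficient_mpolys)

definition exponent_mod :: "nat \<Rightarrow> (nat \<Rightarrow>\<^sub>0 nat) \<Rightarrow> (nat \<Rightarrow>\<^sub>0 nat)"
  where "exponent_mod q w = Poly_Mapping.Abs_poly_mapping (\<lambda>i. Poly_Mapping.lookup w i mod q)"

lemma lookup_exponent_mod:
  "Poly_Mapping.lookup (exponent_mod q w) i = Poly_Mapping.lookup w i mod q"
proof -
  have "{i. Poly_Mapping.lookup w i mod q \<noteq> 0} \<subseteq> Poly_Mapping.keys w"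
  proof
    fix i assume "i \<in> {i. Poly_Mapping.lookup w i mod q \<noteq> 0}"
    then show "i \<in> Poly_Mapping.keys w" by (cases "Poly_Mapping.lookup w i") (auto simp: in_keys_iff)
  qed
  then have "finite {i. Poly_Mapping.lookup w i mod q \<noteq> 0}"
    by (rule finite_subset) simp
  then show ?thesis by (simp add: exponent_mod_def lookup_Abs_poly_mapping)
qed

lemma frobenius_expansion:
  fixes g :: "'k::comm_ring_1 mpoly"
  assumes "q > 0"
  shows "g = (\<Sum>u\<in>exponent_mod q ` Poly_Mapping.keys g.
    Poly_Mapping.single u 1 * frobenius_coefficient q u g)"
proof (rule poly_mapping_eqI)
  fix w :: "nat \<Rightarrow>\<^sub>0 nat"
  let ?U = "exponent_mod q ` Poly_Mapping.keys g"
  let ?le = "\<lambda>u. \<forall>i. Poly_Mapping.lookup u i \<le> Poly_Mapping.lookup w i"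
  note lk = lookup_exponent_mod
  have summand: "Poly_Mapping.lookup (Poly_Mapping.single u 1 * frobenius_coefficient q u g) w =
      (if u = exponent_mod q w then Poly_Mapping.lookup g w else 0)" if "u \<in> ?U" for u
  proof (cases "u = exponent_mod q w")
    case True
    have "w - u + u = w" by (intro poly_mapping_eqI) (simp add: True lookup_add lookup_minus lk)
    then show ?thesis
      by (simp add: True lookup_monomial_mult lookup_frobenius_coefficient lk lookup_minus
          minus_mod_eq_mult_div)
  next
    case False
    have "\<not> (\<forall>i. q dvd Poly_Mapping.lookup (w - u) i)" if le: "?le u"
    proof
      assume *: "\<forall>i. q dvd Poly_Mapping.lookup (w - u) i"
      have "Poly_Mapping.lookup u i = Poly_Mapping.lookup w i mod q" for i
      proof -
        have "Poly_Mapping.lookup u i < q" using that \<open>u \<in> ?U\<close> assms by (auto simp: lk)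
        moreover obtain a where "Poly_Mapping.lookup (w - u) i = q * a" using * by blast
        then have "Poly_Mapping.lookup w i = q * a + Poly_Mapping.lookup u i"
          using le by (simp add: lookup_minus) (metis le_add_diff_inverse2)
        ultimately show ?thesis by simp
      qed
      then have "u = exponent_mod q w" by (intro poly_mapping_eqI) (simp add: lk)
      then show False using False by simp
    qed
    then show ?thesis
      unfolding lookup_monomial_mult lookup_frobenius_coefficient if_not_P[OF False] by auto
  qed
  have "Poly_Mapping.lookup (\<Sum>u\<in>?U. Poly_Mapping.single u 1 * frobenius_coefficient q u g) w
      = (\<Sum>u\<in>?U. if u = exponent_mod q w then Poly_Mapping.lookup g w else 0)"
    using summand by (simp add: lookup_sum)
  also have "\<dots> = Poly_Mapping.lookup g w"
    by (auto simp: in_keys_iff)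
  finally show "Poly_Mapping.lookup g w = Poly_Mapping.lookup (\<Sum>u\<in>?U.
      Poly_Mapping.single u 1 * frobenius_coefficient q u g) w" by simp
qed

text \<open>The bound is on the degree in each variable separately, which adds up under products.\<close>
definition bounded_polys :: "nat \<Rightarrow> nat \<Rightarrow> 'k::comm_ring_1 mpoly set"
  where "bounded_polys n d = {g \<in> mpolys n. \<forall>w\<in>Poly_Mapping.keys g. \<forall>i. Poly_Mapping.lookup w i \<le> d}"

lemma bounded_polys_mult:
  assumes "g \<in> bounded_polys n a" "h \<in> bounded_polys n b"
  shows "g * h \<in> bounded_polys n (a + b)"
proof -
  have "\<forall>i. Poly_Mapping.lookup w i \<le> a + b" if w: "w \<in> Poly_Mapping.keys (g * h)" for w
  proof -
    obtain u v where "u \<in> Poly_Mapping.keys g" "v \<in> Poly_Mapping.keys h" "w = u + v"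
      using w keys_mult[of g h] by blast
    then show ?thesis using assms by (auto simp: bounded_polys_def lookup_add intro!: add_mono)
  qed
  then show ?thesis using assms by (simp add: bounded_polys_def mpolys_closed)
qed

lemma bounded_polys_power:
  assumes "g \<in> bounded_polys n d"
  shows "g ^ k \<in> bounded_polys n (k * d)"
proof (induction k)
  case 0
  have "w = 0" if "w \<in> Poly_Mapping.keys (1::'a mpoly)" for w
    using that by (simp add: in_keys_iff lookup_one when_def split: if_splits)
  then show ?case by (auto simp: bounded_polys_def mpolys_closed)
next
  case (Suc k)
  then show ?case using bounded_polys_mult[OF assms Suc] by (simp add: add.commute)
qed

lemma bounded_polys_mono: "g \<in> bounded_polys n a \<Longrightarrow> a \<le> b \<Longrightarrow> g \<in> bounded_polys n b"
  unfolding bounded_polys_def by (auto intro: le_trans)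

lemma bounded_polys_exists:
  assumes "g \<in> mpolys n"
  obtains d where "g \<in> bounded_polys n d"
proof -
  let ?d = "\<Sum>w\<in>Poly_Mapping.keys g. \<Sum>i\<in>Poly_Mapping.keys w. Poly_Mapping.lookup w i"
  have "Poly_Mapping.lookup w i \<le> ?d" if w: "w \<in> Poly_Mapping.keys g" for w i
  proof (cases "i \<in> Poly_Mapping.keys w")
    case True
    have "Poly_Mapping.lookup w i \<le> (\<Sum>i\<in>Poly_Mapping.keys w. Poly_Mapping.lookup w i)"
      using True by (intro member_le_sum) auto
    also have "\<dots> \<le> ?d"
      using w by (intro member_le_sum[of w _ "\<lambda>w. \<Sum>i\<in>Poly_Mapping.keys w. Poly_Mapping.lookup w i"]) auto
    finally show ?thesis .
  qed (simp add: in_keys_iff)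
  then have "g \<in> bounded_polys n ?d" using assms by (simp add: bounded_polys_def)
  then show ?thesis by (rule that)
qed

text \<open>Polynomials in \<open>x\<^sup>q\<close> of degree at most \<open>d\<close> in each \<open>x\<^sub>j\<^sup>q\<close>.\<close>
definition frobenius_polys :: "nat \<Rightarrow> nat \<Rightarrow> nat \<Rightarrow> 'k::comm_ring_1 mpoly set"
  where "frobenius_polys q n d =
    {g \<in> bounded_polys n (q * d). \<forall>w\<in>Poly_Mapping.keys g. \<forall>i. q dvd Poly_Mapping.lookup w i}"

lemma frobenius_coefficient_bounded:
  assumes "g \<in> bounded_polys n (q * d)"
  shows "frobenius_coefficient q u g \<in> frobenius_polys q n d"
proof -
  have "q dvd Poly_Mapping.lookup w i \<and> Poly_Mapping.lookup w i \<le> q * d"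
    if "w \<in> Poly_Mapping.keys (frobenius_coefficient q u g)" for w i
  proof -
    have "\<forall>i. q dvd Poly_Mapping.lookup w i" "w + u \<in> Poly_Mapping.keys g"
      using that by (auto simp: in_keys_iff lookup_frobenius_coefficient split: if_splits)
    moreover from this have "Poly_Mapping.lookup (w + u) i \<le> q * d"
      using assms by (auto simp: bounded_polys_def)
    ultimately show ?thesis by (simp add: lookup_add)
  qed
  then show ?thesis
    using assms by (simp add: frobenius_polys_def bounded_polys_def frobenius_coefficient_mpolys)
qed

text \<open>The bound does not involve \<open>q\<close>: this makes the number of exceptional exponents
  bounded uniformly in \<open>e\<close>.\<close>
lemma card_frobenius_polys:
  assumes "q > 0"
  shows "finite (frobenius_polys q n d :: 'k::{comm_ring_1, finite} mpoly set)"
    "card (frobenius_polys q n d :: 'k mpoly set) \<le> CARD('k) ^ ((d + 1) ^ n)"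
proof -
  define E where "E = {..<n} \<rightarrow>\<^sub>E {..d}"
  define \<Theta> :: "'k mpoly \<Rightarrow> (nat \<Rightarrow> nat) \<Rightarrow> 'k" where "\<Theta> g = (\<lambda>v\<in>E.
    \<Sum>w\<in>Poly_Mapping.keys g. if \<forall>i<n. Poly_Mapping.lookup w i = q * v i then Poly_Mapping.lookup g w else 0)" for g
  have \<Theta>: "\<Theta> g (\<lambda>i\<in>{..<n}. Poly_Mapping.lookup w i div q) = Poly_Mapping.lookup g w"
    if g: "g \<in> frobenius_polys q n d" and w: "Poly_Mapping.keys w \<subseteq> {..<n}"
      "\<And>i. q dvd Poly_Mapping.lookup w i" "\<And>i. Poly_Mapping.lookup w i \<le> q * d" for g w
  proof -
    let ?v = "\<lambda>i\<in>{..<n}. Poly_Mapping.lookup w i div q"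
    have "Poly_Mapping.lookup w i div q \<le> d" for i
      using div_le_mono[OF w(3)[of i], of q] assms by simp
    then have v: "?v \<in> E" by (auto simp: E_def)
    have *: "(\<forall>i<n. Poly_Mapping.lookup w' i = q * ?v i) \<longleftrightarrow> w' = w"
      if "w' \<in> Poly_Mapping.keys g" for w'
    proof -
      have "Poly_Mapping.keys w' \<subseteq> {..<n}"
        using g that by (auto simp: frobenius_polys_def bounded_polys_def mpolys_def)
      then have "Poly_Mapping.lookup w' i = Poly_Mapping.lookup w i" if "\<not> i < n" for i
      proof -
        have "i \<notin> Poly_Mapping.keys w'" "i \<notin> Poly_Mapping.keys w"
          using \<open>Poly_Mapping.keys w' \<subseteq> _\<close> w(1) that by auto
        then show ?thesis by (simp add: in_keys_iff)
      qed
      then have "w' = w" if "\<forall>i<n. Poly_Mapping.lookup w' i = Poly_Mapping.lookup w i"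
        using that by (intro poly_mapping_eqI) blast
      then have "w' = w \<longleftrightarrow> (\<forall>i<n. Poly_Mapping.lookup w' i = Poly_Mapping.lookup w i)"
        by blast
      then show ?thesis using w(2) by simp
    qed
    have "\<Theta> g ?v = (\<Sum>w'\<in>Poly_Mapping.keys g. if w' = w then Poly_Mapping.lookup g w' else 0)"
      using v * by (simp add: \<Theta>_def cong: sum.cong)
    then show ?thesis by (simp add: in_keys_iff)
  qed
  have inj: "inj_on \<Theta> (frobenius_polys q n d)"
  proof (rule inj_onI, rule poly_mapping_eqI)
    fix g h :: "'k mpoly" and w
    assume g: "g \<in> frobenius_polys q n d" and h: "h \<in> frobenius_polys q n d" and eq: "\<Theta> g = \<Theta> h"
    show "Poly_Mapping.lookup g w = Poly_Mapping.lookup h w"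
    proof (cases "w \<in> Poly_Mapping.keys g \<union> Poly_Mapping.keys h")
      case True
      then have "Poly_Mapping.keys w \<subseteq> {..<n}" "\<And>i. q dvd Poly_Mapping.lookup w i"
        "\<And>i. Poly_Mapping.lookup w i \<le> q * d"
        using g h by (auto simp: frobenius_polys_def bounded_polys_def mpolys_def)
      from \<Theta>[OF g this] \<Theta>[OF h this] show ?thesis using eq by simp
    qed (simp add: in_keys_iff)
  qed
  have fin_E: "finite E" and card_E: "card E = (d + 1) ^ n"
    by (simp_all add: E_def finite_PiE card_PiE)
  have fin: "finite (E \<rightarrow>\<^sub>E (UNIV :: 'k set))" and card: "card (E \<rightarrow>\<^sub>E (UNIV :: 'k set)) = CARD('k) ^ ((d + 1) ^ n)"
    using fin_E by (simp_all add: finite_PiE card_PiE card_E)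
  have sub: "\<Theta> ` frobenius_polys q n d \<subseteq> E \<rightarrow>\<^sub>E UNIV" by (auto simp: \<Theta>_def)
  show "finite (frobenius_polys q n d :: 'k mpoly set)"
    by (rule inj_on_finite[OF inj sub fin])
  show "card (frobenius_polys q n d :: 'k mpoly set) \<le> CARD('k) ^ ((d + 1) ^ n)"
    using card_inj_on_le[OF inj sub fin] by (simp add: card)
qed

lemma frobenius_linearI:
  assumes "\<And>r. r \<in> mpolys n \<Longrightarrow> D r \<in> mpolys n"
    "\<And>r s. r \<in> mpolys n \<Longrightarrow> s \<in> mpolys n \<Longrightarrow> D (r + s) = D r + D s"
    "\<And>c r. r \<in> mpolys n \<Longrightarrow> D (mconst c * r) = mconst c * D r"
    "\<And>j r. j < n \<Longrightarrow> r \<in> mpolys n \<Longrightarrow> D (mvar j ^ q * r) = mvar j ^ q * D r"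
  shows "frobenius_linear q n D"
  unfolding frobenius_linear_def using assms by blast

lemma frobenius_linearD:
  assumes "frobenius_linear q n D" "r \<in> mpolys n"
  shows "D r \<in> mpolys n" "s \<in> mpolys n \<Longrightarrow> D (r + s) = D r + D s"
    "D (mconst c * r) = mconst c * D r" "j < n \<Longrightarrow> D (mvar j ^ q * r) = mvar j ^ q * D r"
  using assms unfolding frobenius_linear_def by blast+

lemma frobenius_linear_add:
  assumes D: "frobenius_linear q n D" and E: "frobenius_linear q n E"
  shows "frobenius_linear q n (\<lambda>r. D r + E r)"
  by (rule frobenius_linearI)
     (simp_all add: frobenius_linearD[OF D] frobenius_linearD[OF E] mpolys_closed distrib_left)

lemma frobenius_linear_mult_left:
  assumes D: "frobenius_linear q n D" and g: "g \<in> mpolys n"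
  shows "frobenius_linear q n (\<lambda>r. g * D r)"
  by (rule frobenius_linearI)
     (simp_all add: frobenius_linearD[OF D] g mpolys_closed distrib_left mult.left_commute)

lemma frobenius_linear_mult_right:
  assumes D: "frobenius_linear q n D" and g: "g \<in> mpolys n"
  shows "frobenius_linear q n (\<lambda>r. D (g * r))"
  by (rule frobenius_linearI)
     (simp_all add: frobenius_linearD[OF D] g mpolys_closed distrib_left mult.left_commute[of g])

lemma frobenius_linear_zero: "frobenius_linear q n (\<lambda>r. 0)"
  by (rule frobenius_linearI) (simp_all add: mpolys_closed)

text \<open>
  The ideal generated by the Frobenius coefficients of \<open>g\<close>; over a perfect field of
  characteristic \<open>p\<close>, with \<open>q\<close> a power of \<open>p\<close>, it is the Frobenius power of the ideal of
  \<open>q\<close>-th roots of \<open>g\<close>.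
\<close>
definition orbit :: "nat \<Rightarrow> nat \<Rightarrow> 'k::comm_ring_1 mpoly \<Rightarrow> 'k mpoly set"
  where "orbit q n g = {D g | D. frobenius_linear q n D}"

lemma orbitI: "frobenius_linear q n D \<Longrightarrow> D g \<in> orbit q n g"
  by (auto simp: orbit_def)

lemma orbitE:
  assumes "h \<in> orbit q n g"
  obtains D where "frobenius_linear q n D" "D g = h"
  using assms unfolding orbit_def by blast

lemma orbit_sum:
  assumes "\<And>i. i \<in> I \<Longrightarrow> h i \<in> orbit q n g"
  shows "(\<Sum>i\<in>I. h i) \<in> orbit q n g"
  using assms
proof (induction I rule: infinite_finite_induct)
  case (insert i I)
  then obtain D E where "frobenius_linear q n D" "h i = D g" "frobenius_linear q n E" "(\<Sum>i\<in>I. h i) = E g"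
    unfolding orbit_def by blast
  then have "frobenius_linear q n (\<lambda>r. D r + E r)" "(\<Sum>i\<in>insert i I. h i) = D g + E g"
    using insert(1,2) by (simp_all add: frobenius_linear_add)
  then show ?case using orbitI[of q n "\<lambda>r. D r + E r" g] by simp
qed (use orbitI[OF frobenius_linear_zero] in simp_all)

lemma orbit_mult:
  assumes "h \<in> orbit q n g" "r \<in> mpolys n"
  shows "r * h \<in> orbit q n g"
proof -
  obtain D where D: "frobenius_linear q n D" "h = D g" using assms(1) by (auto simp: orbit_def)
  show ?thesis
    unfolding D(2) by (rule orbitI[OF frobenius_linear_mult_left[OF D(1) assms(2)]])
qed

lemma orbit_antimono:
  assumes "f \<in> mpolys n" "s \<le> s'"
  shows "orbit q n (f ^ s') \<subseteq> orbit q n (f ^ s)"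
proof
  fix h assume "h \<in> orbit q n (f ^ s')"
  then obtain D where D: "frobenius_linear q n D" "h = D (f ^ s')" by (auto simp: orbit_def)
  have "h = D (f ^ (s' - s) * f ^ s)" using assms(2) D(2) by (simp flip: power_add)
  moreover have "frobenius_linear q n (\<lambda>r. D (f ^ (s' - s) * r))"
    by (rule frobenius_linear_mult_right[OF D(1) mpolys_power[OF assms(1)]])
  ultimately show "h \<in> orbit q n (f ^ s)"
    using orbitI[of q n "\<lambda>r. D (f ^ (s' - s) * r)" "f ^ s"] by simp
qed

text \<open>
  Each exceptional \<open>s\<close> owns a Frobenius coefficient \<open>v s\<close> of \<open>f\<^sup>s\<close> outside the next orbit, since
  \<open>f\<^sup>s\<close> is a combination of its Frobenius coefficients. These have bounded degree, and they are
  distinct because the orbits decrease.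
\<close>
lemma card_jumps:
  fixes f :: "'k::{comm_ring_1, finite} mpoly"
  assumes f: "f \<in> bounded_polys n d" and q: "q > 0"
  shows "finite {s. s < q * c \<and> f ^ s \<notin> orbit q n (f ^ (s + 1))}"
    "card {s. s < q * c \<and> f ^ s \<notin> orbit q n (f ^ (s + 1))} \<le> CARD('k) ^ ((c * d + 1) ^ n)"
proof -
  let ?B = "{s. s < q * c \<and> f ^ s \<notin> orbit q n (f ^ (s + 1))}"
  let ?V = "frobenius_polys q n (c * d) :: 'k mpoly set"
  have fR: "f \<in> mpolys n" using f by (simp add: bounded_polys_def)
  have ex: "\<exists>v\<in>?V. v \<in> orbit q n (f ^ s) \<and> v \<notin> orbit q n (f ^ (s + 1))" if s: "s \<in> ?B" for s
  proof (rule ccontr)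
    assume *: "\<not> ?thesis"
    have "f ^ s \<in> bounded_polys n (s * d)" by (rule bounded_polys_power[OF f])
    moreover have "s * d \<le> (q * c) * d" using s by (intro mult_right_mono) auto
    then have "s * d \<le> q * (c * d)" by (simp only: mult.assoc)
    ultimately have bd: "f ^ s \<in> bounded_polys n (q * (c * d))"
      by (rule bounded_polys_mono)
    have "Poly_Mapping.single u 1 * frobenius_coefficient q u (f ^ s) \<in> orbit q n (f ^ (s + 1))"
      if u: "u \<in> exponent_mod q ` Poly_Mapping.keys (f ^ s)" for u
    proof -
      obtain w where w: "w \<in> Poly_Mapping.keys (f ^ s)" "u = exponent_mod q w" using u by blast
      have lk: "Poly_Mapping.lookup u i = Poly_Mapping.lookup w i mod q" for i
        unfolding w(2) by (rule lookup_exponent_mod)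
      have "frobenius_linear q n (frobenius_coefficient q u :: 'k mpoly \<Rightarrow> 'k mpoly)"
        using q by (intro frobenius_linear_coefficient) (simp add: lk)
      then have "frobenius_coefficient q u (f ^ s) \<in> orbit q n (f ^ s)" by (rule orbitI)
      then have coefficient: "frobenius_coefficient q u (f ^ s) \<in> orbit q n (f ^ (s + 1))"
        using * frobenius_coefficient_bounded[OF bd, of u] by (metis (no_types))
      have "Poly_Mapping.keys w \<subseteq> {..<n}"
        using w(1) mpolys_power[OF fR, of s] by (simp add: mpolys_def)
      moreover have "Poly_Mapping.keys u \<subseteq> Poly_Mapping.keys w"
      proof
        fix i assume "i \<in> Poly_Mapping.keys u"
        then show "i \<in> Poly_Mapping.keys w" by (cases "Poly_Mapping.lookup w i") (auto simp: in_keys_iff lk)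
      qed
      ultimately have "Poly_Mapping.keys u \<subseteq> {..<n}" by blast
      then have "Poly_Mapping.single u 1 \<in> mpolys n" by (simp add: mpolys_def)
      with coefficient show ?thesis by (rule orbit_mult)
    qed
    then have "(\<Sum>u\<in>exponent_mod q ` Poly_Mapping.keys (f ^ s).
        Poly_Mapping.single u 1 * frobenius_coefficient q u (f ^ s)) \<in> orbit q n (f ^ (s + 1))"
      by (rule orbit_sum)
    then have "f ^ s \<in> orbit q n (f ^ (s + 1))"
      by (simp only: frobenius_expansion[OF q, of "f ^ s", symmetric])
    with s show False by blast
  qed
  define v where
    "v s = (SOME v. v \<in> ?V \<and> v \<in> orbit q n (f ^ s) \<and> v \<notin> orbit q n (f ^ (s + 1)))" for s
  have "v s \<in> ?V \<and> v s \<in> orbit q n (f ^ s) \<and> v s \<notin> orbit q n (f ^ (s + 1))" if "s \<in> ?B" for s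
    unfolding v_def by (rule someI_ex) (use ex[OF that] in \<open>unfold Bex_def\<close>)
  note v = this[THEN conjunct1] this[THEN conjunct2, THEN conjunct1] this[THEN conjunct2, THEN conjunct2]
  have neq: "v s \<noteq> v s'" if "s \<in> ?B" "s' \<in> ?B" "s < s'" for s s'
  proof -
    have "orbit q n (f ^ s') \<subseteq> orbit q n (f ^ (s + 1))"
      using that(3) by (intro orbit_antimono[OF fR]) simp
    then have "v s' \<in> orbit q n (f ^ (s + 1))" using v(2)[OF that(2)] by (rule subsetD)
    with v(3)[OF that(1)] show ?thesis by metis
  qed
  have inj: "inj_on v ?B"
  proof (rule inj_onI)
    fix s s' assume *: "s \<in> ?B" "s' \<in> ?B" "v s = v s'"
    show "s = s'"
    proof (rule ccontr)
      assume "s \<noteq> s'"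
      then have "s < s' \<or> s' < s" by (rule linorder_neq_iff[THEN iffD1])
      then show False
      proof
        assume "s < s'"
        from neq[OF *(1,2) this] *(3) show False by (rule notE)
      next
        assume "s' < s"
        from neq[OF *(2,1) this] *(3)[symmetric] show False by (rule notE)
      qed
    qed
  qed
  show "finite ?B" by (rule finite_subset[of _ "{..<q * c}"]) auto
  have "card ?B \<le> card ?V"
    by (rule card_inj_on_le[OF inj _ card_frobenius_polys(1)[OF q]]) (rule image_subsetI, rule v(1))
  then show "card ?B \<le> CARD('k) ^ ((c * d + 1) ^ n)"
    by (rule le_trans[OF _ card_frobenius_polys(2)[OF q]])
qed

text \<open>Finitely many distinct \<open>p\<close>-adic integers have distinct residues at a common level.\<close>
lemma finite_padic_set:
  assumes "X \<subseteq> padic_ints p" and "\<And>e. card ((\<lambda>\<alpha>. \<alpha> (e + m)) ` X) \<le> B" 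
    and "\<And>e. finite ((\<lambda>\<alpha>. \<alpha> (e + m)) ` X)"
  shows "finite X"
proof (rule ccontr)
  assume "infinite X"
  then obtain Y where Y: "Y \<subseteq> X" "finite Y" "card Y = Suc B"
    using infinite_arbitrarily_large[of X "Suc B"] by metis
  define K where "K \<alpha> \<beta> = (SOME k. \<alpha> k \<noteq> \<beta> k)" for \<alpha> \<beta> :: "nat \<Rightarrow> int"
  have K: "\<alpha> (K \<alpha> \<beta>) \<noteq> \<beta> (K \<alpha> \<beta>)" if "\<alpha> \<noteq> \<beta>" for \<alpha> \<beta>
    unfolding K_def by (rule someI_ex) (use that in \<open>simp add: fun_eq_iff\<close>)
  define e where "e = (\<Sum>(\<alpha>, \<beta>)\<in>Y \<times> Y. K \<alpha> \<beta>)"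
  have "inj_on (\<lambda>\<alpha>. \<alpha> (e + m)) Y"
  proof (rule inj_onI, rule ccontr)
    fix \<alpha> \<beta> assume *: "\<alpha> \<in> Y" "\<beta> \<in> Y" "\<alpha> (e + m) = \<beta> (e + m)" "\<alpha> \<noteq> \<beta>"
    have "K \<alpha> \<beta> \<le> e"
      using member_le_sum[of "(\<alpha>, \<beta>)" "Y \<times> Y" "\<lambda>(\<alpha>, \<beta>). K \<alpha> \<beta>"] *(1,2) Y(2)
      by (simp add: e_def)
    then have "K \<alpha> \<beta> \<le> e + m" by simp
    have "\<alpha> \<in> padic_ints p" "\<beta> \<in> padic_ints p" using *(1,2) Y(1) assms(1) by auto
    from padic_ints_mod[OF this(1) \<open>K \<alpha> \<beta> \<le> e + m\<close>] padic_ints_mod[OF this(2) \<open>K \<alpha> \<beta> \<le> e + m\<close>]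
    have "\<alpha> (K \<alpha> \<beta>) = \<beta> (K \<alpha> \<beta>)" using *(3) by simp
    then show False using K[OF *(4)] by simp
  qed
  then have "Suc B = card ((\<lambda>\<alpha>. \<alpha> (e + m)) ` Y)" using Y(3) by (simp add: card_image)
  also have "\<dots> \<le> card ((\<lambda>\<alpha>. \<alpha> (e + m)) ` X)" using Y(1) assms(3) by (intro card_mono image_mono)
  also have "\<dots> \<le> B" by (rule assms(2))
  finally show False by simp
qed

theorem mainTheorem2:
  fixes p m n :: nat
    and f :: "'a::nontriv mod_ring mpoly"
  assumes "prime p"
    and "CARD('a) = p ^ (m + 1)"
    and "f \<in> mpolys n"
    and "nonzerodivisor n f"
  shows "finite (bernstein_sato_roots p n f)"
proof -
  have char: "of_nat (p ^ Suc m) = (0 :: 'a mod_ring)"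
    using of_nat_card_eq_0[where ?'a = 'a] assms(2) by (simp del: of_nat_card_eq_0)
  interpret bernstein_sato_setting p m n "TYPE('a mod_ring)" f
    using assms(1,3) char by unfold_locales auto
  obtain d where d: "f \<in> bounded_polys n d" using bounded_polys_exists[OF assms(3)] .
  let ?jumps = "\<lambda>e. {s. s < p ^ e * p ^ m \<and> f ^ s \<notin> orbit (p ^ e) n (f ^ (s + 1))}"
  have pe: "p ^ e > 0" for e using prime_gt_0_nat[OF assms(1)] by simp
  note jumps = card_jumps[OF d pe, where c = "p ^ m"]
  have roots: "(\<lambda>\<alpha>. \<alpha> (e + m)) ` bernstein_sato_roots p n f \<subseteq> int ` ?jumps e" for e
  proof clarify
    fix \<alpha> assume \<alpha>: "\<alpha> \<in> bernstein_sato_roots p n f"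
    then have padic: "\<alpha> \<in> padic_ints p" by (simp add: bernstein_sato_roots_def)
    then have "0 \<le> \<alpha> (e + m)" "\<alpha> (e + m) < int p ^ (e + m)"
      by (auto simp: padic_ints_def)
    then have "0 \<le> \<alpha> (e + m)" "\<alpha> (e + m) < int (p ^ e * p ^ m)"
      by (simp_all add: power_add)
    then have "\<alpha> (e + m) = int (nat (\<alpha> (e + m)))" "nat (\<alpha> (e + m)) < p ^ e * p ^ m" by linarith+
    then obtain s where s: "\<alpha> (e + m) = int s" "s < p ^ e * p ^ m" by blast
    have "f ^ s \<notin> orbit (p ^ e) n (f ^ (s + 1))"
    proof
      assume "f ^ s \<in> orbit (p ^ e) n (f ^ (s + 1))"
      then obtain D where "frobenius_linear (p ^ e) n D" "D (f ^ (s + 1)) = f ^ s"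
        by (rule orbitE)
      from not_bernstein_sato_root[OF this padic s(1)] \<alpha> show False by simp
    qed
    then show "\<alpha> (e + m) \<in> int ` ?jumps e" using s by auto
  qed
  show ?thesis
  proof (rule finite_padic_set[where m = m])
    show "bernstein_sato_roots p n f \<subseteq> padic_ints p" by (auto simp: bernstein_sato_roots_def)
    fix e
    show "finite ((\<lambda>\<alpha>. \<alpha> (e + m)) ` bernstein_sato_roots p n f)"
      by (rule finite_subset[OF roots]) (simp add: jumps(1))
    have "card ((\<lambda>\<alpha>. \<alpha> (e + m)) ` bernstein_sato_roots p n f) \<le> card (int ` ?jumps e)"
      by (rule card_mono[OF _ roots]) (simp add: jumps(1))
    also have "\<dots> = card (?jumps e)" by (simp add: card_image)
    also have "\<dots> \<le> CARD('a mod_ring) ^ ((p ^ m * d + 1) ^ n)" by (rule jumps(2))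
    finally show "card ((\<lambda>\<alpha>. \<alpha> (e + m)) ` bernstein_sato_roots p n f)
      \<le> CARD('a mod_ring) ^ ((p ^ m * d + 1) ^ n)" .
  qed
qed

end
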